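(* Let $\theta\ne0$ and $\theta^+=\max(\theta,0)$. For every $x_0>0$, uniformly over $x\in[x_0,\infty)$, $$\lim_{n\to\infty}P_n^{\theta/n}(M\ge\sqrt n\,x)=1-e^{-\psi(x)},$$ where $$\psi(x)=\frac{2\theta^+}{\sigma^2}+\frac{3|\theta|}{\sigma^2}\left(\coth^2\left(\sqrt{\frac{|\theta|}{2\sigma_R^2}}\,x\right)-1\right),\quad x>0,$$ is the unique solution to $$\begin{cases}\dfrac{\sigma_R^2}{2}\dfrac{\partial^2\psi}{\partial x^2}=-\theta\psi+\dfrac{\sigma^2}{2}\psi^2,\quad x>0,\\ \lim_{x\to0+}\psi(x)=\infty,\\ \lim_{x\to\infty}\psi(x)=\dfrac{2\theta^+}{\sigma^2}.\end{cases}$$ Moreover, $$\psi(x)\sim\frac{2\theta^+}{\sigma^2}+\frac{12|\theta|}{\sigma^2}\exp\left(-\sqrt{\frac{2|\theta|}{\sigma_R^2}}\,x\right),\quad\text{as }x\to\infty.$$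
   Context: Branching random walk. Fix a jump distribution $\{a_k\}_{k\in\mathbb{Z}}$ on $\mathbb{Z}$ supported in $[-R,R]$ for some $R<\infty$, with mean $0$ and variance $\sigma_R^2>0$. For each $\eta>-1$ fix an offspring distribution $F_B^\eta=\{p_i^\eta\}_{i\ge0}$ with $p_0^\eta>0$, mean $1+\eta$, variance $\sigma^2(\eta)$ and third moment $\gamma(\eta)$; assume $\sigma(0)=\lim_{\eta\to0}\sigma(\eta)=\sigma>0$ and $\sup_{|\eta|<\delta}\gamma(\eta)<\infty$ for some $\delta>0$. $P_n^\eta$ is the law of the discrete-time branching random walk $X=(X_k(x))_{k\ge0,x\in\mathbb{Z}}$ started at generation $0$ by $n$ particles at the origin: in each generation every particle first jumps, independently, according to $\{a_k\}$, and is then replaced at its new site, independently, by a random number of offspring with law $F_B^\eta$; $X_k(x)$ is the number of particles at site $x$ at generation $k$. Only $n$ with $\theta/n>-1$ are considered. Let $L_m(x)=\sum_{k\le m}X_k(x)$, $M_m=\max\{z\in\mathbb{Z}: L_m(z)>0\}$ and $M=\sup_{k\ge0}M_k\in[0,\infty]$ (the rightmost position reached over all generations). Solutions of the ODE are real-valued $C^2$ functions on $(0,\infty)$. $g\sim h$ means $g/h\to1$. *)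

theory Defs
  imports "HOL-Probability.Probability" "HOL-Library.Landau_Symbols"
begin

section \<open>Branching random walk\<close>

text \<open>
  The \<^term>\<open>i\<close>-th particle of generation \<^term>\<open>k\<close> carries the mark \<^term>\<open>\<omega> (k, i)\<close>, a pair of a
  jump and a number of children. It first jumps and is then replaced, at its new site, by its
  children; \<^term>\<open>brw_gen n \<omega> k\<close> lists the positions of the particles of generation \<^term>\<open>k\<close>
  with multiplicity.
\<close>

primrec brw_gen :: "nat \<Rightarrow> (nat \<times> nat \<Rightarrow> int \<times> nat) \<Rightarrow> nat \<Rightarrow> int list" where
  "brw_gen n \<omega> 0 = replicate n 0"
| "brw_gen n \<omega> (Suc k) =
     concat (map (\<lambda>(i, y). replicate (snd (\<omega> (k, i))) (y + fst (\<omega> (k, i))))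
       (List.enumerate 0 (brw_gen n \<omega> k)))"

definition marks :: "int pmf \<Rightarrow> nat pmf \<Rightarrow> (nat \<times> nat \<Rightarrow> int \<times> nat) measure" where
  "marks a p = PiM UNIV (\<lambda>_. measure_pmf (pair_pmf a p))"

text \<open>A path \<^term>\<open>X\<close> records in \<^term>\<open>X k x\<close> the number of particles at site \<^term>\<open>x\<close> at generation
  \<^term>\<open>k\<close>.\<close>

type_synonym path = "nat \<Rightarrow> int \<Rightarrow> nat"

definition path_space :: "path measure" where
  "path_space = PiM UNIV (\<lambda>_. PiM UNIV (\<lambda>_. count_space UNIV))"

definition brw_path :: "nat \<Rightarrow> (nat \<times> nat \<Rightarrow> int \<times> nat) \<Rightarrow> path" where
  "brw_path n \<omega> = (\<lambda>k x. count_list (brw_gen n \<omega> k) x)"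

definition brw_law :: "int pmf \<Rightarrow> nat pmf \<Rightarrow> nat \<Rightarrow> path measure" where
  "brw_law a p n = distr (marks a p) path_space (brw_path n)"

definition local_time :: "path \<Rightarrow> nat \<Rightarrow> int \<Rightarrow> nat" where
  "local_time X m x = (\<Sum>k\<le>m. X k x)"

text \<open>For \<^term>\<open>n \<ge> 1\<close> the set below is finite and nonempty along every \<^term>\<open>brw_path n \<omega>\<close>
  (see below), so that \<^term>\<open>Max\<close> is the true maximum.\<close>

definition max_upto :: "path \<Rightarrow> nat \<Rightarrow> int" where
  "max_upto X m = Max {z. local_time X m z > 0}"

definition max_position :: "path \<Rightarrow> ereal" where
  "max_position X = (SUP m. ereal (real_of_int (max_upto X m)))"


section \<open>The limit equation\<close>

definition coth :: "real \<Rightarrow> real" where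
  "coth x = cosh x / sinh x"

definition psi :: "real \<Rightarrow> real \<Rightarrow> real \<Rightarrow> real \<Rightarrow> real" where
  "psi \<theta> \<sigma> \<sigma>R x =
     2 * max \<theta> 0 / \<sigma>\<^sup>2 + 3 * \<bar>\<theta>\<bar> / \<sigma>\<^sup>2 * ((coth (sqrt (\<bar>\<theta>\<bar> / (2 * \<sigma>R\<^sup>2)) * x))\<^sup>2 - 1)"

text \<open>Solutions live on the open half-line; the values of \<^term>\<open>f\<close> on \<^term>\<open>{..0::real}\<close> are irrelevant.\<close>

definition solves_bvp :: "real \<Rightarrow> real \<Rightarrow> real \<Rightarrow> (real \<Rightarrow> real) \<Rightarrow> bool" where
  "solves_bvp \<theta> \<sigma> \<sigma>R f \<longleftrightarrow>
     (\<exists>f' f''. (\<forall>x>0. (f has_real_derivative f' x) (at x)) \<and>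
               (\<forall>x>0. (f' has_real_derivative f'' x) (at x)) \<and>
               continuous_on {0<..} f'' \<and>
               (\<forall>x>0. \<sigma>R\<^sup>2 / 2 * f'' x = - \<theta> * f x + \<sigma>\<^sup>2 / 2 * (f x)\<^sup>2)) \<and>
     filterlim f at_top (at_right 0) \<and>
     (f \<longlongrightarrow> 2 * max \<theta> 0 / \<sigma>\<^sup>2) at_top"


section \<open>Well-definedness\<close>

lemma space_path_space [simp]: "space path_space = UNIV"
  by (simp add: path_space_def space_PiM)

lemma prob_space_marks: "prob_space (marks a p)"
  unfolding marks_def by (intro prob_space_PiM measure_pmf.prob_space_axioms)

lemma measurable_mark:
  "(\<lambda>\<omega>. \<omega> ki) \<in> measurable (marks a p) (count_space UNIV)"
proof -
  have "(\<lambda>\<omega>. \<omega> ki) \<in> measurable (marks a p) (measure_pmf (pair_pmf a p))"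
    unfolding marks_def by (rule measurable_component_singleton) simp
  then show ?thesis by simp
qed

lemma measurable_brw_step:
  "(\<lambda>\<omega>. concat (map (\<lambda>(i, y). replicate (snd (\<omega> (k, i))) (y + fst (\<omega> (k, i)))) (List.enumerate s ys)))
     \<in> measurable (marks a p) (count_space UNIV)"
proof (induction ys arbitrary: s)
  case Nil
  show ?case by simp
next
  case (Cons y ys)
  have 1: "(\<lambda>\<omega>. (\<lambda>(j, b). replicate b (y + j)) (\<omega> (k, s)))
      \<in> measurable (marks a p) (count_space UNIV)"
    by (rule measurable_compose[OF measurable_mark]) simp
  have "(\<lambda>\<omega>. (\<lambda>(j, b). replicate b (y + j)) (\<omega> (k, s)) @
      concat (map (\<lambda>(i, y). replicate (snd (\<omega> (k, i))) (y + fst (\<omega> (k, i)))) (List.enumerate (Suc s) ys)))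
      \<in> measurable (marks a p) (count_space UNIV)"
    by (rule measurable_compose_countable[OF _ 1, where f = "\<lambda>us \<omega>. us @ concat
          (map (\<lambda>(i, y). replicate (snd (\<omega> (k, i))) (y + fst (\<omega> (k, i)))) (List.enumerate (Suc s) ys))"])
       (rule measurable_compose[OF Cons.IH], simp)
  then show ?case by (simp add: case_prod_unfold)
qed

lemma measurable_brw_gen:
  "(\<lambda>\<omega>. brw_gen n \<omega> k) \<in> measurable (marks a p) (count_space UNIV)"
proof (induction k)
  case 0
  show ?case by simp
next
  case (Suc k)
  show ?case
    unfolding brw_gen.simps
    by (rule measurable_compose_countable[OF measurable_brw_step Suc])
qed

lemma measurable_brw_path: "brw_path n \<in> measurable (marks a p) path_space"
  unfolding brw_path_def path_space_def
  by (intro measurable_PiM_single' measurable_compose[OF measurable_brw_gen]) (auto simp: space_PiM)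

lemma prob_space_brw_law: "prob_space (brw_law a p n)"
  unfolding brw_law_def
  by (intro prob_space.prob_space_distr prob_space_marks measurable_brw_path)

lemma measurable_local_time:
  "(\<lambda>X. local_time X m x) \<in> measurable path_space (count_space UNIV)"
proof -
  have [measurable]: "(\<lambda>X. X k x) \<in> measurable path_space (count_space UNIV)" for k
    unfolding path_space_def
    by (rule measurable_compose[of "\<lambda>X. X k" _ "PiM UNIV (\<lambda>_. count_space UNIV)"])
       (auto intro!: measurable_component_singleton)
  show ?thesis unfolding local_time_def by measurable
qed

lemma measurable_max_upto:
  "(\<lambda>X. max_upto X m) \<in> measurable path_space (count_space UNIV)"
proof -
  define S where "S = (\<lambda>X. {z. local_time X m z > 0})"
  have eq: "max_upto X m = z \<longleftrightarrow>
      (if \<exists>b. \<forall>y. 0 < local_time X m y \<longrightarrow> \<bar>y\<bar> \<le> b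
       then if \<exists>y. 0 < local_time X m y
            then 0 < local_time X m z \<and> (\<forall>y. 0 < local_time X m y \<longrightarrow> y \<le> z)
            else z = Max {}
       else z = the None)" for X z
  proof -
    have fin: "finite (S X) \<longleftrightarrow> (\<exists>b. \<forall>y. 0 < local_time X m y \<longrightarrow> \<bar>y\<bar> \<le> b)"
    proof
      assume f: "finite (S X)"
      have "\<bar>y\<bar> \<le> (\<Sum>y\<in>S X. \<bar>y\<bar>)" if "0 < local_time X m y" for y
        using f that by (intro member_le_sum) (auto simp: S_def)
      then show "\<exists>b. \<forall>y. 0 < local_time X m y \<longrightarrow> \<bar>y\<bar> \<le> b" by blast
    next
      assume "\<exists>b. \<forall>y. 0 < local_time X m y \<longrightarrow> \<bar>y\<bar> \<le> b"
      then obtain b where b: "\<And>y. 0 < local_time X m y \<Longrightarrow> \<bar>y\<bar> \<le> b" by blast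
      have "S X \<subseteq> {-b..b}"
      proof
        fix y assume "y \<in> S X"
        then show "y \<in> {-b..b}" using b[of y] by (auto simp: S_def)
      qed
      then show "finite (S X)" by (rule finite_subset) simp
    qed
    show ?thesis
    proof (cases "finite (S X)")
      case False
      then have "max_upto X m = the None"
        unfolding max_upto_def S_def by (rule Max.infinite)
      then show ?thesis using False fin by auto
    next
      case True
      show ?thesis
      proof (cases "S X = {}")
        case e: True
        then show ?thesis using True fin
          unfolding max_upto_def S_def by auto
      next
        case False
        moreover have "max_upto X m = Max (S X)"
          by (simp add: max_upto_def S_def)
        ultimately have "max_upto X m = z \<longleftrightarrow> z \<in> S X \<and> (\<forall>y\<in>S X. y \<le> z)"
          using True by (simp add: Max_eq_iff)
        then show ?thesis using True \<open>S X \<noteq> {}\<close> fin unfolding S_def by auto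
      qed
    qed
  qed
  have [measurable]: "(\<lambda>X. local_time X m x) \<in> measurable path_space (count_space UNIV)" for x
    by (rule measurable_local_time)
  have *: "(\<lambda>X. max_upto X m) -` {z} \<inter> space path_space \<in> sets path_space" for z
  proof -
    have "Measurable.pred path_space (\<lambda>X. max_upto X m = z)"
      unfolding eq by measurable
    then have "{X \<in> space path_space. max_upto X m = z} \<in> sets path_space"
      by (simp add: pred_def)
    moreover have "(\<lambda>X. max_upto X m) -` {z} \<inter> space path_space
        = {X \<in> space path_space. max_upto X m = z}" by auto
    ultimately show ?thesis by simp
  qed
  show ?thesis
    using * by (subst measurable_count_space_eq2_countable) auto
qed

lemma borel_measurable_max_position: "max_position \<in> borel_measurable path_space"
proof -
  have [measurable]: "(\<lambda>X. ereal (real_of_int (max_upto X m))) \<in> borel_measurable path_space" for m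
    by (rule measurable_compose[OF measurable_max_upto]) simp
  have "(\<lambda>X. SUP m. ereal (real_of_int (max_upto X m))) \<in> borel_measurable path_space"
    by measurable
  then show ?thesis unfolding max_position_def[abs_def] .
qed

lemma measure_brw_law:
  "measure (brw_law a p n) {X. max_position X \<ge> c} =
   measure (marks a p) {\<omega> \<in> space (marks a p). max_position (brw_path n \<omega>) \<ge> c}"
proof -
  have "{X \<in> space path_space. max_position X \<ge> c} \<in> sets path_space"
    using borel_measurable_max_position by measurable
  then have "{X. max_position X \<ge> c} \<in> sets path_space" by simp
  from measure_distr[OF measurable_brw_path this]
  show ?thesis unfolding brw_law_def
    by (auto simp: vimage_def Int_def intro!: arg_cong[where f = "measure (marks a p)"])
qed

lemma local_time_support_brw_path:
  assumes "n \<ge> 1"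
  shows "finite {z. local_time (brw_path n \<omega>) m z > 0}"
    and "{z. local_time (brw_path n \<omega>) m z > 0} \<noteq> {}"
proof -
  have eq: "{z. local_time (brw_path n \<omega>) m z > 0} = (\<Union>k\<le>m. set (brw_gen n \<omega> k))"
    by (auto simp: local_time_def brw_path_def sum_eq_0_iff count_list_0_iff simp flip: neq0_conv)
  show "finite {z. local_time (brw_path n \<omega>) m z > 0}"
    unfolding eq by simp
  have "0 \<in> set (brw_gen n \<omega> 0)" using assms by simp
  then show "{z. local_time (brw_path n \<omega>) m z > 0} \<noteq> {}"
    unfolding eq by blast
qed

end

theory Submission
  imports Defs "HOL-Real_Asymp.Real_Asymp"
begin

text \<open>
  Let \<open>u(z)\<close> be the probability that the descendants of one particle at the origin ever reach \<open>z\<close>. By the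
  branching property the probability in question is \<open>1 - (1 - u)\<^sup>n\<close> at \<open>z = \<lceil>\<surd>n x\<rceil>\<close>, so it suffices that
  \<open>n u \<rightarrow> \<psi>(x)\<close>. Conditioning on the first generation, \<open>u\<close> is the minimal solution of
  \<open>u(z) = \<Sum>\<^sub>j a\<^sub>j Q(u(z - j))\<close> for \<open>z \<ge> 1\<close> with \<open>u = 1\<close> on \<open>z \<le> 0\<close>, where
  \<open>Q(t) = 1 - \<Sum>\<^sub>i p\<^sub>i (1 - t)\<^sup>i = (1 + \<eta>) t - \<sigma>\<^sup>2 t\<^sup>2 / 2 + O(t\<^sup>3)\<close>.
  Solutions \<open>\<psi>\<close> of the limit equation with slightly perturbed \<open>\<sigma>\<close> and \<open>\<sigma>\<^sub>R\<close>, rescaled and shifted by a bounded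
  number of sites, are discrete super- and subsolutions and squeeze \<open>u\<close>. Supersolutions are compared with \<open>u\<close>
  by induction on the generation, subsolutions through the maximum of the ratio to \<open>u\<close>, using that
  \<open>Q(t) / t\<close> is nonincreasing. Uniformity follows from monotonicity in \<open>x\<close> and a lower bound for the survival
  probability. For uniqueness in the boundary value problem, the first integral of the equation turns it into
  an explicitly solvable first-order equation.
\<close>

section \<open>The solution of the limit equation\<close>

text \<open>The obstacle is that the expansion of Q is accurate only near 0, whereas u = 1 at the
  origin, where psi is singular. Two facts get around it. First,
  \<open>psi \<theta> \<sigma> \<rho> (j / sqrt n) / n\<close> tends to
  \<open>6 * \<rho>^2 / (\<sigma>^2 * j^2)\<close>: at bounded lattice distance a barrier has a
  height of order one that the distance alone adjusts, and a bounded shift disappears in the limit.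
  Second, at K jump lengths from the singularity, psi and its second derivative change over one jump
  by a factor close to 1, uniformly in n, so a multiplicative change of the two variances absorbs
  the discretisation error everywhere. The upper bound takes two rounds: a crude barrier, built on a
  bound for Q valid on all of [0, 1], shows that u is small at bounded distance; only then can the
  sharp expansion be used. From below, induction on the generation gives nothing, since the
  iteration increases to u; the ratio argument instead requires the subsolution to lie below u far
  out. For \<theta> > 0 the survival probability supplies this, for \<theta> < 0 a truncation
  does.\<close>

definition csch2 :: "real \<Rightarrow> real" where
  "csch2 y = 1 / (sinh y)\<^sup>2"

definition psi_rate :: "real \<Rightarrow> real \<Rightarrow> real" where
  "psi_rate \<theta> \<rho> = sqrt (\<bar>\<theta>\<bar> / (2 * \<rho>\<^sup>2))"

text \<open>\<open>psi1\<close> and \<open>psi2\<close> are the first two derivatives of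
  \<open>psi\<close> on the positive axis. Since coth^2 - 1 is \<open>csch2\<close>, the second one
  is a polynomial in \<open>csch2\<close> with positive coefficients; positivity, monotonicity and
  ratio bounds are inherited from \<open>csch2\<close>. The parameter \<rho> takes the place of
  \<open>\<sigma>R\<close> because the barriers use perturbed values of it.\<close>

definition psi1 :: "real \<Rightarrow> real \<Rightarrow> real \<Rightarrow> real \<Rightarrow> real" where
  "psi1 \<theta> \<sigma> \<rho> x = 3 * \<bar>\<theta>\<bar> / \<sigma>\<^sup>2 *
     (psi_rate \<theta> \<rho> * (- 2 * cosh (psi_rate \<theta> \<rho> * x) / sinh (psi_rate \<theta> \<rho> * x) ^ 3))"

definition psi2 :: "real \<Rightarrow> real \<Rightarrow> real \<Rightarrow> real \<Rightarrow> real" where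
  "psi2 \<theta> \<sigma> \<rho> x = 3 * \<bar>\<theta>\<bar> / \<sigma>\<^sup>2 * ((psi_rate \<theta> \<rho>)\<^sup>2 *
     (6 * (csch2 (psi_rate \<theta> \<rho> * x))\<^sup>2 + 4 * csch2 (psi_rate \<theta> \<rho> * x)))"

lemma psi_rate_pos: "\<theta> \<noteq> 0 \<Longrightarrow> \<rho> > 0 \<Longrightarrow> psi_rate \<theta> \<rho> > 0"
  by (simp add: psi_rate_def)

lemma psi_rate_sq: "(psi_rate \<theta> \<rho>)\<^sup>2 = \<bar>\<theta>\<bar> / (2 * \<rho>\<^sup>2)"
  by (simp add: psi_rate_def)

lemma csch2_pos: "y > 0 \<Longrightarrow> csch2 y > 0"
  by (simp add: csch2_def)

lemma csch2_antimono: "0 < x \<Longrightarrow> x \<le> y \<Longrightarrow> csch2 y \<le> csch2 x"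
  unfolding csch2_def by (intro divide_left_mono power_mono mult_pos_pos) (auto)

lemma psi_eq:
  assumes "\<theta> \<noteq> 0" "\<rho> > 0" "x > 0"
  shows "psi \<theta> \<sigma> \<rho> x = 2 * max \<theta> 0 / \<sigma>\<^sup>2 + 3 * \<bar>\<theta>\<bar> / \<sigma>\<^sup>2 * csch2 (psi_rate \<theta> \<rho> * x)"
proof -
  have "psi_rate \<theta> \<rho> * x > 0" using psi_rate_pos assms by simp
  then have "sinh (psi_rate \<theta> \<rho> * x) \<noteq> 0" by (metis sinh_real_pos_iff less_irrefl)
  then have "(coth (psi_rate \<theta> \<rho> * x))\<^sup>2 - 1 = csch2 (psi_rate \<theta> \<rho> * x)"
    by (simp add: coth_def csch2_def power_divide cosh_square_eq add_divide_distrib del: sinh_real_zero_iff)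
  then show ?thesis by (simp add: psi_def psi_rate_def)
qed

lemma has_real_derivative_csch2:
  assumes "y > 0"
  shows "(csch2 has_real_derivative (- 2 * cosh y / sinh y ^ 3)) (at y)"
proof -
  have "sinh y > 0" using assms by simp
  then show ?thesis unfolding csch2_def
    by (auto intro!: derivative_eq_intros simp: field_simps power2_eq_square power3_eq_cube)
qed

lemma has_real_derivative_csch2':
  assumes "y > 0"
  shows "((\<lambda>y. - 2 * cosh y / sinh y ^ 3) has_real_derivative (6 * (csch2 y)\<^sup>2 + 4 * csch2 y)) (at y)"
proof -
  have s: "sinh y > 0" using assms by simp
  have c: "cosh y * cosh y = sinh y * sinh y + 1"
    using cosh_square_eq[of y] by (simp add: power2_eq_square)
  have "((\<lambda>y. - 2 * cosh y / sinh y ^ 3) has_real_derivative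
      ((- 2 * sinh y) * sinh y ^ 3 - (- 2 * cosh y) * (3 * sinh y ^ 2 * cosh y)) / (sinh y ^ 3 * sinh y ^ 3)) (at y)"
    using s by (intro DERIV_divide) (auto intro!: derivative_eq_intros)
  also have "((- 2 * sinh y) * sinh y ^ 3 - (- 2 * cosh y) * (3 * sinh y ^ 2 * cosh y)) / (sinh y ^ 3 * sinh y ^ 3)
      = (6 * (cosh y * cosh y) - 2 * (sinh y * sinh y)) / sinh y ^ 4"
  proof -
    have n: "(- 2 * sinh y) * sinh y ^ 3 - (- 2 * cosh y) * (3 * sinh y ^ 2 * cosh y)
        = (6 * (cosh y * cosh y) - 2 * (sinh y * sinh y)) * (sinh y)\<^sup>2"
      by (simp add: algebra_simps eval_nat_numeral)
    have d: "sinh y ^ 3 * sinh y ^ 3 = sinh y ^ 4 * (sinh y)\<^sup>2"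
      by (simp flip: power_add)
    show ?thesis unfolding n d using s by (intro nonzero_mult_divide_mult_cancel_right) auto
  qed
  also have "\<dots> = 6 * (csch2 y)\<^sup>2 + 4 * csch2 y"
    unfolding c using s by (simp add: csch2_def field_simps eval_nat_numeral)
  finally show ?thesis .
qed

lemma has_real_derivative_psi:
  assumes "\<theta> \<noteq> 0" "\<rho> > 0" "x > 0"
  shows "(psi \<theta> \<sigma> \<rho> has_real_derivative psi1 \<theta> \<sigma> \<rho> x) (at x)"
proof -
  let ?l = "psi_rate \<theta> \<rho>"
  have l: "?l > 0" using psi_rate_pos assms by simp
  have d: "((\<lambda>x. csch2 (?l * x)) has_real_derivative
      (- 2 * cosh (?l * x) / sinh (?l * x) ^ 3) * ?l) (at x)"
    by (rule DERIV_chain'[OF _ has_real_derivative_csch2])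
       (use l assms in \<open>auto intro!: derivative_eq_intros\<close>)
  have "((\<lambda>x. 2 * max \<theta> 0 / \<sigma>\<^sup>2 + 3 * \<bar>\<theta>\<bar> / \<sigma>\<^sup>2 * csch2 (?l * x))
      has_real_derivative psi1 \<theta> \<sigma> \<rho> x) (at x)"
    using DERIV_add[OF DERIV_const DERIV_cmult[OF d], of "2 * max \<theta> 0 / \<sigma>\<^sup>2" "3 * \<bar>\<theta>\<bar> / \<sigma>\<^sup>2"]
    by (simp add: psi1_def mult_ac)
  moreover have "eventually (\<lambda>y. 2 * max \<theta> 0 / \<sigma>\<^sup>2 + 3 * \<bar>\<theta>\<bar> / \<sigma>\<^sup>2 * csch2 (?l * y) = psi \<theta> \<sigma> \<rho> y) (nhds x)"
    using eventually_nhds_in_open[of "{0<..}" x] assms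
    by (auto elim!: eventually_mono simp: psi_eq)
  ultimately show ?thesis
    using assms by (subst (asm) DERIV_cong_ev[OF refl _ refl]) auto
qed

lemma has_real_derivative_psi1:
  assumes "\<theta> \<noteq> 0" "\<rho> > 0" "x > 0"
  shows "(psi1 \<theta> \<sigma> \<rho> has_real_derivative psi2 \<theta> \<sigma> \<rho> x) (at x)"
proof -
  let ?l = "psi_rate \<theta> \<rho>"
  have l: "?l > 0" using psi_rate_pos assms by simp
  have d: "((\<lambda>x. - 2 * cosh (?l * x) / sinh (?l * x) ^ 3) has_real_derivative
      (6 * (csch2 (?l * x))\<^sup>2 + 4 * csch2 (?l * x)) * ?l) (at x)"
    by (rule DERIV_chain'[OF _ has_real_derivative_csch2'])
       (use l assms in \<open>auto intro!: derivative_eq_intros\<close>)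
  show ?thesis
    using DERIV_cmult[OF DERIV_cmult[OF d, of ?l], of "3 * \<bar>\<theta>\<bar> / \<sigma>\<^sup>2"]
    unfolding psi1_def[abs_def] psi2_def by (simp add: power2_eq_square mult_ac)
qed

lemma psi_ode:
  assumes "\<theta> \<noteq> 0" "\<rho> > 0" "x > 0" "\<sigma> > 0"
  shows "\<rho>\<^sup>2 / 2 * psi2 \<theta> \<sigma> \<rho> x = - \<theta> * psi \<theta> \<sigma> \<rho> x + \<sigma>\<^sup>2 / 2 * (psi \<theta> \<sigma> \<rho> x)\<^sup>2"
proof -
  let ?c = "csch2 (psi_rate \<theta> \<rho> * x)"
  have 1: "\<rho>\<^sup>2 / 2 * psi2 \<theta> \<sigma> \<rho> x = (\<rho>\<^sup>2 * (\<bar>\<theta>\<bar> / (2 * \<rho>\<^sup>2))) * (3 * \<bar>\<theta>\<bar> / \<sigma>\<^sup>2 * (3 * ?c\<^sup>2 + 2 * ?c))"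
    unfolding psi2_def psi_rate_sq by (simp add: algebra_simps)
  have 2: "\<rho>\<^sup>2 * (\<bar>\<theta>\<bar> / (2 * \<rho>\<^sup>2)) = \<bar>\<theta>\<bar> / 2" using assms by simp
  show ?thesis
  proof (cases "\<theta> > 0")
    case True
    then show ?thesis unfolding 1 2 psi_eq[OF assms(1-3)]
      using assms by (simp add: field_simps power2_eq_square)
  next
    case False
    then have "\<theta> < 0" using assms by simp
    then show ?thesis unfolding 1 2 psi_eq[OF assms(1-3)]
      using assms by (simp add: field_simps power2_eq_square)
  qed
qed

lemma psi2_pos: "\<theta> \<noteq> 0 \<Longrightarrow> \<rho> > 0 \<Longrightarrow> x > 0 \<Longrightarrow> \<sigma> > 0 \<Longrightarrow> psi2 \<theta> \<sigma> \<rho> x > 0"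
  unfolding psi2_def
  by (intro mult_pos_pos add_pos_pos divide_pos_pos zero_less_power csch2_pos psi_rate_pos) auto

lemma psi_gt_limit:
  "\<theta> \<noteq> 0 \<Longrightarrow> \<rho> > 0 \<Longrightarrow> x > 0 \<Longrightarrow> \<sigma> > 0 \<Longrightarrow> psi \<theta> \<sigma> \<rho> x > 2 * max \<theta> 0 / \<sigma>\<^sup>2"
  using csch2_pos[of "psi_rate \<theta> \<rho> * x"] psi_rate_pos[of \<theta> \<rho>] by (simp add: psi_eq)

lemma psi_pos: "\<theta> \<noteq> 0 \<Longrightarrow> \<rho> > 0 \<Longrightarrow> x > 0 \<Longrightarrow> \<sigma> > 0 \<Longrightarrow> psi \<theta> \<sigma> \<rho> x > 0"
  by (rule le_less_trans[OF _ psi_gt_limit]) auto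

lemma psi_antimono:
  assumes "\<theta> \<noteq> 0" "\<rho> > 0" "0 < x" "x \<le> y"
  shows "psi \<theta> \<sigma> \<rho> y \<le> psi \<theta> \<sigma> \<rho> x"
  using assms psi_rate_pos[of \<theta> \<rho>]
  by (auto simp: psi_eq intro!: mult_left_mono divide_right_mono csch2_antimono)

lemma psi2_antimono:
  assumes "\<theta> \<noteq> 0" "\<rho> > 0" "0 < x" "x \<le> y"
  shows "psi2 \<theta> \<sigma> \<rho> y \<le> psi2 \<theta> \<sigma> \<rho> x"
proof -
  have "psi_rate \<theta> \<rho> > 0" using assms psi_rate_pos by simp
  then show ?thesis using assms unfolding psi2_def
    by (intro mult_left_mono add_mono power_mono csch2_antimono less_imp_le[OF csch2_pos]) auto
qed

text \<open>Near 0 the function behaves like y^-2, so a shift by s costs a factor near 1 once y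
  exceeds a large multiple of s; for large y it decays like exp (-2 y), so a small s costs little.
  One K covers both regimes.\<close>

lemma csch2_ratio:
  assumes "\<epsilon> > 0"
  shows "\<exists>K>1. \<exists>s\<^sub>0>0. \<forall>s y. 0 < s \<longrightarrow> s \<le> s\<^sub>0 \<longrightarrow> y \<ge> K * s \<longrightarrow> csch2 (y - s) \<le> (1 + \<epsilon>) * csch2 y"
proof -
  define e where "e = sqrt (1 + \<epsilon>) - 1"
  have e: "e > 0" "(1 + e)\<^sup>2 = 1 + \<epsilon>" using assms by (auto simp: e_def)
  have "((\<lambda>s::real. exp s) \<longlongrightarrow> 1) (at_right 0)" "((\<lambda>s::real. sinh s / s) \<longlongrightarrow> 1) (at_right 0)"
    by real_asymp+
  then have "eventually (\<lambda>s::real. exp s < 1 + e / 2 \<and> sinh s / s < 2) (at_right 0)"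
    using e by (intro eventually_conj order_tendstoD(2)) auto
  then obtain b where b: "b > 0" "\<And>s::real. 0 < s \<Longrightarrow> s < b \<Longrightarrow> exp s < 1 + e / 2 \<and> sinh s / s < 2"
    by (auto simp: eventually_at_right_field)
  \<comment> \<open>From y >= K * s the distance t = y - s is at least 4 s / e, hence
    \<open>sinh s / t\<close> is at most e / 2. Together with exp s < 1 + e / 2 this bounds sinh y /
    sinh t by 1 + e.\<close>
  define K where "K = 1 + 4 / e"
  show ?thesis
  proof (intro exI conjI allI impI)
    show "K > 1" using e by (simp add: K_def)
    show "b / 2 > 0" using b by simp
    fix s y :: real assume s: "0 < s" "s \<le> b / 2" and y: "y \<ge> K * s"
    define t where "t = y - s"
    have t: "t \<ge> 4 / e * s" using y by (simp add: t_def K_def algebra_simps)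
    have t0: "t > 0" using t e s by (intro less_le_trans[OF _ t]) auto
    have sb: "exp s < 1 + e / 2" "sinh s / s < 2" using b s by auto
    have sh: "sinh t > 0" using t0 by simp
    have ct: "cosh t \<le> sinh t * (1 + 1 / t)"
    proof -
      have "t * (cosh t - sinh t) = t * exp (- t)"
        by (simp add: sinh_def cosh_def field_simps)
      also have "\<dots> \<le> sinh t"
      proof -
        have "2 * t * exp (- t) \<le> exp t - exp (- t)"
        proof -
          have "2 * t + 1 \<le> exp (2 * t)" using exp_ge_add_one_self[of "2*t"] by linarith
          then have "(2 * t + 1) * exp (- t) \<le> exp (2 * t) * exp (- t)" by (intro mult_right_mono) auto
          then show ?thesis by (simp add: algebra_simps flip: exp_add)
        qed
        then show ?thesis by (simp add: sinh_def)
      qed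
      finally show ?thesis using t0 by (simp add: field_simps)
    qed
    have "sinh y = sinh t * cosh s + cosh t * sinh s"
      using sinh_add[of t s] by (simp add: t_def)
    also have "\<dots> \<le> sinh t * cosh s + (sinh t * (1 + 1 / t)) * sinh s"
      using ct s by (intro add_mono mult_right_mono) auto
    also have "\<dots> = sinh t * (exp s + sinh s / t)"
      by (simp add: cosh_plus_sinh[of s, symmetric] algebra_simps)
    also have "\<dots> \<le> sinh t * (1 + e)"
    proof -
      have "sinh s / t \<le> sinh s / (4 / e * s)"
        using t s e t0 by (intro divide_left_mono mult_pos_pos divide_pos_pos) auto
      also have "\<dots> = sinh s / s * (e / 4)" using s e by simp
      also have "\<dots> \<le> 2 * (e / 4)" using sb e by (intro mult_right_mono) auto
      finally have "exp s + sinh s / t \<le> 1 + e" using sb(1) by linarith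
      then show ?thesis using sh by (intro mult_left_mono) auto
    qed
    finally have 1: "sinh y \<le> sinh t * (1 + e)" .
    have y0: "sinh y > 0" using t0 s by (simp add: t_def)
    have "(sinh y)\<^sup>2 \<le> (sinh t * (1 + e))\<^sup>2" using 1 y0 by (intro power_mono) auto
    also have "\<dots> = (sinh t)\<^sup>2 * (1 + \<epsilon>)" using e by (simp add: power_mult_distrib)
    finally show "csch2 (y - s) \<le> (1 + \<epsilon>) * csch2 y"
      using y0 sh unfolding csch2_def t_def[symmetric] by (simp add: field_simps)
  qed
qed

text \<open>K is chosen before \<theta>, \<sigma> and \<rho>; only the admissible step
  \<open>r\<^sub>0\<close> depends on them. The crude barrier relies on this order, as its \<rho> is
  chosen in terms of K. The square root in the proof is there because \<open>psi2\<close> contains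
  the square of \<open>csch2\<close>.\<close>

lemma psi_ratio:
  assumes "\<epsilon> > 0"
  shows "\<exists>K>1. \<forall>\<theta> \<sigma> \<rho>. \<theta> \<noteq> 0 \<longrightarrow> \<sigma> > 0 \<longrightarrow> \<rho> > 0 \<longrightarrow> (\<exists>r\<^sub>0>0. \<forall>r x. 0 < r \<longrightarrow> r \<le> r\<^sub>0 \<longrightarrow> x \<ge> K * r \<longrightarrow>
     psi \<theta> \<sigma> \<rho> (x - r) \<le> (1 + \<epsilon>) * psi \<theta> \<sigma> \<rho> x \<and> psi2 \<theta> \<sigma> \<rho> (x - r) \<le> (1 + \<epsilon>) * psi2 \<theta> \<sigma> \<rho> x)"
proof -
  define e where "e = sqrt (1 + \<epsilon>) - 1"
  have e: "e > 0" "(1 + e)\<^sup>2 = 1 + \<epsilon>" using assms by (auto simp: e_def)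
  have e': "1 + e \<le> 1 + \<epsilon>" using e by (simp add: power2_eq_square algebra_simps flip: e(2))
  from csch2_ratio[OF e(1)] obtain K s\<^sub>0 where K: "K > 1" "s\<^sub>0 > 0"
    and *: "\<And>s y. 0 < s \<Longrightarrow> s \<le> s\<^sub>0 \<Longrightarrow> y \<ge> K * s \<Longrightarrow> csch2 (y - s) \<le> (1 + e) * csch2 y"
    by blast
  show ?thesis
  proof (rule exI[of _ K], intro conjI allI impI K(1))
    fix \<theta> \<sigma> \<rho> :: real assume h: "\<theta> \<noteq> 0" "\<sigma> > 0" "\<rho> > 0"
    define l where "l = psi_rate \<theta> \<rho>"
    have l: "l > 0" using psi_rate_pos h by (simp add: l_def)
    let ?f = "psi \<theta> \<sigma> \<rho>" and ?g = "psi2 \<theta> \<sigma> \<rho>"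
    show "\<exists>r\<^sub>0>0. \<forall>r x. 0 < r \<longrightarrow> r \<le> r\<^sub>0 \<longrightarrow> x \<ge> K * r \<longrightarrow>
     ?f (x - r) \<le> (1 + \<epsilon>) * ?f x \<and> ?g (x - r) \<le> (1 + \<epsilon>) * ?g x"
    proof (intro exI[of _ "s\<^sub>0 / l"] conjI allI impI)
      show "s\<^sub>0 / l > 0" using l K by simp
      fix r x
      let ?u = "csch2 (l * (x - r))" and ?v = "csch2 (l * x)"
      assume r: "0 < r" "r \<le> s\<^sub>0 / l" and x: "K * r \<le> x"
      have "1 * r < K * r" using K r by (intro mult_strict_right_mono) auto
      then have xr: "x - r > 0" using x by simp
      have "csch2 (l * x - l * r) \<le> (1 + e) * ?v"
        using l r x by (intro *) (auto simp: field_simps)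
      then have c: "?u \<le> (1 + e) * ?v" by (simp add: right_diff_distrib)
      have cp: "?v > 0" "?u > 0" using l xr r by (auto intro!: csch2_pos)
      have c1: "?u \<le> (1 + \<epsilon>) * ?v"
        using c mult_right_mono[OF e', of "?v"] cp by linarith
      have "(?u)\<^sup>2 \<le> ((1 + e) * ?v)\<^sup>2"
        using c cp by (intro power_mono) auto
      then have c2: "(?u)\<^sup>2 \<le> (1 + \<epsilon>) * (?v)\<^sup>2"
        using e by (simp add: power_mult_distrib)
      have A: "(2 * max \<theta> 0 / \<sigma>\<^sup>2) \<le> (1 + \<epsilon>) * (2 * max \<theta> 0 / \<sigma>\<^sup>2)"
        using assms mult_right_mono[of 1 "1 + \<epsilon>" "2 * max \<theta> 0 / \<sigma>\<^sup>2"] by simp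
      have "?f (x - r) = 2 * max \<theta> 0 / \<sigma>\<^sup>2 + 3 * \<bar>\<theta>\<bar> / \<sigma>\<^sup>2 * ?u"
        unfolding l_def by (rule psi_eq) (use h xr in auto)
      also have "\<dots> \<le> (1 + \<epsilon>) * (2 * max \<theta> 0 / \<sigma>\<^sup>2) + 3 * \<bar>\<theta>\<bar> / \<sigma>\<^sup>2 * ((1 + \<epsilon>) * ?v)"
        using A c1 by (intro add_mono mult_left_mono) auto
      also have "\<dots> = (1 + \<epsilon>) * ?f x"
        using h xr r by (simp add: psi_eq l_def distrib_left)
      finally show "?f (x - r) \<le> (1 + \<epsilon>) * ?f x" .
      have "?g (x - r) \<le> 3 * \<bar>\<theta>\<bar> / \<sigma>\<^sup>2 * (l\<^sup>2 * (6 * ((1 + \<epsilon>) * (?v)\<^sup>2) + 4 * ((1 + \<epsilon>) * ?v)))"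
        unfolding psi2_def l_def[symmetric] using c1 c2 by (intro mult_left_mono add_mono) auto
      also have "\<dots> = (1 + \<epsilon>) * ?g x"
      proof -
        have "c * (q * (6 * (k * u) + 4 * (k * v))) = k * (c * (q * (6 * u + 4 * v)))" for c q k u v :: real
          by (simp add: algebra_simps)
        then show ?thesis unfolding psi2_def l_def by blast
      qed
      finally show "?g (x - r) \<le> (1 + \<epsilon>) * ?g x" .
    qed
  qed
qed

lemma tendsto_psi_at_top:
  assumes "\<theta> \<noteq> 0" "\<rho> > 0"
  shows "(psi \<theta> \<sigma> \<rho> \<longlongrightarrow> 2 * max \<theta> 0 / \<sigma>\<^sup>2) at_top"
proof -
  have l: "psi_rate \<theta> \<rho> > 0" using psi_rate_pos assms by simp
  have "((\<lambda>x. csch2 (psi_rate \<theta> \<rho> * x)) \<longlongrightarrow> 0) at_top"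
    unfolding csch2_def using l by real_asymp
  then have "((\<lambda>x. 2 * max \<theta> 0 / \<sigma>\<^sup>2 + 3 * \<bar>\<theta>\<bar> / \<sigma>\<^sup>2 * csch2 (psi_rate \<theta> \<rho> * x))
      \<longlongrightarrow> 2 * max \<theta> 0 / \<sigma>\<^sup>2 + 3 * \<bar>\<theta>\<bar> / \<sigma>\<^sup>2 * 0) at_top"
    by (intro tendsto_intros)
  then show ?thesis unfolding mult_zero_right add_0_right
    by (rule Lim_transform_eventually)
       (rule eventually_mono[OF eventually_gt_at_top[of 0]], simp add: psi_eq assms)
qed

text \<open>As \<open>csch2 y\<close> is asymptotic to y^-2 at 0, \<theta> cancels between the
  prefactor and the rate. The limit, of order j^-2, is the height of a barrier at lattice distance j
  from its singularity, and is used to tune the starting heights of all barriers.\<close>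

lemma tendsto_psi_scaled:
  assumes "\<theta> \<noteq> 0" "\<rho> > 0" "\<sigma> > 0" "j > 0"
  shows "(\<lambda>n. psi \<theta> \<sigma> \<rho> (j / sqrt (real n)) / real n) \<longlonglongrightarrow> 6 * \<rho>\<^sup>2 / (\<sigma>\<^sup>2 * j\<^sup>2)"
proof -
  define l where "l = psi_rate \<theta> \<rho>"
  have l: "l > 0" using psi_rate_pos assms by (simp add: l_def)
  have *: "(\<lambda>n. csch2 (l * (j / sqrt (real n))) / real n) \<longlonglongrightarrow> 1 / (l * j)\<^sup>2"
  proof -
    have "(\<lambda>n. csch2 (l * (j / sqrt (real n))) / real n) \<longlonglongrightarrow> inverse ((j * l)\<^sup>2)"
      unfolding csch2_def using l assms by real_asymp
    then show ?thesis by (simp add: inverse_eq_divide mult.commute)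
  qed
  have "(\<lambda>n. 2 * max \<theta> 0 / \<sigma>\<^sup>2 / real n + 3 * \<bar>\<theta>\<bar> / \<sigma>\<^sup>2 * (csch2 (l * (j / sqrt (real n))) / real n))
     \<longlonglongrightarrow> 0 + 3 * \<bar>\<theta>\<bar> / \<sigma>\<^sup>2 * (1 / (l * j)\<^sup>2)"
    by (intro tendsto_add tendsto_mult tendsto_const lim_const_over_n *)
  also have "0 + 3 * \<bar>\<theta>\<bar> / \<sigma>\<^sup>2 * (1 / (l * j)\<^sup>2) = 6 * \<rho>\<^sup>2 / (\<sigma>\<^sup>2 * j\<^sup>2)"
    using assms by (simp add: l_def power_mult_distrib psi_rate_sq field_simps)
  finally show ?thesis
    by (rule Lim_transform_eventually)
       (rule eventually_mono[OF eventually_gt_at_top[of 0]], simp add: psi_eq assms l_def add_divide_distrib)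
qed

lemma tendsto_psi:
  assumes "\<theta> \<noteq> 0" "\<rho> > 0" "\<sigma> > 0" "x > 0"
    and "(s \<longlongrightarrow> \<sigma>) F" "(r \<longlongrightarrow> \<rho>) F" "(y \<longlongrightarrow> x) F"
  shows "((\<lambda>n. psi \<theta> (s n) (r n) (y n)) \<longlongrightarrow> psi \<theta> \<sigma> \<rho> x) F"
  unfolding psi_def coth_def using assms
  by (intro tendsto_intros) (auto simp: real_sqrt_eq_zero_cancel_iff)

text \<open>12 = 3 * 4, because \<open>csch2 y\<close> is asymptotic to 4 exp (-2 y), and the rate
  in the exponential is twice \<open>psi_rate\<close>. For \<theta> < 0 the constant term vanishes,
  so the exponentials themselves must match; their quotient is exactly 1 / (1 - exp (-2 l
  x))^2.\<close>

lemma psi_asymp_equiv: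
  assumes "\<theta> \<noteq> 0" "\<rho> > 0" "\<sigma> > 0"
  shows "psi \<theta> \<sigma> \<rho> \<sim>[at_top]
           (\<lambda>x. 2 * max \<theta> 0 / \<sigma>\<^sup>2 + 12 * \<bar>\<theta>\<bar> / \<sigma>\<^sup>2 * exp (- (sqrt (2 * \<bar>\<theta>\<bar> / \<rho>\<^sup>2) * x)))"
proof -
  define l where "l = psi_rate \<theta> \<rho>"
  have l: "l > 0" using psi_rate_pos assms by (simp add: l_def)
  have 2: "sqrt (2 * \<bar>\<theta>\<bar> / \<rho>\<^sup>2) = 2 * l"
  proof -
    have "sqrt (2 * \<bar>\<theta>\<bar> / \<rho>\<^sup>2) = sqrt (2\<^sup>2 * (\<bar>\<theta>\<bar> / (2 * \<rho>\<^sup>2)))" by simp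
    then show ?thesis unfolding real_sqrt_mult l_def psi_rate_def by simp
  qed
  have "(\<lambda>x. 2 * max \<theta> 0 / \<sigma>\<^sup>2 + 3 * \<bar>\<theta>\<bar> / \<sigma>\<^sup>2 * csch2 (l * x)) \<sim>[at_top]
     (\<lambda>x. 2 * max \<theta> 0 / \<sigma>\<^sup>2 + 12 * \<bar>\<theta>\<bar> / \<sigma>\<^sup>2 * exp (- (2 * l * x)))"
  proof (cases "\<theta> > 0")
    case True
    define c d where "c = 2 * \<theta> / \<sigma>\<^sup>2" and "d = \<theta> / \<sigma>\<^sup>2"
    have cd: "c > 0" "d > 0" using True assms by (auto simp: c_def d_def)
    have "(\<lambda>x. c + 3 * d * csch2 (l * x)) \<sim>[at_top] (\<lambda>x. c + 12 * d * exp (- (2 * l * x)))"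
      unfolding csch2_def using l cd by real_asymp
    then show ?thesis using True by (simp add: c_def d_def)
  next
    case False
    define d where "d = \<bar>\<theta>\<bar> / \<sigma>\<^sup>2"
    have cd: "d > 0" using assms by (auto simp: d_def)
    have "((\<lambda>x. 3 * d * csch2 (l * x) / (12 * d * exp (- (2 * l * x)))) \<longlongrightarrow> 1) at_top"
    proof -
      have "((\<lambda>x. 1 / (1 - exp (- (2 * l * x)))\<^sup>2) \<longlongrightarrow> 1) at_top" using l by real_asymp
      moreover have "3 * d * csch2 (l * x) / (12 * d * exp (- (2 * l * x))) = 1 / (1 - exp (- (2 * l * x)))\<^sup>2" for x
      proof -
        have "sinh (l * x) = exp (l * x) * (1 - exp (- (2 * l * x))) / 2"
          by (simp add: sinh_def algebra_simps flip: exp_add)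
        then have "(sinh (l * x))\<^sup>2 = exp (2 * l * x) * (1 - exp (- (2 * l * x)))\<^sup>2 / 4"
        proof -
          have "(exp (l * x))\<^sup>2 = exp (2 * l * x)" by (simp add: power2_eq_square flip: exp_add)
          then show ?thesis unfolding \<open>sinh (l * x) = _\<close> power_divide power_mult_distrib by simp
        qed
        moreover have "3 * d * (1 / (e * q / 4)) / (12 * d * inverse e) = 1 / q" if "e > 0" for e q :: real
          using that cd by (cases "q = 0") (simp_all add: field_simps)
        ultimately show ?thesis unfolding csch2_def exp_minus by (metis exp_gt_zero)
      qed
      ultimately show ?thesis by simp
    qed
    then have "(\<lambda>x. 3 * d * csch2 (l * x)) \<sim>[at_top] (\<lambda>x. 12 * d * exp (- (2 * l * x)))"
      by (rule asymp_equivI')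
    then show ?thesis using False by (simp add: d_def)
  qed
  then show ?thesis unfolding 2
    by (rule asymp_equiv_cong[THEN iffD1, rotated -1])
       (rule eventually_mono[OF eventually_gt_at_top[of 0]], simp_all add: psi_eq assms l_def)
qed

lemma solves_bvp_psi:
  assumes "\<theta> \<noteq> 0" "\<rho> > 0" "\<sigma> > 0"
  shows "solves_bvp \<theta> \<sigma> \<rho> (psi \<theta> \<sigma> \<rho>)"
proof -
  define l where "l = psi_rate \<theta> \<rho>"
  have l: "l > 0" using psi_rate_pos assms by (simp add: l_def)
  have 1: "continuous_on {0<..} (psi2 \<theta> \<sigma> \<rho>)"
    unfolding psi2_def csch2_def l_def[symmetric] using l
    by (intro continuous_intros) auto
  have "filterlim (\<lambda>x. csch2 (l * x)) at_top (at_right 0)"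
    unfolding csch2_def using l by real_asymp
  then have "filterlim (\<lambda>x. 2 * max \<theta> 0 / \<sigma>\<^sup>2 + 3 * \<bar>\<theta>\<bar> / \<sigma>\<^sup>2 * csch2 (l * x)) at_top (at_right 0)"
    using assms by (intro filterlim_tendsto_add_at_top[OF tendsto_const]
      filterlim_tendsto_pos_mult_at_top[OF tendsto_const]) auto
  moreover have "eventually (\<lambda>x. 2 * max \<theta> 0 / \<sigma>\<^sup>2 + 3 * \<bar>\<theta>\<bar> / \<sigma>\<^sup>2 * csch2 (l * x) = psi \<theta> \<sigma> \<rho> x) (at_right 0)"
    using eventually_at_right_less[of 0] assms by (auto elim!: eventually_mono simp: psi_eq l_def)
  ultimately have 2: "filterlim (psi \<theta> \<sigma> \<rho>) at_top (at_right 0)"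
    by (simp cong: filterlim_cong)
  show ?thesis
    unfolding solves_bvp_def using 1 2 assms
    by (intro conjI exI[where x = "psi1 \<theta> \<sigma> \<rho>"] exI[where x = "psi2 \<theta> \<sigma> \<rho>"] allI impI)
       (auto simp: psi_ode[simplified] tendsto_psi_at_top intro: has_real_derivative_psi has_real_derivative_psi1)
qed

section \<open>Uniqueness for the limit equation\<close>

text \<open>Multiplying the equation by f' and integrating gives f'^2 as a cubic in f plus a
  constant. The limit value L is a critical point of the cubic; with the constant that makes f'
  vanish at L it is a double root, and L - 3 |\<theta>| / \<sigma>^2 is the third.\<close>

lemma bvp_first_integral:
  assumes f: "solves_bvp \<theta> \<sigma> \<rho> f" and pos: "\<theta> \<noteq> 0" "\<rho> > 0" "\<sigma> > 0"
  defines "L \<equiv> 2 * max \<theta> 0 / \<sigma>\<^sup>2"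
  shows "\<exists>f'. (\<forall>x>0. (f has_real_derivative f' x) (at x)) \<and> continuous_on {0<..} f' \<and>
    (\<forall>x>0. (f' x)\<^sup>2 = 2 * \<sigma>\<^sup>2 / (3 * \<rho>\<^sup>2) * (f x - L)\<^sup>2 * (f x - L + 3 * \<bar>\<theta>\<bar> / \<sigma>\<^sup>2))"
proof -
  from f obtain f' f'' where
    d1: "\<And>x. x > 0 \<Longrightarrow> (f has_real_derivative f' x) (at x)"
    and d2: "\<And>x. x > 0 \<Longrightarrow> (f' has_real_derivative f'' x) (at x)"
    and ode: "\<And>x. x > 0 \<Longrightarrow> \<rho>\<^sup>2 / 2 * f'' x = - \<theta> * f x + \<sigma>\<^sup>2 / 2 * (f x)\<^sup>2"
    and lim: "(f \<longlongrightarrow> L) at_top"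
    unfolding solves_bvp_def L_def by blast
  define \<kappa> where "\<kappa> = 2 * \<sigma>\<^sup>2 / (3 * \<rho>\<^sup>2)"
  define D where "D = 3 * \<bar>\<theta>\<bar> / \<sigma>\<^sup>2"
  define E where "E = (\<lambda>x. (f' x)\<^sup>2 - \<kappa> * (f x - L)\<^sup>2 * (f x - L + D))"
  have dE: "(E has_real_derivative 0) (at x)" if "x > 0" for x
  proof -
    have "(E has_real_derivative (2 * f' x * f'' x - \<kappa> * (2 * (f x - L) * f' x * (f x - L + D) + (f x - L)\<^sup>2 * f' x))) (at x)"
      unfolding E_def using d1[OF that] d2[OF that]
      by (auto intro!: derivative_eq_intros simp: algebra_simps)
    moreover have "2 * f'' x = \<kappa> * (2 * (f x - L) * (f x - L + D) + (f x - L)\<^sup>2)"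
    proof -
      have 1: "f'' x = 2 / \<rho>\<^sup>2 * (- \<theta> * f x + \<sigma>\<^sup>2 / 2 * (f x)\<^sup>2)"
        unfolding ode[OF that, symmetric] using pos by simp
      show ?thesis
      proof (cases "\<theta> > 0")
        case True
        then show ?thesis unfolding 1 L_def D_def \<kappa>_def using pos
          by (simp add: divide_simps) (simp add: algebra_simps eval_nat_numeral)
      next
        case False
        then have "\<theta> < 0" using pos by simp
        then show ?thesis unfolding 1 L_def D_def \<kappa>_def using pos
          by (simp add: divide_simps) (simp add: algebra_simps eval_nat_numeral)
      qed
    qed
    then have "2 * f' x * f'' x = f' x * (\<kappa> * (2 * (f x - L) * (f x - L + D) + (f x - L)\<^sup>2))"
      by (metis mult.assoc mult.commute)
    ultimately show ?thesis by (simp add: algebra_simps)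
  qed
  have "\<exists>c. \<forall>x\<in>{0<..}. E x = c"
    by (rule has_field_derivative_zero_constant) (auto intro: DERIV_subset[OF dE])
  then obtain c where c: "\<And>x. x > 0 \<Longrightarrow> E x = c" by auto
  have sq: "(f' x)\<^sup>2 = c + \<kappa> * (f x - L)\<^sup>2 * (f x - L + D)" if "x > 0" for x
    using c[OF that] by (simp add: E_def)
  have "((\<lambda>x. c + \<kappa> * (f x - L)\<^sup>2 * (f x - L + D)) \<longlongrightarrow> c + \<kappa> * (L - L)\<^sup>2 * (L - L + D)) at_top"
    by (intro tendsto_intros lim)
  then have "((\<lambda>x. c + \<kappa> * (f x - L)\<^sup>2 * (f x - L + D)) \<longlongrightarrow> c) at_top" by simp
  moreover have "eventually (\<lambda>x. c + \<kappa> * (f x - L)\<^sup>2 * (f x - L + D) = (f' x)\<^sup>2) at_top"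
    by (rule eventually_mono[OF eventually_gt_at_top[of 0]]) (simp add: sq)
  ultimately have lsq: "((\<lambda>x. (f' x)\<^sup>2) \<longlongrightarrow> c) at_top" by (rule Lim_transform_eventually)
  have "c \<ge> 0" by (rule tendsto_lowerbound[OF lsq]) auto
  \<comment> \<open>The constant c is the limit of f'^2. If it were positive, |f'| would stay
    bounded away from 0 far out, while the increments f (x + 1) - f x tend to 0; the mean value
    theorem rules this out.\<close>
  have "c = 0"
  proof (rule ccontr)
    assume "c \<noteq> 0"
    then have cp: "c > 0" using \<open>c \<ge> 0\<close> by simp
    then have "eventually (\<lambda>x. (f' x)\<^sup>2 > c / 2) at_top" by (intro order_tendstoD[OF lsq]) auto
    then obtain N where N: "\<And>x. x \<ge> N \<Longrightarrow> (f' x)\<^sup>2 > c / 2" by (auto simp: eventually_at_top_linorder)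
    have "filterlim (\<lambda>x::real. x + 1) at_top at_top" by real_asymp
    then have "((\<lambda>x. f (x + 1)) \<longlongrightarrow> L) at_top" by (rule filterlim_compose[OF lim])
    then have "((\<lambda>x. (f (x + 1) - f x)\<^sup>2) \<longlongrightarrow> (L - L)\<^sup>2) at_top" by (intro tendsto_intros lim)
    then have *: "((\<lambda>x. (f (x + 1) - f x)\<^sup>2) \<longlongrightarrow> 0) at_top" by simp
    have "eventually (\<lambda>x. (f (x + 1) - f x)\<^sup>2 < c / 2) at_top" using cp by (intro order_tendstoD(2)[OF *]) simp
    then have "eventually (\<lambda>x. (f (x + 1) - f x)\<^sup>2 < c / 2 \<and> x > max N 0) at_top"
      by (intro eventually_conj eventually_gt_at_top)
    then obtain x where x: "(f (x + 1) - f x)\<^sup>2 < c / 2" "x > max N 0"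
      by (auto simp: eventually_at_top_linorder)
    obtain z where z: "x < z" "f (x + 1) - f x = (x + 1 - x) * f' z"
      using MVT2[of x "x + 1" f f'] d1 x by auto
    then have "(f' z)\<^sup>2 < c / 2" using x by simp
    moreover have "(f' z)\<^sup>2 > c / 2" using N[of z] x z by simp
    ultimately show False by simp
  qed
  moreover have "continuous_on {0<..} f'"
    by (rule DERIV_continuous_on[OF DERIV_subset[OF d2]]) auto
  ultimately show ?thesis
    using d1 sq unfolding D_def \<kappa>_def by (intro exI[of _ f']) auto
qed

text \<open>Where \<^term>\<open>f\<close> meets its limit \<open>L\<close>, the first integral gives \<open>\<bar>f'\<bar> \<le> C \<bar>f - L\<bar>\<close> nearby, so
  \<^term>\<open>f\<close> would equal \<open>L\<close> all the way down to 0, against the blow-up there.\<close>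

lemma bvp_gt_limit:
  assumes f: "solves_bvp \<theta> \<sigma> \<rho> f" and pos: "\<theta> \<noteq> 0" "\<rho> > 0" "\<sigma> > 0" and x: "x > 0"
  shows "f x > 2 * max \<theta> 0 / \<sigma>\<^sup>2"
proof (rule ccontr)
  define L where "L = 2 * max \<theta> 0 / \<sigma>\<^sup>2"
  define D where "D = 3 * \<bar>\<theta>\<bar> / \<sigma>\<^sup>2"
  define \<kappa> where "\<kappa> = 2 * \<sigma>\<^sup>2 / (3 * \<rho>\<^sup>2)"
  have kD: "\<kappa> > 0" "D > 0" using pos by (auto simp: \<kappa>_def D_def)
  from bvp_first_integral[OF f pos] obtain f' where
    d: "\<And>x. x > 0 \<Longrightarrow> (f has_real_derivative f' x) (at x)"
    and sq: "\<And>x. x > 0 \<Longrightarrow> (f' x)\<^sup>2 = \<kappa> * (f x - L)\<^sup>2 * (f x - L + D)"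
    unfolding L_def D_def \<kappa>_def by blast
  have cont: "continuous_on {0<..} f"
    by (rule DERIV_continuous_on[OF DERIV_subset[OF d]]) auto
  have top: "filterlim f at_top (at_right 0)" using f by (simp add: solves_bvp_def)
  then have ev: "eventually (\<lambda>y. f y > L) (at_right 0)" by (simp add: filterlim_at_top_dense)
  then obtain b where b: "b > 0" "\<And>y. 0 < y \<Longrightarrow> y < b \<Longrightarrow> f y > L"
    by (auto simp: eventually_at_right_field)
  assume "\<not> f x > 2 * max \<theta> 0 / \<sigma>\<^sup>2"
  then have fx: "f x \<le> L" by (simp add: L_def)
  define y0 where "y0 = min (b / 2) x"
  have y0: "0 < y0" "y0 \<le> x" "y0 < b" using b x by (auto simp: y0_def)
  then have y0L: "f y0 \<ge> L" using b(2)[of y0] by simp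
  have "continuous_on {y0..x} f" using y0 by (intro continuous_on_subset[OF cont]) auto
  then obtain x2 where x2: "y0 \<le> x2" "x2 \<le> x" "f x2 = L"
    using IVT2'[of f x L y0] fx y0 y0L by auto
  have eqL: "f a = L" if a: "0 < a" "a \<le> x2" for a
  proof -
    have "compact (f ` {a..x2})"
      using a by (intro compact_continuous_image continuous_on_subset[OF cont]) auto
    then have "bounded (f ` {a..x2})" by (rule compact_imp_bounded)
    then obtain B where "\<forall>z\<in>f ` {a..x2}. norm z \<le> B" unfolding bounded_iff by blast
    then have B: "\<bar>f y\<bar> \<le> B" if "a \<le> y" "y \<le> x2" for y using that by auto
    define C where "C = sqrt (\<kappa> * (\<bar>B\<bar> + \<bar>L\<bar> + D))"
    have C0: "C \<ge> 0" "C\<^sup>2 = \<kappa> * (\<bar>B\<bar> + \<bar>L\<bar> + D)" using kD by (auto simp: C_def)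
    have bd: "\<bar>f' y\<bar> \<le> C * \<bar>f y - L\<bar>" if "a \<le> y" "y \<le> x2" for y
    proof -
      have "(f' y)\<^sup>2 = (f y - L)\<^sup>2 * (\<kappa> * (f y - L + D))" using sq[of y] that a by simp
      also have "\<dots> \<le> (f y - L)\<^sup>2 * (\<kappa> * (\<bar>B\<bar> + \<bar>L\<bar> + D))"
        using kD B[OF that] by (intro mult_left_mono) auto
      also have "\<dots> = (C * \<bar>f y - L\<bar>)\<^sup>2" by (simp add: power_mult_distrib C0)
      finally show ?thesis using C0 by (intro power2_le_imp_le[of "\<bar>f' y\<bar>"]) auto
    qed
    \<comment> \<open>Gronwall's argument, run backwards from x2: the exponential weight makes h
      nondecreasing, and h is nonnegative and vanishes at x2.\<close>
    define h where "h = (\<lambda>y. (f y - L)\<^sup>2 * exp (2 * C * y))"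
    have "h a \<le> h x2"
    proof (rule DERIV_nonneg_imp_nondecreasing[OF a(2)])
      fix y assume y: "a \<le> y" "y \<le> x2"
      have "(h has_real_derivative (2 * (f y - L) * f' y + 2 * C * (f y - L)\<^sup>2) * exp (2 * C * y)) (at y)"
        unfolding h_def using d[of y] a y by (auto intro!: derivative_eq_intros simp: algebra_simps)
      moreover have "(f y - L) * f' y + C * (f y - L)\<^sup>2 \<ge> 0"
      proof -
        have "\<bar>(f y - L) * f' y\<bar> \<le> \<bar>f y - L\<bar> * (C * \<bar>f y - L\<bar>)"
          unfolding abs_mult using bd[OF y] by (intro mult_left_mono) auto
        also have "\<dots> = C * (f y - L)\<^sup>2" by (simp add: power2_eq_square)
        finally show ?thesis by linarith
      qed
      then have "(2 * (f y - L) * f' y + 2 * C * (f y - L)\<^sup>2) * exp (2 * C * y) \<ge> 0"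
        by (intro mult_nonneg_nonneg) (auto simp: algebra_simps)
      ultimately show "\<exists>z. (h has_real_derivative z) (at y) \<and> 0 \<le> z"
        by blast
    qed
    then have "h a \<le> 0" using x2 by (simp add: h_def)
    then show "f a = L" by (simp add: h_def mult_le_0_iff not_le[symmetric])
  qed
  have "min (b/2) x2 > 0" using b y0 x2 by auto
  then have "f (min (b/2) x2) > L" using b by auto
  moreover have "f (min (b/2) x2) = L" using \<open>min (b/2) x2 > 0\<close> by (intro eqL) auto
  ultimately show False by simp
qed

text \<open>Only the sign of the square root is open. As f stays above L, f' has no zero and hence a
  constant sign; were it positive at x, f would be at most f x on the whole interval left of x,
  against the blow-up at 0.\<close>

lemma bvp_derivative:
  assumes f: "solves_bvp \<theta> \<sigma> \<rho> f" and pos: "\<theta> \<noteq> 0" "\<rho> > 0" "\<sigma> > 0" and x: "x > 0"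
  defines "L \<equiv> 2 * max \<theta> 0 / \<sigma>\<^sup>2"
  shows "(f has_real_derivative
    (- sqrt (2 * \<sigma>\<^sup>2 / (3 * \<rho>\<^sup>2)) * (f x - L) * sqrt (f x - L + 3 * \<bar>\<theta>\<bar> / \<sigma>\<^sup>2))) (at x)"
proof -
  define D where "D = 3 * \<bar>\<theta>\<bar> / \<sigma>\<^sup>2"
  define \<kappa> where "\<kappa> = 2 * \<sigma>\<^sup>2 / (3 * \<rho>\<^sup>2)"
  have kD: "\<kappa> > 0" "D > 0" using pos by (auto simp: \<kappa>_def D_def)
  from bvp_first_integral[OF f pos] obtain f' where
    d: "\<And>x. x > 0 \<Longrightarrow> (f has_real_derivative f' x) (at x)"
    and cont: "continuous_on {0<..} f'"
    and sq: "\<And>x. x > 0 \<Longrightarrow> (f' x)\<^sup>2 = \<kappa> * (f x - L)\<^sup>2 * (f x - L + D)"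
    unfolding L_def D_def \<kappa>_def by blast
  have gt: "f x > L" if "x > 0" for x using bvp_gt_limit[OF f pos that] by (simp add: L_def)
  have nz: "f' x \<noteq> 0" if "x > 0" for x
  proof
    assume "f' x = 0"
    then have "\<kappa> * (f x - L)\<^sup>2 * (f x - L + D) = 0" using sq[OF that] by simp
    then show False using gt[OF that] kD by simp
  qed
  have neg: "f' x < 0"
  proof (rule ccontr)
    assume "\<not> f' x < 0"
    have p: "f' y \<ge> 0" if y: "0 < y" "y \<le> x" for y
    proof (rule ccontr)
      assume "\<not> f' y \<ge> 0"
      moreover have "continuous_on {y..x} f'" using y by (intro continuous_on_subset[OF cont]) auto
      ultimately obtain z where "y \<le> z" "z \<le> x" "f' z = 0"
        using IVT'[of f' y 0 x] \<open>\<not> f' x < 0\<close> y by auto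
      then show False using nz[of z] y by auto
    qed
    have le: "f y \<le> f x" if "0 < y" "y \<le> x" for y
      by (rule DERIV_nonneg_imp_nondecreasing[OF that(2)]) (use d p that in \<open>meson less_le_trans\<close>)
    have "filterlim f at_top (at_right 0)" using f by (simp add: solves_bvp_def)
    then have "eventually (\<lambda>y. f y > f x) (at_right 0)" by (simp add: filterlim_at_top_dense)
    then obtain b where b: "b > 0" "\<And>y. 0 < y \<Longrightarrow> y < b \<Longrightarrow> f y > f x"
      by (auto simp: eventually_at_right_field)
    have "0 < min (b/2) x" "min (b/2) x < b" "min (b/2) x \<le> x" using b(1) x by auto
    then show False using le[of "min (b/2) x"] b(2)[of "min (b/2) x"] by linarith
  qed
  have "sqrt ((f' x)\<^sup>2) = sqrt \<kappa> * \<bar>f x - L\<bar> * sqrt (f x - L + D)"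
    unfolding sq[OF x] by (simp add: real_sqrt_mult)
  then have "f' x = - sqrt \<kappa> * (f x - L) * sqrt (f x - L + D)" using neg gt[OF x] by simp
  then show ?thesis using d[OF x] unfolding \<kappa>_def D_def by metis
qed

text \<open>With \<open>g\<^sup>2 = f - L + b\<^sup>2\<close> the first-order equation says that \<open>ln ((g + b) / (g - b))\<close> has constant
  derivative; the blow-up at 0 makes it vanish there.\<close>

lemma bvp_explicit:
  assumes f: "solves_bvp \<theta> \<sigma> \<rho> f" and pos: "\<theta> \<noteq> 0" "\<rho> > 0" "\<sigma> > 0" and x: "x > 0"
  defines "L \<equiv> 2 * max \<theta> 0 / \<sigma>\<^sup>2" and "b \<equiv> sqrt (3 * \<bar>\<theta>\<bar> / \<sigma>\<^sup>2)"
  defines "E \<equiv> exp (b * sqrt (2 * \<sigma>\<^sup>2 / (3 * \<rho>\<^sup>2)) * x)"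
  shows "f x = L - b\<^sup>2 + (b * (E + 1) / (E - 1))\<^sup>2"
proof -
  define k where "k = sqrt (2 * \<sigma>\<^sup>2 / (3 * \<rho>\<^sup>2))"
  have b: "b > 0" "b\<^sup>2 = 3 * \<bar>\<theta>\<bar> / \<sigma>\<^sup>2" and k: "k > 0" using pos by (auto simp: b_def k_def)
  have gt: "f x > L" if "x > 0" for x using bvp_gt_limit[OF f pos that] by (simp add: L_def)
  define g where "g = (\<lambda>x. sqrt (f x - L + b\<^sup>2))"
  have g2: "(g x)\<^sup>2 = f x - L + b\<^sup>2" if "x > 0" for x using gt[OF that] b by (simp add: g_def)
  have gb: "g x > b" if "x > 0" for x
    unfolding g_def using gt[OF that] by (intro real_less_rsqrt) simp
  define T where "T = (\<lambda>x. ln (g x + b) - ln (g x - b))"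
  have dT: "(T has_real_derivative b * k) (at x)" if "x > 0" for x
  proof -
    have "(f has_real_derivative (- k * (f x - L) * g x)) (at x)"
      using bvp_derivative[OF f pos that] unfolding k_def g_def L_def b(2) .
    then have "(g has_real_derivative (- k * (f x - L) * g x) * (inverse (sqrt (f x - L + b\<^sup>2)) / 2)) (at x)"
    proof -
      have "f x - L + b\<^sup>2 > 0" using gt[OF that] by (intro add_pos_nonneg) auto
      then show ?thesis
        unfolding g_def using \<open>(f has_real_derivative _) (at x)\<close>
        by (auto intro!: derivative_eq_intros simp: g_def)
    qed
    then have dg: "(g has_real_derivative (- k * (f x - L) / 2)) (at x)"
    proof -
      have "sqrt (f x - L + b\<^sup>2) = g x" by (simp add: g_def)
      then show ?thesis using \<open>(g has_real_derivative _) (at x)\<close> gb[OF that] b(1) by (simp add: mult.assoc)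
    qed
    have "(T has_real_derivative (- k * (f x - L) / 2) / (g x + b) - (- k * (f x - L) / 2) / (g x - b)) (at x)"
      unfolding T_def using dg gb[OF that] b(1) by (auto intro!: derivative_eq_intros simp: mult.commute)
    moreover have "(- k * (f x - L) / 2) / (g x + b) - (- k * (f x - L) / 2) / (g x - b) = b * k"
    proof -
      have fL: "f x - L = (g x + b) * (g x - b)" using g2[OF that] by (simp add: algebra_simps power2_eq_square)
      have "(- k * (u * v) / 2) / u - (- k * (u * v) / 2) / v = k * (u - v) / 2" if "u > 0" "v > 0" for u v
      proof -
        have "(- k * (u * v) / 2) / u = - k * v / 2" "(- k * (u * v) / 2) / v = - k * u / 2"
          using that by simp_all
        then show ?thesis by (simp only:) (simp add: right_diff_distrib diff_divide_distrib)
      qed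
      from this[of "g x + b" "g x - b"] show ?thesis unfolding fL using gb[OF that] b(1) by simp
    qed
    ultimately show ?thesis by simp
  qed
  have "\<exists>c. \<forall>x\<in>{0<..}. T x - b * k * x = c"
  proof (rule has_field_derivative_zero_constant)
    show "((\<lambda>x. T x - b * k * x) has_real_derivative 0) (at x within {0<..})" if "x \<in> {0<..}" for x
    proof -
      have "((\<lambda>x. T x - b * k * x) has_real_derivative (b * k - b * k * 1)) (at x)"
        using that by (intro DERIV_diff dT DERIV_cmult DERIV_ident) auto
      then show ?thesis by (auto intro: DERIV_subset)
    qed
  qed auto
  then obtain c where c: "\<And>x. x > 0 \<Longrightarrow> T x = b * k * x + c" by (auto simp: algebra_simps)
  have "filterlim f at_top (at_right 0)" using f by (simp add: solves_bvp_def)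
  then have "filterlim (\<lambda>x. (b\<^sup>2 - L) + f x) at_top (at_right 0)"
    by (rule filterlim_tendsto_add_at_top[OF tendsto_const])
  then have "filterlim g at_top (at_right 0)"
    unfolding g_def by (intro filterlim_compose[OF sqrt_at_top]) (simp add: algebra_simps)
  moreover have "((\<lambda>y. ln (y + b) - ln (y - b)) \<longlongrightarrow> 0) at_top" using b by real_asymp
  ultimately have T0: "(T \<longlongrightarrow> 0) (at_right 0)" unfolding T_def by (rule filterlim_compose[rotated])
  have "((\<lambda>x. b * k * x + c) \<longlongrightarrow> b * k * 0 + c) (at_right 0)" by (intro tendsto_intros)
  moreover have "eventually (\<lambda>x. b * k * x + c = T x) (at_right 0)"
    by (rule eventually_mono[OF eventually_at_right_less[of 0]]) (simp add: c)
  ultimately have "(T \<longlongrightarrow> b * k * 0 + c) (at_right 0)" by (rule Lim_transform_eventually)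
  then have "c = 0" using tendsto_unique[OF _ T0] by simp
  then have "T x = b * k * x" using c x by simp
  then have "ln ((g x + b) / (g x - b)) = b * k * x" using gb[OF x] b by (simp add: T_def ln_div)
  then have E: "(g x + b) / (g x - b) = E"
    unfolding E_def k_def[symmetric] using gb[OF x] b by (metis divide_pos_pos add_pos_pos exp_ln diff_gt_0_iff_gt less_trans)
  have E1: "E > 1" unfolding E_def k_def[symmetric] using b k x by simp
  have "g x + b = E * (g x - b)" using E gb[OF x] by (simp add: field_simps)
  then have "g x = b * (E + 1) / (E - 1)" using E1 by (simp add: field_simps)
  then show ?thesis using g2[OF x] by simp
qed

text \<open>The explicit formula contains no trace of f, so two solutions agree without any
  comparison of that formula with \<open>psi\<close>.\<close>

lemma bvp_unique:
  assumes "solves_bvp \<theta> \<sigma> \<rho> f" "solves_bvp \<theta> \<sigma> \<rho> g" "\<theta> \<noteq> 0" "\<rho> > 0" "\<sigma> > 0" "x > 0"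
  shows "f x = g x"
  unfolding bvp_explicit[OF assms(1,3-)] bvp_explicit[OF assms(2-)] ..

section \<open>The branching property\<close>

lemma all_nat_0_Suc: "(\<forall>k. P k) \<longleftrightarrow> P 0 \<and> (\<forall>k. P (Suc k))"
  by (metis not0_implies_Suc)

definition brw_step :: "(nat \<Rightarrow> int \<times> nat) \<Rightarrow> int list \<Rightarrow> int list" where
  "brw_step \<xi> ys = concat (map (\<lambda>(i, y). replicate (snd (\<xi> i)) (y + fst (\<xi> i))) (List.enumerate 0 ys))"

text \<open>Started from an arbitrary list, because after the first generation is split off the
  process continues from whatever positions that generation produced.\<close>

primrec brw_from :: "int list \<Rightarrow> (nat \<times> nat \<Rightarrow> int \<times> nat) \<Rightarrow> nat \<Rightarrow> int list" where
  "brw_from ys \<omega> 0 = ys"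
| "brw_from ys \<omega> (Suc k) = brw_step (\<lambda>i. \<omega> (k, i)) (brw_from ys \<omega> k)"

text \<open>The function Q of the overview: the probability that at least one child succeeds when
  the children succeed independently with probability t.\<close>

definition branch_prob :: "nat pmf \<Rightarrow> real \<Rightarrow> real" where
  "branch_prob p t = 1 - measure_pmf.expectation p (\<lambda>i. (1 - t) ^ i)"

text \<open>Finite-horizon version of u: the probability that the progeny of one particle at the
  origin meets {z..} by generation m. The recursion conditions on the first generation; for z <= 0
  the ancestor itself counts.\<close>

primrec reach_prob :: "int pmf \<Rightarrow> nat pmf \<Rightarrow> nat \<Rightarrow> int \<Rightarrow> real" where
  "reach_prob a p 0 z = (if z \<le> 0 then 1 else 0)"
| "reach_prob a p (Suc m) z = (if z \<le> 0 then 1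
     else measure_pmf.expectation a (\<lambda>j. branch_prob p (reach_prob a p m (z - j))))"

lemma brw_gen_eq_brw_from: "brw_gen n \<omega> k = brw_from (replicate n 0) \<omega> k"
  by (induction k) (simp_all add: brw_step_def)

text \<open>The definition appends generations at the end, whereas the branching property needs the
  first generation split off.\<close>

lemma brw_from_Suc_shift:
  "brw_from ys \<omega> (Suc k) = brw_from (brw_step (\<lambda>i. \<omega> (0, i)) ys) (\<lambda>(k, i). \<omega> (Suc k, i)) k"
  by (induction k) simp_all

lemma brw_step_Nil [simp]: "brw_step \<xi> [] = []"
  by (simp add: brw_step_def)

lemma brw_step_Cons [simp]:
  "brw_step \<xi> (y # ys) = replicate (snd (\<xi> 0)) (y + fst (\<xi> 0)) @ brw_step (\<lambda>i. \<xi> (Suc i)) ys"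
proof -
  have "List.enumerate (Suc s) ys = map (\<lambda>(i, y). (Suc i, y)) (List.enumerate s ys)" for s
    by (induction ys arbitrary: s) auto
  then show ?thesis by (simp add: brw_step_def case_prod_unfold comp_def)
qed

lemma measurable_brw_from: "(\<lambda>\<omega>. brw_from ys \<omega> k) \<in> measurable (marks a p) (count_space UNIV)"
proof (induction k)
  case 0
  show ?case by simp
next
  case (Suc k)
  show ?case
    unfolding brw_from.simps brw_step_def
    by (rule measurable_compose_countable[OF measurable_brw_step Suc])
qed

lemma branch_prob_bounds:
  assumes "0 \<le> t" "t \<le> 1"
  shows "0 \<le> branch_prob p t" "branch_prob p t \<le> 1"
proof -
  have i: "integrable (measure_pmf p) (\<lambda>i. (1 - t) ^ i)"
    using assms by (intro measure_pmf.integrable_const_bound[where B = 1]) (auto simp: power_le_one)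
  have "measure_pmf.expectation p (\<lambda>i. (1 - t) ^ i) \<le> measure_pmf.expectation p (\<lambda>i. 1)"
    using assms by (intro integral_mono i) (auto simp: power_le_one)
  then show "0 \<le> branch_prob p t" by (simp add: branch_prob_def)
  show "branch_prob p t \<le> 1"
    using assms by (simp add: branch_prob_def integral_nonneg)
qed

lemma abs_branch_prob_le_1: "0 \<le> t \<Longrightarrow> t \<le> 1 \<Longrightarrow> \<bar>branch_prob p t\<bar> \<le> 1"
  using branch_prob_bounds[of t p] by simp

lemma reach_prob_bounds: "0 \<le> reach_prob a p m z" "reach_prob a p m z \<le> 1"
proof (induction m arbitrary: z)
  case (Suc m)
  {
    case 1
    show ?case using Suc by (auto intro!: Bochner_Integration.integral_nonneg branch_prob_bounds)
  next
    case 2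
    have "measure_pmf.expectation a (\<lambda>j. branch_prob p (reach_prob a p m (z - j)))
        \<le> measure_pmf.expectation a (\<lambda>j. 1)"
      using Suc by (intro integral_mono measure_pmf.integrable_const_bound[where B = 1])
        (auto intro!: branch_prob_bounds abs_branch_prob_le_1)
    then show ?case by simp
  }
qed auto

section \<open>Splitting the marks into the first generation and the rest\<close>

abbreviation marks_row :: "int pmf \<Rightarrow> nat pmf \<Rightarrow> (nat \<Rightarrow> int \<times> nat) measure" where
  "marks_row a p \<equiv> PiM UNIV (\<lambda>_. measure_pmf (pair_pmf a p))"

definition glue_row :: "(nat \<Rightarrow> int \<times> nat) \<times> (nat \<times> nat \<Rightarrow> int \<times> nat) \<Rightarrow> nat \<times> nat \<Rightarrow> int \<times> nat" where
  "glue_row = (\<lambda>(\<xi>, \<omega>) (k, i). case k of 0 \<Rightarrow> \<xi> i | Suc k \<Rightarrow> \<omega> (k, i))"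

lemma measurable_glue_row: "glue_row \<in> measurable (marks_row a p \<Otimes>\<^sub>M marks a p) (marks a p)"
  unfolding marks_def
proof (rule measurable_PiM_single')
  fix ki :: "nat \<times> nat"
  obtain k i where ki: "ki = (k, i)" by (cases ki)
  show "(\<lambda>x. glue_row x ki) \<in> measurable (marks_row a p \<Otimes>\<^sub>M PiM UNIV (\<lambda>_. measure_pmf (pair_pmf a p))) (measure_pmf (pair_pmf a p))"
  proof (cases k)
    case 0
    have "(\<lambda>x. fst x i) \<in> measurable (marks_row a p \<Otimes>\<^sub>M PiM UNIV (\<lambda>_::nat\<times>nat. measure_pmf (pair_pmf a p))) (measure_pmf (pair_pmf a p))"
      by (rule measurable_compose[OF measurable_fst measurable_component_singleton]) simp
    then show ?thesis using 0 ki by (simp add: glue_row_def case_prod_unfold)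
  next
    case (Suc k')
    have "(\<lambda>x. snd x (k', i)) \<in> measurable (marks_row a p \<Otimes>\<^sub>M PiM UNIV (\<lambda>_::nat\<times>nat. measure_pmf (pair_pmf a p))) (measure_pmf (pair_pmf a p))"
      by (rule measurable_compose[OF measurable_snd measurable_component_singleton]) simp
    then show ?thesis using Suc ki by (simp add: glue_row_def case_prod_unfold)
  qed
qed (auto simp: space_PiM)

text \<open>A product measure is determined by its finite cylinders. The index set J of a cylinder
  splits into its part in row 0 and the part in later rows shifted down by one, and both sides
  factorise accordingly.\<close>

lemma distr_glue_row: "distr (marks_row a p \<Otimes>\<^sub>M marks a p) (marks a p) glue_row = marks a p"
proof -
  let ?\<mu> = "measure_pmf (pair_pmf a p)"
  interpret P: product_prob_space "\<lambda>_::nat \<times> nat. ?\<mu>" UNIV ..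
  interpret R: product_prob_space "\<lambda>_::nat. ?\<mu>" UNIV ..
  have "distr (marks_row a p \<Otimes>\<^sub>M marks a p) (marks a p) glue_row = PiM UNIV (\<lambda>_. ?\<mu>)"
  proof (rule P.PiM_eq)
    fix J :: "(nat \<times> nat) set" and E assume J: "finite J" "J \<subseteq> UNIV" "\<And>j. j \<in> J \<Longrightarrow> E j \<in> sets ?\<mu>"
    define J0 where "J0 = (\<lambda>i. (0, i)) -` J"
    define J1 where "J1 = (\<lambda>(k, i). (Suc k, i)) -` J"
    have fin: "finite J0" "finite J1"
      unfolding J0_def J1_def using J(1) by (auto intro!: finite_vimageI injI)
    let ?X = "prod_emb UNIV (\<lambda>_. ?\<mu>) J (\<Pi>\<^sub>E j\<in>J. E j)"
    let ?E = "prod_emb UNIV (\<lambda>_. ?\<mu>) J0 (\<Pi>\<^sub>E i\<in>J0. E (0, i))"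
    let ?F = "prod_emb UNIV (\<lambda>_. ?\<mu>) J1 (\<Pi>\<^sub>E (k, i)\<in>J1. E (Suc k, i))"
    have "glue_row -` ?X \<inter> space (marks_row a p \<Otimes>\<^sub>M marks a p) = ?E \<times> ?F"
    proof -
      have "glue_row (\<xi>, \<omega>) \<in> ?X \<longleftrightarrow> \<xi> \<in> ?E \<and> \<omega> \<in> ?F" for \<xi> \<omega>
      proof -
        have "glue_row (\<xi>, \<omega>) \<in> ?X \<longleftrightarrow> (\<forall>k i. (k, i) \<in> J \<longrightarrow> glue_row (\<xi>, \<omega>) (k, i) \<in> E (k, i))"
          by (auto simp: prod_emb_def PiE_iff)
        also have "\<dots> \<longleftrightarrow> (\<forall>i. (0, i) \<in> J \<longrightarrow> \<xi> i \<in> E (0, i)) \<and> (\<forall>k i. (Suc k, i) \<in> J \<longrightarrow> \<omega> (k, i) \<in> E (Suc k, i))"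
          unfolding glue_row_def by (subst all_nat_0_Suc) auto
        also have "\<dots> \<longleftrightarrow> \<xi> \<in> ?E \<and> \<omega> \<in> ?F"
          by (auto simp: prod_emb_def PiE_iff J0_def J1_def)
        finally show ?thesis .
      qed
      then show ?thesis by (auto simp: space_pair_measure space_PiM marks_def)
    qed
    then have "emeasure (distr (marks_row a p \<Otimes>\<^sub>M marks a p) (marks a p) glue_row) ?X
        = emeasure (marks_row a p \<Otimes>\<^sub>M marks a p) (?E \<times> ?F)"
      using J by (subst emeasure_distr) (auto simp: marks_def intro!: sets_PiM_I measurable_glue_row[unfolded marks_def])
    also have "\<dots> = emeasure (marks_row a p) ?E * emeasure (marks a p) ?F"
      unfolding marks_def using fin by (intro P.P.emeasure_pair_measure_Times) (auto intro!: sets_PiM_I)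
    also have "emeasure (marks_row a p) ?E = (\<Prod>i\<in>J0. emeasure ?\<mu> (E (0, i)))"
      using fin by (intro R.emeasure_PiM_emb) auto
    also have "emeasure (marks a p) ?F = (\<Prod>(k, i)\<in>J1. emeasure ?\<mu> (E (Suc k, i)))"
      unfolding marks_def using fin by (subst P.emeasure_PiM_emb) (auto simp: case_prod_unfold)
    also have "(\<Prod>i\<in>J0. emeasure ?\<mu> (E (0, i))) = (\<Prod>j\<in>(\<lambda>i. (0, i)) ` J0. emeasure ?\<mu> (E j))"
      by (subst prod.reindex) (auto intro!: inj_onI)
    also have "(\<Prod>(k, i)\<in>J1. emeasure ?\<mu> (E (Suc k, i))) = (\<Prod>j\<in>(\<lambda>(k, i). (Suc k, i)) ` J1. emeasure ?\<mu> (E j))"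
      by (subst prod.reindex) (auto intro!: inj_onI simp: case_prod_unfold)
    also have "(\<Prod>j\<in>(\<lambda>i. (0, i)) ` J0. emeasure ?\<mu> (E j)) * (\<Prod>j\<in>(\<lambda>(k, i). (Suc k, i)) ` J1. emeasure ?\<mu> (E j))
       = (\<Prod>j\<in>(\<lambda>i. (0, i)) ` J0 \<union> (\<lambda>(k, i). (Suc k, i)) ` J1. emeasure ?\<mu> (E j))"
      using fin by (intro prod.union_disjoint[symmetric]) auto
    also have "(\<lambda>i. (0, i)) ` J0 \<union> (\<lambda>(k, i). (Suc k, i)) ` J1 = J"
      unfolding J0_def J1_def
    proof (intro equalityI subsetI)
      fix x assume "x \<in> J"
      obtain k i where x: "x = (k, i)" by (cases x)
      show "x \<in> (\<lambda>i. (0, i)) ` (\<lambda>i. (0, i)) -` J \<union> (\<lambda>(k, i). (Suc k, i)) ` (\<lambda>(k, i). (Suc k, i)) -` J"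
        using \<open>x \<in> J\<close> unfolding x by (cases k) (auto simp: image_iff)
    qed auto
    finally show "emeasure (distr (marks_row a p \<Otimes>\<^sub>M marks a p) (marks a p) glue_row) ?X = (\<Prod>j\<in>J. emeasure ?\<mu> (E j))" .
  qed (simp add: marks_def)
  then show ?thesis by (simp add: marks_def)
qed

lemma nn_integral_marks_row:
  assumes f: "f \<in> borel_measurable (marks a p)"
  shows "(\<integral>\<^sup>+\<omega>. f \<omega> \<partial>marks a p) = (\<integral>\<^sup>+\<xi>. \<integral>\<^sup>+\<omega>. f (glue_row (\<xi>, \<omega>)) \<partial>marks a p \<partial>marks_row a p)"
proof -
  interpret M: prob_space "marks a p" by (rule prob_space_marks)
  have "(\<integral>\<^sup>+\<omega>. f \<omega> \<partial>marks a p) = (\<integral>\<^sup>+x. f (glue_row x) \<partial>(marks_row a p \<Otimes>\<^sub>M marks a p))"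
    by (subst distr_glue_row[symmetric], rule nn_integral_distr[OF measurable_glue_row]) (simp add: f)
  also have "\<dots> = (\<integral>\<^sup>+\<xi>. \<integral>\<^sup>+\<omega>. f (glue_row (\<xi>, \<omega>)) \<partial>marks a p \<partial>marks_row a p)"
    by (rule M.nn_integral_fst[symmetric]) (rule measurable_compose[OF measurable_glue_row f])
  finally show ?thesis .
qed

lemma measurable_brw_step_row:
  "(\<lambda>\<xi>. brw_step \<xi> ys) \<in> measurable (marks_row a p) (count_space UNIV)"
proof (induction ys)
  case Nil
  show ?case by simp
next
  case (Cons y ys)
  have c: "(\<lambda>\<xi>. \<xi> i) \<in> measurable (marks_row a p) (count_space UNIV)" for i
  proof -
    have "(\<lambda>\<xi>. \<xi> i) \<in> measurable (marks_row a p) (measure_pmf (pair_pmf a p))"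
      by (rule measurable_component_singleton) simp
    then show ?thesis by simp
  qed
  have 1: "(\<lambda>\<xi>. (\<lambda>(j, b). replicate b (y + j)) (\<xi> 0)) \<in> measurable (marks_row a p) (count_space UNIV)"
    by (rule measurable_compose[OF c]) simp
  have "(\<lambda>\<xi> i. \<xi> (Suc i)) \<in> measurable (marks_row a p) (marks_row a p)"
    by (rule measurable_PiM_single') (auto simp: space_PiM intro!: measurable_component_singleton)
  then have 2: "(\<lambda>\<xi>. brw_step (\<lambda>i. \<xi> (Suc i)) ys) \<in> measurable (marks_row a p) (count_space UNIV)"
    by (rule measurable_compose[OF _ Cons])
  have "(\<lambda>\<xi>. (\<lambda>(j, b). replicate b (y + j)) (\<xi> 0) @ brw_step (\<lambda>i. \<xi> (Suc i)) ys) \<in> measurable (marks_row a p) (count_space UNIV)"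
    by (rule measurable_compose_countable[OF _ 1, where f = "\<lambda>us \<xi>. us @ brw_step (\<lambda>i. \<xi> (Suc i)) ys"])
       (rule measurable_compose[OF 2], simp)
  then show ?case by (simp add: case_prod_unfold)
qed

lemma measurable_prod_list_brw_step:
  "(\<lambda>\<xi>. prod_list (map h (brw_step \<xi> ys)) :: ennreal) \<in> borel_measurable (marks_row a p)"
  by (rule measurable_compose[OF measurable_brw_step_row]) simp

text \<open>Different particles use different marks, so the expectation of the product over all
  children factorises over the parents. The induction removes the first parent together with mark 0;
  the remaining parents see the shifted sequence of marks, which has the same law.\<close>

lemma nn_integral_brw_step:
  fixes h :: "int \<Rightarrow> ennreal"
  shows "(\<integral>\<^sup>+\<xi>. prod_list (map h (brw_step \<xi> ys)) \<partial>marks_row a p)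
     = prod_list (map (\<lambda>y. \<integral>\<^sup>+(j, b). h (y + j) ^ b \<partial>measure_pmf (pair_pmf a p)) ys)"
proof (induction ys)
  case Nil
  interpret R: prob_space "marks_row a p" by (intro prob_space_PiM measure_pmf.prob_space_axioms)
  show ?case by (simp add: R.emeasure_space_1)
next
  case (Cons y ys)
  let ?\<mu> = "measure_pmf (pair_pmf a p)"
  interpret S: sequence_space ?\<mu> ..
  have "(\<integral>\<^sup>+\<xi>. prod_list (map h (brw_step \<xi> (y # ys))) \<partial>marks_row a p)
     = (\<integral>\<^sup>+\<xi>. prod_list (map h (brw_step \<xi> (y # ys))) \<partial>distr (?\<mu> \<Otimes>\<^sub>M marks_row a p) (marks_row a p) (\<lambda>(s, \<omega>). case_nat s \<omega>))"
    using S.PiM_iter by simp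
  also have "\<dots> = (\<integral>\<^sup>+x. prod_list (map h (brw_step (case x of (s, \<omega>) \<Rightarrow> case_nat s \<omega>) (y # ys))) \<partial>(?\<mu> \<Otimes>\<^sub>M marks_row a p))"
    by (rule nn_integral_distr) (simp_all add: split_beta' measurable_prod_list_brw_step del: brw_step_Cons)
  also have "\<dots> = (\<integral>\<^sup>+s. \<integral>\<^sup>+\<omega>. prod_list (map h (brw_step (case_nat s \<omega>) (y # ys))) \<partial>marks_row a p \<partial>?\<mu>)"
  proof -
    have "(\<lambda>x. case_nat (fst x) (snd x)) \<in> measurable (?\<mu> \<Otimes>\<^sub>M marks_row a p) (marks_row a p)"
      by measurable
    then have "(\<lambda>x. prod_list (map h (brw_step (case_nat (fst x) (snd x)) (y # ys)))) \<in> borel_measurable (?\<mu> \<Otimes>\<^sub>M marks_row a p)"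
      by (rule measurable_compose[OF _ measurable_prod_list_brw_step])
    from S.P.nn_integral_fst[OF this] show ?thesis by (simp add: split_beta' del: brw_step_Cons)
  qed
  also have "\<dots> = (\<integral>\<^sup>+s. h (y + fst s) ^ snd s * (\<integral>\<^sup>+\<omega>. prod_list (map h (brw_step \<omega> ys)) \<partial>marks_row a p) \<partial>?\<mu>)"
    by (intro nn_integral_cong, subst nn_integral_cmult[symmetric])
       (simp_all add: measurable_prod_list_brw_step)
  also have "\<dots> = (\<integral>\<^sup>+s. h (y + fst s) ^ snd s \<partial>?\<mu>) * (\<integral>\<^sup>+\<omega>. prod_list (map h (brw_step \<omega> ys)) \<partial>marks_row a p)"
    by (rule nn_integral_multc) simp
  finally show ?case by (simp add: Cons case_prod_unfold)
qed

text \<open>Given the first row of marks \<xi>, the later rows run the same process from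
  \<open>brw_step \<xi> ys\<close>, and the induction hypothesis yields a product over the children.
  Averaging over \<xi> factorises over the parents, and the mean of (1 - r)^b over the offspring
  number b is 1 - Q r. If some initial particle is already at z or beyond, both sides are 0.\<close>

lemma emeasure_brw_from_below:
  "emeasure (marks a p) {\<omega> \<in> space (marks a p). \<forall>k\<le>m. \<forall>y\<in>set (brw_from ys \<omega> k). y < z}
     = prod_list (map (\<lambda>y. ennreal (1 - reach_prob a p m (z - y))) ys)"
proof (induction m arbitrary: ys)
  case 0
  interpret M: prob_space "marks a p" by (rule prob_space_marks)
  show ?case
  proof (cases "\<forall>y\<in>set ys. y < z")
    case True
    then have "map (\<lambda>y. ennreal (1 - reach_prob a p 0 (z - y))) ys = map (\<lambda>_. 1) ys" by auto
    then have "prod_list (map (\<lambda>y. ennreal (1 - reach_prob a p 0 (z - y))) ys) = 1"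
      by (simp add: map_replicate_const)
    then show ?thesis using True M.emeasure_space_1 by simp
  next
    case False
    then obtain y where "y \<in> set ys" "z - y \<le> 0" by force
    then have "0 \<in> set (map (\<lambda>y. ennreal (1 - reach_prob a p 0 (z - y))) ys)"
      by (auto simp: image_iff simp del: mult_eq_0_iff intro!: bexI[of _ y])
    then have "prod_list (map (\<lambda>y. ennreal (1 - reach_prob a p 0 (z - y))) ys) = 0"
      by (simp only: prod_list_zero_iff)
    moreover have "{\<omega> \<in> space (marks a p). \<forall>k\<le>0. \<forall>y\<in>set (brw_from ys \<omega> k). y < z} = {}"
      using False by auto
    ultimately show ?thesis by (simp only:) simp
  qed
next
  case (Suc m)
  show ?case
  proof (cases "\<forall>y\<in>set ys. y < z")
    case False
    then obtain y where "y \<in> set ys" "z - y \<le> 0" by force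
    then have "0 \<in> set (map (\<lambda>y. ennreal (1 - reach_prob a p (Suc m) (z - y))) ys)"
      by (auto simp: image_iff simp del: mult_eq_0_iff intro!: bexI[of _ y])
    then have "prod_list (map (\<lambda>y. ennreal (1 - reach_prob a p (Suc m) (z - y))) ys) = 0"
      by (simp only: prod_list_zero_iff)
    moreover have "{\<omega> \<in> space (marks a p). \<forall>k\<le>Suc m. \<forall>y\<in>set (brw_from ys \<omega> k). y < z} = {}"
      using False by fastforce
    ultimately show ?thesis by (simp only:) simp
  next
    case True
    let ?ev = "\<lambda>m ys. {\<omega> \<in> space (marks a p). \<forall>k\<le>m. \<forall>y\<in>set (brw_from ys \<omega> k). y < z}"
    have meas: "?ev m ys \<in> sets (marks a p)" for m ys
    proof -
      have "Measurable.pred (marks a p) (\<lambda>\<omega>. \<forall>y\<in>set (brw_from ys \<omega> k). y < z)" for k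
        by (rule measurable_compose[OF measurable_brw_from]) simp
      then have "Measurable.pred (marks a p) (\<lambda>\<omega>. \<forall>k\<le>m. \<forall>y\<in>set (brw_from ys \<omega> k). y < z)"
        by measurable
      then show ?thesis unfolding pred_def .
    qed
    have ind: "indicator (?ev (Suc m) ys) (glue_row (\<xi>, \<omega>)) = (indicator (?ev m (brw_step \<xi> ys)) \<omega> :: ennreal)" for \<xi> \<omega>
    proof -
      have g: "brw_from ys (glue_row (\<xi>, \<omega>)) (Suc k) = brw_from (brw_step \<xi> ys) \<omega> k" for k
      proof -
        have "(\<lambda>i. glue_row (\<xi>, \<omega>) (0, i)) = \<xi>" "(\<lambda>(k, i). glue_row (\<xi>, \<omega>) (Suc k, i)) = \<omega>"
          by (auto simp: glue_row_def)
        then show ?thesis unfolding brw_from_Suc_shift by (simp only:)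
      qed
      have "(\<forall>k\<le>Suc m. \<forall>y\<in>set (brw_from ys (glue_row (\<xi>, \<omega>)) k). y < z) \<longleftrightarrow>
          (\<forall>y\<in>set ys. y < z) \<and> (\<forall>k\<le>m. \<forall>y\<in>set (brw_from ys (glue_row (\<xi>, \<omega>)) (Suc k)). y < z)"
      proof -
        have "(\<forall>k\<le>Suc m. Q k) \<longleftrightarrow> Q 0 \<and> (\<forall>k\<le>m. Q (Suc k))" for Q
          by (metis Suc_le_mono not0_implies_Suc zero_le)
        then show ?thesis by (simp only: brw_from.simps(1))
      qed
      then show ?thesis using True unfolding g
        by (simp add: indicator_def space_PiM marks_def)
    qed
    have "emeasure (marks a p) (?ev (Suc m) ys) = (\<integral>\<^sup>+\<omega>. indicator (?ev (Suc m) ys) \<omega> \<partial>marks a p)"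
      by (rule nn_integral_indicator[OF meas, symmetric])
    also have "\<dots> = (\<integral>\<^sup>+\<xi>. \<integral>\<^sup>+\<omega>. indicator (?ev m (brw_step \<xi> ys)) \<omega> \<partial>marks a p \<partial>marks_row a p)"
    proof -
      have "indicator (?ev (Suc m) ys) \<in> borel_measurable (marks a p)" using meas by (rule borel_measurable_indicator)
      from nn_integral_marks_row[OF this] show ?thesis unfolding ind .
    qed
    also have "\<dots> = (\<integral>\<^sup>+\<xi>. prod_list (map (\<lambda>y. ennreal (1 - reach_prob a p m (z - y))) (brw_step \<xi> ys)) \<partial>marks_row a p)"
      unfolding nn_integral_indicator[OF meas] Suc ..
    also have "\<dots> = prod_list (map (\<lambda>y. \<integral>\<^sup>+(j, b). ennreal (1 - reach_prob a p m (z - (y + j))) ^ b \<partial>measure_pmf (pair_pmf a p)) ys)"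
      by (rule nn_integral_brw_step)
    also have "\<dots> = prod_list (map (\<lambda>y. ennreal (1 - reach_prob a p (Suc m) (z - y))) ys)"
    proof (intro arg_cong[where f = prod_list] map_cong refl)
      fix y assume "y \<in> set ys"
      then have y: "\<not> z - y \<le> 0" using True by auto
      let ?r = "\<lambda>j. reach_prob a p m (z - y - j)"
      have r: "0 \<le> ?r j" "?r j \<le> 1" for j by (rule reach_prob_bounds)+
      have i: "integrable (measure_pmf p) (\<lambda>b. (1 - ?r j) ^ b)" for j
        using r[of j] by (intro measure_pmf.integrable_const_bound[where B = 1]) (auto simp: power_le_one)
      have "(\<integral>\<^sup>+(j, b). ennreal (1 - reach_prob a p m (z - (y + j))) ^ b \<partial>measure_pmf (pair_pmf a p))
          = (\<integral>\<^sup>+j. \<integral>\<^sup>+b. ennreal ((1 - ?r j) ^ b) \<partial>measure_pmf p \<partial>measure_pmf a)"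
        by (simp add: nn_integral_pair_pmf' reach_prob_bounds diff_diff_eq flip: ennreal_power)
      also have "\<dots> = (\<integral>\<^sup>+j. ennreal (1 - branch_prob p (?r j)) \<partial>measure_pmf a)"
        by (intro nn_integral_cong, subst nn_integral_eq_integral[OF i])
           (simp_all add: branch_prob_def reach_prob_bounds)
      also have "\<dots> = ennreal (measure_pmf.expectation a (\<lambda>j. 1 - branch_prob p (?r j)))"
        by (intro nn_integral_eq_integral measure_pmf.integrable_const_bound[where B = 1])
           (simp_all add: branch_prob_bounds reach_prob_bounds)
      also have "measure_pmf.expectation a (\<lambda>j. 1 - branch_prob p (?r j))
          = 1 - measure_pmf.expectation a (\<lambda>j. branch_prob p (?r j))"
        by (subst Bochner_Integration.integral_diff)
           (simp_all add: measure_pmf.integrable_const_bound[where B = 1] abs_branch_prob_le_1 reach_prob_bounds)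
      finally show "(\<integral>\<^sup>+(j, b). ennreal (1 - reach_prob a p m (z - (y + j))) ^ b \<partial>measure_pmf (pair_pmf a p))
          = ennreal (1 - reach_prob a p (Suc m) (z - y))" using y by simp
    qed
    finally show ?thesis .
  qed
qed

lemma max_position_brw_path_ge_iff:
  assumes "n \<ge> 1"
  shows "max_position (brw_path n \<omega>) \<ge> ereal c \<longleftrightarrow> (\<exists>k. \<exists>y\<in>set (brw_gen n \<omega> k). \<lceil>c\<rceil> \<le> y)"
proof -
  have eq: "{z. local_time (brw_path n \<omega>) m z > 0} = (\<Union>k\<le>m. set (brw_gen n \<omega> k))" for m
    by (auto simp: local_time_def brw_path_def sum_eq_0_iff count_list_0_iff simp flip: neq0_conv)
  have mx: "b \<le> max_upto (brw_path n \<omega>) m \<longleftrightarrow> (\<exists>k\<le>m. \<exists>y\<in>set (brw_gen n \<omega> k). b \<le> y)" for b m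
    unfolding max_upto_def using local_time_support_brw_path[OF assms, of \<omega> m]
    by (subst Max_ge_iff) (auto simp: eq)
  show ?thesis
  proof
    assume "max_position (brw_path n \<omega>) \<ge> ereal c"
    \<comment> \<open>A supremum at least c need not exhibit a term at least c. It does exhibit a
      term above \<lceil>c\<rceil> - 1, and for integers that means at least
      \<lceil>c\<rceil>.\<close>
    moreover have "ereal (real_of_int (\<lceil>c\<rceil> - 1)) < ereal c" by simp linarith
    ultimately have "ereal (real_of_int (\<lceil>c\<rceil> - 1)) < max_position (brw_path n \<omega>)" by (rule less_le_trans[rotated])
    then obtain m where "real_of_int (\<lceil>c\<rceil> - 1) < real_of_int (max_upto (brw_path n \<omega>) m)"
      unfolding max_position_def less_SUP_iff by auto
    then have "\<lceil>c\<rceil> \<le> max_upto (brw_path n \<omega>) m" by linarith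
    then show "\<exists>k. \<exists>y\<in>set (brw_gen n \<omega> k). \<lceil>c\<rceil> \<le> y" unfolding mx by auto
  next
    assume "\<exists>k. \<exists>y\<in>set (brw_gen n \<omega> k). \<lceil>c\<rceil> \<le> y"
    then obtain m where "\<lceil>c\<rceil> \<le> max_upto (brw_path n \<omega>) m" unfolding mx by auto
    then have "ereal c \<le> ereal (real_of_int (max_upto (brw_path n \<omega>) m))" by (simp add: ceiling_le_iff)
    also have "\<dots> \<le> max_position (brw_path n \<omega>)" unfolding max_position_def by (intro SUP_upper) auto
    finally show "max_position (brw_path n \<omega>) \<ge> ereal c" .
  qed
qed

text \<open>Staying below \<lceil>c\<rceil> up to generation m is a decreasing sequence of events,
  each with a product probability over the n ancestors; continuity from above gives the
  limit.\<close>

lemma tendsto_max_position_prob: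
  assumes "n \<ge> 1"
  shows "(\<lambda>m. 1 - (1 - reach_prob a p m \<lceil>c\<rceil>) ^ n)
     \<longlonglongrightarrow> measure (brw_law a p n) {X. max_position X \<ge> ereal c}"
proof -
  interpret M: prob_space "marks a p" by (rule prob_space_marks)
  define below where "below m = {\<omega> \<in> space (marks a p). \<forall>k\<le>m. \<forall>y\<in>set (brw_from (replicate n 0) \<omega> k). y < \<lceil>c\<rceil>}" for m
  have meas: "below m \<in> sets (marks a p)" for m
  proof -
    have "Measurable.pred (marks a p) (\<lambda>\<omega>. \<forall>y\<in>set (brw_from (replicate n 0) \<omega> k). y < \<lceil>c\<rceil>)" for k
      by (rule measurable_compose[OF measurable_brw_from]) simp
    then have "Measurable.pred (marks a p) (\<lambda>\<omega>. \<forall>k\<le>m. \<forall>y\<in>set (brw_from (replicate n 0) \<omega> k). y < \<lceil>c\<rceil>)"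
      by measurable
    then show ?thesis unfolding pred_def below_def .
  qed
  have pr: "M.prob (below m) = (1 - reach_prob a p m \<lceil>c\<rceil>) ^ n" for m
  proof -
    have "emeasure (marks a p) (below m) = ennreal ((1 - reach_prob a p m \<lceil>c\<rceil>) ^ n)"
      unfolding below_def emeasure_brw_from_below
      using reach_prob_bounds[of a p m "\<lceil>c\<rceil>"] by (simp add: prod_list_replicate ennreal_power)
    then show ?thesis using reach_prob_bounds[of a p m "\<lceil>c\<rceil>"] by (simp add: M.emeasure_eq_measure)
  qed
  have "decseq below" unfolding decseq_def below_def by (blast intro: order_trans)
  with meas have "(\<lambda>m. M.prob (below m)) \<longlonglongrightarrow> M.prob (\<Inter>m. below m)"
    by (intro M.finite_Lim_measure_decseq) auto
  then have "(\<lambda>m. 1 - M.prob (below m)) \<longlonglongrightarrow> 1 - M.prob (\<Inter>m. below m)"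
    by (intro tendsto_intros)
  also have "1 - M.prob (\<Inter>m. below m) = M.prob (space (marks a p) - (\<Inter>m. below m))"
    using meas by (intro M.prob_compl[symmetric]) auto
  also have "space (marks a p) - (\<Inter>m. below m) = {\<omega> \<in> space (marks a p). max_position (brw_path n \<omega>) \<ge> ereal c}"
    unfolding max_position_brw_path_ge_iff[OF assms] brw_gen_eq_brw_from below_def
    by (auto simp: not_less) (metis not_le, metis not_le order_refl)
  finally show ?thesis by (simp add: pr measure_brw_law)
qed

section \<open>The generating function of the offspring law\<close>

lemma power_one_minus_le:
  fixes t :: real assumes "0 \<le> t" "t \<le> 1"
  shows "(1 - t) ^ i \<le> 1 - real i * t + real i * (real i - 1) / 2 * t\<^sup>2"
proof (induction i)
  case (Suc i)
  have "(1 - t) ^ Suc i \<le> (1 - t) * (1 - real i * t + real i * (real i - 1) / 2 * t\<^sup>2)"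
    using Suc assms by (simp add: mult_left_mono)
  also have "\<dots> = 1 - real (Suc i) * t + real (Suc i) * (real (Suc i) - 1) / 2 * t\<^sup>2 - real i * (real i - 1) / 2 * t ^ 3"
    by (simp add: field_simps power2_eq_square power3_eq_cube)
  also have "\<dots> \<le> 1 - real (Suc i) * t + real (Suc i) * (real (Suc i) - 1) / 2 * t\<^sup>2"
    using assms by (cases i) auto
  finally show ?case .
qed simp

text \<open>The Bonferroni inequality of the next order, with i^3 as a crude substitute for the
  binomial coefficient, so that integration produces the third moment directly.\<close>

lemma power_one_minus_ge:
  fixes t :: real assumes "0 \<le> t" "t \<le> 1"
  shows "(1 - t) ^ i \<ge> 1 - real i * t + real i * (real i - 1) / 2 * t\<^sup>2 - real i ^ 3 * t ^ 3"
proof (induction i)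
  case (Suc i)
  have "real (Suc i) ^ 3 \<ge> real i ^ 3 + real i * (real i - 1) / 2"
    by (simp add: field_simps power2_eq_square power3_eq_cube)
  then have c: "(real i ^ 3 + real i * (real i - 1) / 2) * t ^ 3 \<le> real (Suc i) ^ 3 * t ^ 3"
    using assms by (intro mult_right_mono) auto
  have d: "0 \<le> real i ^ 3 * (t * t ^ 3)" using assms by simp
  have "1 - real (Suc i) * t + real (Suc i) * (real (Suc i) - 1) / 2 * t\<^sup>2 - real (Suc i) ^ 3 * t ^ 3
      \<le> 1 - real (Suc i) * t + real (Suc i) * (real (Suc i) - 1) / 2 * t\<^sup>2
        - (real i ^ 3 + real i * (real i - 1) / 2) * t ^ 3 + real i ^ 3 * (t * t ^ 3)"
    using c d by linarith
  also have "\<dots> = (1 - t) * (1 - real i * t + real i * (real i - 1) / 2 * t\<^sup>2 - real i ^ 3 * t ^ 3)"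
    by (simp add: field_simps power2_eq_square power3_eq_cube)
  also have "\<dots> \<le> (1 - t) ^ Suc i"
    using Suc assms by (simp add: mult_left_mono)
  finally show ?case .
qed simp

lemma integrable_power_one_minus:
  assumes "0 \<le> t" "t \<le> 1"
  shows "integrable (measure_pmf p) (\<lambda>i. (1 - t :: real) ^ i)"
  using assms by (intro measure_pmf.integrable_const_bound[where B = 1]) (auto simp: power_le_one)

lemma branch_prob_0 [simp]: "branch_prob p 0 = 0"
  by (simp add: branch_prob_def)

lemma branch_prob_mono:
  assumes "0 \<le> s" "s \<le> t" "t \<le> 1"
  shows "branch_prob p s \<le> branch_prob p t"
  using assms unfolding branch_prob_def
  by (intro diff_left_mono integral_mono integrable_power_one_minus power_mono) auto

text \<open>Concavity of Q together with Q 0 = 0, i.e. Q t / t is nonincreasing, written without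
  division. It reduces to a pointwise inequality for powers, expressing their convexity along the
  ray from t = 0.\<close>

lemma branch_prob_scale:
  assumes "1 \<le> c" "0 \<le> t" "c * t \<le> 1"
  shows "branch_prob p (c * t) \<le> c * branch_prob p t"
proof -
  have t: "t \<le> 1" using assms mult_right_mono[of 1 c t] by linarith
  have pw: "(1 - c * t) ^ i \<ge> 1 - c + c * (1 - t) ^ i" for i
  proof (induction i)
    case (Suc i)
    have p1: "(1 - t) ^ i \<le> 1" using assms t by (simp add: power_le_one)
    have "1 - c + c * (1 - t) ^ Suc i \<le> (1 - c * t) * (1 - c + c * (1 - t) ^ i)"
    proof -
      have "(1 - c * t) * (1 - c + c * (1 - t) ^ i) - (1 - c + c * (1 - t) ^ Suc i)
          = c * (c - 1) * t * (1 - (1 - t) ^ i)"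
        by (simp add: algebra_simps)
      also have "\<dots> \<ge> 0" using assms p1 by (intro mult_nonneg_nonneg) auto
      finally show ?thesis by simp
    qed
    also have "\<dots> \<le> (1 - c * t) ^ Suc i" using Suc assms by (simp add: mult_left_mono)
    finally show ?case .
  qed simp
  have i: "integrable (measure_pmf p) (\<lambda>i. (1 - t) ^ i)" using assms t by (intro integrable_power_one_minus)
  have "measure_pmf.expectation p (\<lambda>i. 1 - c + c * (1 - t) ^ i) \<le> measure_pmf.expectation p (\<lambda>i. (1 - c * t) ^ i)"
    using assms pw by (intro integral_mono integrable_power_one_minus i Bochner_Integration.integrable_add integrable_mult_right) auto
  also have "measure_pmf.expectation p (\<lambda>i. 1 - c + c * (1 - t) ^ i) = 1 - c + c * measure_pmf.expectation p (\<lambda>i. (1 - t) ^ i)"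
    using i by (subst Bochner_Integration.integral_add) auto
  finally show ?thesis by (simp add: branch_prob_def algebra_simps)
qed

lemma integrable_real_pmf:
  assumes "integrable (measure_pmf p) (\<lambda>i. (real i)\<^sup>2)"
  shows "integrable (measure_pmf p) real"
proof (rule Bochner_Integration.integrable_bound[OF assms])
  have "real i \<le> (real i)\<^sup>2" for i by (cases i) (auto simp: power2_eq_square)
  then show "AE i in measure_pmf p. norm (real i) \<le> norm ((real i)\<^sup>2)" by simp
qed simp

text \<open>Expectation of \<open>power_one_minus_le\<close>. The quadratic coefficient is half the
  second factorial moment, which equals the variance plus m^2 - m and therefore has the same limit
  as the variance when m tends to 1.\<close>

lemma branch_prob_ge:
  assumes i2: "integrable (measure_pmf p) (\<lambda>i. (real i)\<^sup>2)" and t: "0 \<le> t" "t \<le> 1"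
  defines "m \<equiv> measure_pmf.expectation p real"
  shows "branch_prob p t \<ge> m * t - (measure_pmf.expectation p (\<lambda>i. (real i)\<^sup>2) - m) / 2 * t\<^sup>2"
proof -
  have i1: "integrable (measure_pmf p) real" by (rule integrable_real_pmf[OF i2])
  have "measure_pmf.expectation p (\<lambda>i. (1 - t) ^ i)
      \<le> measure_pmf.expectation p (\<lambda>i. 1 + real i * (- t - t\<^sup>2 / 2) + (real i)\<^sup>2 * (t\<^sup>2 / 2))"
  proof (intro integral_mono integrable_power_one_minus t Bochner_Integration.integrable_add integrable_mult_left i1 i2)
    show "(1 - t) ^ i \<le> 1 + real i * (- t - t\<^sup>2 / 2) + (real i)\<^sup>2 * (t\<^sup>2 / 2)" for i
      using power_one_minus_le[OF t, of i] by (simp add: field_simps power2_eq_square)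
  qed simp
  also have "\<dots> = 1 + m * (- t - t\<^sup>2 / 2) + measure_pmf.expectation p (\<lambda>i. (real i)\<^sup>2) * (t\<^sup>2 / 2)"
    using i1 i2 by (simp add: m_def)
  finally show ?thesis by (simp add: branch_prob_def field_simps)
qed

lemma branch_prob_le:
  assumes i2: "integrable (measure_pmf p) (\<lambda>i. (real i)\<^sup>2)"
    and i3: "integrable (measure_pmf p) (\<lambda>i. real i ^ 3)" and t: "0 \<le> t" "t \<le> 1"
  defines "m \<equiv> measure_pmf.expectation p real"
  shows "branch_prob p t \<le> m * t - (measure_pmf.expectation p (\<lambda>i. (real i)\<^sup>2) - m) / 2 * t\<^sup>2
    + measure_pmf.expectation p (\<lambda>i. real i ^ 3) * t ^ 3"
proof -
  have i1: "integrable (measure_pmf p) real" by (rule integrable_real_pmf[OF i2])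
  have "measure_pmf.expectation p (\<lambda>i. 1 + real i * (- t - t\<^sup>2 / 2) + (real i)\<^sup>2 * (t\<^sup>2 / 2) + real i ^ 3 * (- (t ^ 3)))
      \<le> measure_pmf.expectation p (\<lambda>i. (1 - t) ^ i)"
  proof (intro integral_mono integrable_power_one_minus t Bochner_Integration.integrable_add integrable_mult_left i1 i2 i3)
    show "1 + real i * (- t - t\<^sup>2 / 2) + (real i)\<^sup>2 * (t\<^sup>2 / 2) + real i ^ 3 * (- (t ^ 3)) \<le> (1 - t) ^ i" for i
      using power_one_minus_ge[OF t, of i] by (simp add: field_simps power2_eq_square)
  qed simp
  also have "measure_pmf.expectation p (\<lambda>i. 1 + real i * (- t - t\<^sup>2 / 2) + (real i)\<^sup>2 * (t\<^sup>2 / 2) + real i ^ 3 * (- (t ^ 3)))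
    = 1 + m * (- t - t\<^sup>2 / 2) + measure_pmf.expectation p (\<lambda>i. (real i)\<^sup>2) * (t\<^sup>2 / 2) + measure_pmf.expectation p (\<lambda>i. real i ^ 3) * (- (t ^ 3))"
    using i1 i2 i3 by (simp add: m_def)
  finally show ?thesis by (simp add: branch_prob_def field_simps)
qed

lemma branch_prob_pos:
  assumes i2: "integrable (measure_pmf p) (\<lambda>i. (real i)\<^sup>2)" and m: "measure_pmf.expectation p real > 0"
    and t: "0 < t" "t \<le> 1"
  shows "branch_prob p t > 0"
proof -
  define m where "m = measure_pmf.expectation p real"
  define b where "b = (measure_pmf.expectation p (\<lambda>i. (real i)\<^sup>2) - m) / 2"
  \<comment> \<open>The quadratic lower bound is positive only for small arguments: this s gives b *
    s <= m / 2, and monotonicity carries positivity on to t.\<close>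
  define s where "s = min t (m / (2 * (\<bar>b\<bar> + 1)))"
  have m0: "m > 0" using m by (simp add: m_def)
  have s: "0 < s" "s \<le> t" "s \<le> m / (2 * (\<bar>b\<bar> + 1))" using t m0 by (auto simp: s_def)
  have "b * s \<le> (\<bar>b\<bar> + 1) * s" using s by (intro mult_right_mono) auto
  also have "\<dots> \<le> (\<bar>b\<bar> + 1) * (m / (2 * (\<bar>b\<bar> + 1)))" using s by (intro mult_left_mono) auto
  also have "\<dots> = m / 2" by (simp add: field_simps)
  also have "\<dots> < m" using m0 by simp
  finally have "0 < (m - b * s) * s" using s by simp
  also have "\<dots> = m * s - b * s\<^sup>2" by (simp add: algebra_simps power2_eq_square)
  also have "\<dots> \<le> branch_prob p s"
    unfolding b_def m_def using s t by (intro branch_prob_ge[OF i2]) auto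
  also have "\<dots> \<le> branch_prob p t" using s t by (intro branch_prob_mono) auto
  finally show ?thesis .
qed

section \<open>Averages over one jump\<close>

locale centered_jump =
  fixes a :: "int pmf" and R :: int and V :: real
  assumes jump_le: "j \<in> set_pmf a \<Longrightarrow> \<bar>j\<bar> \<le> R"
    and jump_mean: "(\<Sum>j\<in>set_pmf a. pmf a j * real_of_int j) = 0"
    and jump_var: "(\<Sum>j\<in>set_pmf a. pmf a j * (real_of_int j)\<^sup>2) = V"
    and V_pos: "V > 0"
begin

definition avg :: "(int \<Rightarrow> real) \<Rightarrow> int \<Rightarrow> real" where
  "avg f z = (\<Sum>j\<in>set_pmf a. pmf a j * f (z - j))"

lemma finite_jumps: "finite (set_pmf a)"
proof (rule finite_subset)
  show "set_pmf a \<subseteq> {-R..R}" using jump_le by (auto simp: abs_le_iff) (metis minus_le_iff)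
qed simp

lemma R_nonneg: "R \<ge> 0"
  using jump_le set_pmf_not_empty[of a] by fastforce

lemma sum_jumps: "(\<Sum>j\<in>set_pmf a. pmf a j) = 1"
  using sum_pmf_eq_1[OF finite_jumps order_refl] .

lemma expectation_jump: "measure_pmf.expectation a (\<lambda>j. f (z - j)) = avg f z"
  unfolding avg_def by (subst integral_measure_pmf_real[OF finite_jumps]) (auto simp: mult.commute)

lemma avg_mono: "(\<And>j. j \<in> set_pmf a \<Longrightarrow> f (z - j) \<le> g (z - j)) \<Longrightarrow> avg f z \<le> avg g z"
  unfolding avg_def by (intro sum_mono mult_left_mono) auto

lemma avg_cmult: "avg (\<lambda>y. c * f y) z = c * avg f z"
  unfolding avg_def by (simp add: sum_distrib_left mult_ac)

lemma avg_diff: "avg (\<lambda>y. f y - g y) z = avg f z - avg g z"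
  unfolding avg_def by (simp add: sum_subtractf right_diff_distrib)

lemma avg_const [simp]: "avg (\<lambda>y. c) z = c"
  unfolding avg_def by (simp add: sum_jumps flip: sum_distrib_right)

lemma avg_int [simp]: "avg real_of_int z = real_of_int z"
  unfolding avg_def by (simp add: right_diff_distrib sum_subtractf jump_mean sum_jumps flip: sum_distrib_right)

text \<open>Jensen's inequality through the tangent to the square at f z, not at the mean; the first
  hypothesis compensates for the different base point.\<close>

lemma avg_sq_ge:
  assumes "avg f z \<ge> f z" "f z \<ge> 0"
  shows "avg (\<lambda>y. (f y)\<^sup>2) z \<ge> (f z)\<^sup>2"
proof -
  have "(f z)\<^sup>2 \<le> 2 * f z * avg f z - (f z)\<^sup>2"
    using mult_left_mono[OF assms(1), of "2 * f z"] assms(2) by (simp add: power2_eq_square)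
  also have "\<dots> = avg (\<lambda>y. 2 * f z * f y - (f z)\<^sup>2) z" by (simp add: avg_diff avg_cmult)
  also have "\<dots> \<le> avg (\<lambda>y. (f y)\<^sup>2) z"
  proof (rule avg_mono)
    show "2 * f z * f (z - j) - (f z)\<^sup>2 \<le> (f (z - j))\<^sup>2" for j
      using zero_le_power2[of "f z - f (z - j)"] by (simp add: power2_diff)
  qed
  finally show ?thesis .
qed

lemma ex_positive_jump: "\<exists>j\<in>set_pmf a. j > 0"
proof (rule ccontr)
  assume "\<not> ?thesis"
  then have neg: "\<And>j. j \<in> set_pmf a \<Longrightarrow> j \<le> 0" by (auto simp: not_less)
  have "(\<Sum>j\<in>set_pmf a. - (pmf a j * real_of_int j)) = 0" using jump_mean by (simp add: sum_negf)
  then have z: "\<forall>j\<in>set_pmf a. - (pmf a j * real_of_int j) = 0"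
    using neg by (subst (asm) sum_nonneg_eq_0_iff[OF finite_jumps]) (auto simp: mult_le_0_iff)
  have "(\<Sum>j\<in>set_pmf a. pmf a j * (real_of_int j)\<^sup>2) = 0"
    using z by (intro sum.neutral) auto
  then show False using jump_var V_pos by simp
qed

text \<open>Second-order Taylor expansion: the linear term averages to 0 because the jumps are
  centered, the quadratic one yields V. As \<open>psi2\<close> is decreasing, its value at the
  intermediate point lies between those at the two ends of the range of one jump.\<close>

lemma avg_psi_bounds:
  fixes \<theta> \<rho> \<sigma> h x :: real
  assumes pos: "\<theta> \<noteq> 0" "\<rho> > 0" "\<sigma> > 0" and h: "h > 0" and x: "x - R * h > 0"
  shows "(\<Sum>j\<in>set_pmf a. pmf a j * psi \<theta> \<sigma> \<rho> (x - j * h)) - psi \<theta> \<sigma> \<rho> x \<le> V / 2 * h\<^sup>2 * psi2 \<theta> \<sigma> \<rho> (x - R * h)"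
    and "V / 2 * h\<^sup>2 * psi2 \<theta> \<sigma> \<rho> (x + R * h) \<le> (\<Sum>j\<in>set_pmf a. pmf a j * psi \<theta> \<sigma> \<rho> (x - j * h)) - psi \<theta> \<sigma> \<rho> x"
proof -
  let ?f = "psi \<theta> \<sigma> \<rho>" and ?g = "psi1 \<theta> \<sigma> \<rho>" and ?h = "psi2 \<theta> \<sigma> \<rho>"
  have tay: "?f (x - j * h) \<le> ?f x - ?g x * (j * h) + ?h (x - R * h) / 2 * (j * h)\<^sup>2 \<and>
      ?f (x - j * h) \<ge> ?f x - ?g x * (j * h) + ?h (x + R * h) / 2 * (j * h)\<^sup>2"
    if "j \<in> set_pmf a" for j
  proof (cases "j = 0")
    case False
    have jR: "\<bar>real_of_int j\<bar> \<le> R" using jump_le[OF that] by linarith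
    have jh: "- (R * h) \<le> j * h" "j * h \<le> R * h"
      using jR h mult_right_mono[of "- real_of_int R" j h] by (auto intro!: mult_right_mono simp: abs_le_iff)
    have R0: "0 \<le> R * h" using R_nonneg h by simp
    define D where "D = (\<lambda>m::nat. if m = 0 then ?f else if m = 1 then ?g else ?h)"
    have "\<exists>t. (if x - j * h < x then x - j * h < t \<and> t < x else x < t \<and> t < x - j * h) \<and>
       ?f (x - j * h) = (\<Sum>m<2. D m x / fact m * (x - j * h - x) ^ m) + D 2 t / fact 2 * (x - j * h - x) ^ 2"
    proof (rule Taylor[where a = "x - R * h" and b = "x + R * h"])
      show "\<forall>m t. m < 2 \<and> x - R * h \<le> t \<and> t \<le> x + R * h \<longrightarrow> DERIV (D m) t :> D (Suc m) t"
        using pos x by (auto simp: D_def less_2_cases_iff intro: has_real_derivative_psi has_real_derivative_psi1)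
    qed (use jh R0 False h in \<open>auto simp: D_def\<close>)
    then obtain t where t0: "if x - j * h < x then x - j * h < t \<and> t < x else x < t \<and> t < x - j * h"
      and eq: "?f (x - j * h) = (\<Sum>m<2. D m x / fact m * (x - j * h - x) ^ m) + D 2 t / fact 2 * (x - j * h - x) ^ 2"
      by blast
    have t: "x - R * h \<le> t" "t \<le> x + R * h" using t0 jh R0 by (auto split: if_splits)
    have "?f (x - j * h) = ?f x - ?g x * (j * h) + ?h t / 2 * (j * h)\<^sup>2"
      unfolding eq by (simp add: D_def numeral_2_eq_2)
    moreover have "?h t \<le> ?h (x - R * h)" "?h t \<ge> ?h (x + R * h)"
      using pos x t by (auto intro!: psi2_antimono)
    ultimately show ?thesis by (auto intro!: mult_right_mono)
  qed simp
  have s: "(\<Sum>j\<in>set_pmf a. pmf a j * (A - B * (j * h) + C / 2 * (j * h)\<^sup>2)) = A + V / 2 * h\<^sup>2 * C" for A B C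
  proof -
    have "(\<Sum>j\<in>set_pmf a. pmf a j * (A - B * (j * h) + C / 2 * (j * h)\<^sup>2))
       = (\<Sum>j\<in>set_pmf a. pmf a j * A - (B * h) * (pmf a j * j) + (C / 2 * h\<^sup>2) * (pmf a j * (real_of_int j)\<^sup>2))"
      by (intro sum.cong refl) (simp add: algebra_simps power_mult_distrib)
    also have "\<dots> = A - (B * h) * 0 + (C / 2 * h\<^sup>2) * V"
      by (simp only: sum.distrib sum_subtractf jump_mean jump_var flip: sum_distrib_left sum_distrib_right) (simp add: sum_jumps)
    finally show ?thesis by simp
  qed
  have "(\<Sum>j\<in>set_pmf a. pmf a j * ?f (x - j * h))
     \<le> (\<Sum>j\<in>set_pmf a. pmf a j * (?f x - ?g x * (j * h) + ?h (x - R * h) / 2 * (j * h)\<^sup>2))"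
    using tay by (intro sum_mono mult_left_mono) auto
  then show "(\<Sum>j\<in>set_pmf a. pmf a j * ?f (x - j * h)) - ?f x \<le> V / 2 * h\<^sup>2 * ?h (x - R * h)"
    unfolding s by simp
  have "(\<Sum>j\<in>set_pmf a. pmf a j * ?f (x - j * h))
     \<ge> (\<Sum>j\<in>set_pmf a. pmf a j * (?f x - ?g x * (j * h) + ?h (x + R * h) / 2 * (j * h)\<^sup>2))"
    using tay by (intro sum_mono mult_left_mono) auto
  then show "V / 2 * h\<^sup>2 * ?h (x + R * h) \<le> (\<Sum>j\<in>set_pmf a. pmf a j * ?f (x - j * h)) - ?f x"
    unfolding s by simp
qed

end

section \<open>Discrete super- and subsolutions\<close>

text \<open>Since Q t / t is nonincreasing, s * Q (s + t) <= (s + t) * Q s, and likewise with s and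
  t exchanged; the sum of both is the claim times s + t.\<close>

lemma branch_prob_subadditive:
  assumes "s > 0" "t > 0" "s + t \<le> 1"
  shows "branch_prob p (s + t) \<le> branch_prob p s + branch_prob p t"
proof -
  have *: "x * branch_prob p y \<le> y * branch_prob p x" if "0 < x" "x \<le> y" "y \<le> 1" for x y
  proof -
    have "branch_prob p (y / x * x) \<le> y / x * branch_prob p x"
      using that by (intro branch_prob_scale) auto
    then show ?thesis using that by (simp add: field_simps)
  qed
  have "(s + t) * branch_prob p (s + t) \<le> (s + t) * (branch_prob p s + branch_prob p t)"
    using *[of s "s + t"] *[of t "s + t"] assms by (simp add: algebra_simps)
  then show ?thesis using assms by simp
qed

locale branching_jump = centered_jump +
  fixes p :: "nat pmf"
  assumes offspring_sq: "integrable (measure_pmf p) (\<lambda>i. (real i)\<^sup>2)"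
    and offspring_mean_pos: "measure_pmf.expectation p real > 0"
begin

abbreviation Q :: "real \<Rightarrow> real" where "Q \<equiv> branch_prob p"

abbreviation reach :: "nat \<Rightarrow> int \<Rightarrow> real" where "reach \<equiv> reach_prob a p"

definition ever_reach :: "int \<Rightarrow> real" where
  "ever_reach z = (SUP m. reach m z)"

lemma reach_Suc: "reach (Suc m) z = (if z \<le> 0 then 1 else avg (\<lambda>y. Q (reach m y)) z)"
  by (simp add: expectation_jump[of "\<lambda>y. Q (reach m y)"])

lemma reach_mono: "reach m z \<le> reach (Suc m) z"
proof (induction m arbitrary: z)
  case 0
  show ?case
  proof (cases "z \<le> 0")
    case False
    then show ?thesis using reach_prob_bounds(1)[of a p "Suc 0" z] by (simp del: reach_prob.simps(2))
  qed simp
next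
  case (Suc m)
  show ?case
  proof (cases "z \<le> 0")
    case False
    have "avg (\<lambda>y. Q (reach m y)) z \<le> avg (\<lambda>y. Q (reach (Suc m) y)) z"
      by (intro avg_mono branch_prob_mono reach_prob_bounds Suc)
    then show ?thesis using False by (simp only: reach_Suc if_False)
  qed simp
qed

lemma reach_tendsto: "(\<lambda>m. reach m z) \<longlonglongrightarrow> ever_reach z"
  unfolding ever_reach_def using reach_mono reach_prob_bounds[of a p]
  by (intro LIMSEQ_incseq_SUP bdd_aboveI[of _ 1] incseq_SucI) auto

lemma reach_le_ever_reach: "reach m z \<le> ever_reach z"
  using incseq_le[OF incseq_SucI reach_tendsto, of z m] reach_mono by simp

lemma ever_reach_le: "(\<And>m. reach m z \<le> c) \<Longrightarrow> ever_reach z \<le> c"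
  unfolding ever_reach_def by (intro cSUP_least) auto

lemma ever_reach_nonneg: "0 \<le> ever_reach z"
  using reach_le_ever_reach[of 0 z] reach_prob_bounds[of a p 0 z] by linarith

lemma ever_reach_le_1: "ever_reach z \<le> 1"
  by (intro ever_reach_le reach_prob_bounds)

lemma ever_reach_eq_1: "z \<le> 0 \<Longrightarrow> ever_reach z = 1"
  using reach_le_ever_reach[of 0 z] ever_reach_le_1[of z] by simp

text \<open>Passing to the limit in the recursion needs continuity of Q from below along the
  increasing iterates. The scaling property provides it: Q (reach) lies between (reach / ever_reach)
  * Q (ever_reach) and Q (ever_reach).\<close>

lemma ever_reach_ge_avg:
  assumes "z \<ge> 1"
  shows "ever_reach z \<ge> avg (\<lambda>y. Q (ever_reach y)) z"
proof -
  have lim: "(\<lambda>m. Q (reach m y)) \<longlonglongrightarrow> Q (ever_reach y)" for y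
  proof (cases "ever_reach y = 0")
    case True
    then have "reach m y = 0" for m
      using reach_le_ever_reach[of m y] reach_prob_bounds[of a p m y] by simp
    then show ?thesis using True by simp
  next
    case False
    then have up: "ever_reach y > 0" using ever_reach_nonneg[of y] by simp
    have lb: "reach m y / ever_reach y * Q (ever_reach y) \<le> Q (reach m y)" for m
    proof (cases "reach m y = 0")
      case False
      then have rp: "reach m y > 0" using reach_prob_bounds[of a p m y] by simp
      have "Q (ever_reach y / reach m y * reach m y) \<le> ever_reach y / reach m y * Q (reach m y)"
        using rp reach_le_ever_reach[of m y] ever_reach_le_1[of y] by (intro branch_prob_scale) auto
      then show ?thesis using rp up by (simp add: field_simps)
    qed simp
    have ub: "Q (reach m y) \<le> Q (ever_reach y)" for m
      using reach_le_ever_reach[of m y] reach_prob_bounds[of a p m y] ever_reach_le_1[of y]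
      by (intro branch_prob_mono) auto
    have "(\<lambda>m. reach m y / ever_reach y * Q (ever_reach y)) \<longlonglongrightarrow> ever_reach y / ever_reach y * Q (ever_reach y)"
      using up by (intro tendsto_intros reach_tendsto) auto
    then have "(\<lambda>m. reach m y / ever_reach y * Q (ever_reach y)) \<longlonglongrightarrow> Q (ever_reach y)" using up by simp
    then show ?thesis
      by (rule tendsto_sandwich[OF always_eventually always_eventually _ tendsto_const, rotated 2]) (use lb ub in auto)
  qed
  have "(\<lambda>m. avg (\<lambda>y. Q (reach m y)) z) \<longlonglongrightarrow> avg (\<lambda>y. Q (ever_reach y)) z"
    unfolding avg_def by (intro tendsto_intros lim)
  moreover have "avg (\<lambda>y. Q (reach m y)) z \<le> ever_reach z" for m
    using reach_le_ever_reach[of "Suc m" z] assms by (simp only: reach_Suc) simp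
  ultimately show ?thesis by (intro LIMSEQ_le_const2) auto
qed

text \<open>With positive probability a particle makes a positive jump and has a successful child,
  so positivity passes from the closer target z - j to z. It is what permits division by
  \<open>ever_reach\<close> in the comparison below.\<close>

lemma ever_reach_pos: "ever_reach z > 0"
proof (cases "z \<le> 0")
  case False
  obtain j where j: "j \<in> set_pmf a" "j > 0" using ex_positive_jump by blast
  have "ever_reach (int n) > 0" for n
  proof (induction n rule: less_induct)
    case (less n)
    show ?case
    proof (cases "n = 0")
      case False
      have prev: "ever_reach (int n - j) > 0"
      proof (cases "int n - j \<le> 0")
        case False
        then have "ever_reach (int (nat (int n - j))) > 0" using j by (intro less) linarith
        then show ?thesis using False by simp
      qed (simp add: ever_reach_eq_1)
      then have "0 < pmf a j * Q (ever_reach (int n - j))"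
        using j ever_reach_le_1 by (intro mult_pos_pos branch_prob_pos offspring_sq offspring_mean_pos) (auto simp: pmf_positive)
      also have "\<dots> \<le> avg (\<lambda>y. Q (ever_reach y)) (int n)"
        unfolding avg_def using j ever_reach_nonneg ever_reach_le_1
        by (intro member_le_sum) (auto simp: finite_jumps intro!: mult_nonneg_nonneg branch_prob_bounds)
      also have "\<dots> \<le> ever_reach (int n)" using False by (intro ever_reach_ge_avg) auto
      finally show ?thesis .
    qed (simp add: ever_reach_eq_1)
  qed
  from this[of "nat z"] show ?thesis using False by simp
qed (simp add: ever_reach_eq_1)

text \<open>At a maximum of the ratio of \<^term>\<open>v\<close> to \<^term>\<open>ever_reach\<close> that exceeds 1, the scaling
  property of \<^term>\<open>Q\<close> would contradict strictness.\<close>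

lemma strict_subsolution_le_ever_reach:
  assumes bd: "\<And>z. z \<ge> 1 - R \<Longrightarrow> 0 \<le> v z \<and> v z \<le> 1"
    and far: "\<And>z. z > N \<Longrightarrow> v z \<le> ever_reach z"
    and sub: "\<And>z. z \<ge> 1 \<Longrightarrow> v z > 0 \<Longrightarrow> v z < avg (\<lambda>y. Q (v y)) z"
    and z: "z \<ge> 1"
  shows "v z \<le> ever_reach z"
proof (rule ccontr)
  assume "\<not> v z \<le> ever_reach z"
  define F where "F = {y \<in> {1..N}. v y > ever_reach y}"
  have "finite F" by (rule finite_subset[of _ "{1..N}"]) (auto simp: F_def)
  have zF: "z \<in> F" using far[of z] z \<open>\<not> v z \<le> ever_reach z\<close> by (auto simp: F_def not_le) (meson not_le)
  define c where "c = Max ((\<lambda>y. v y / ever_reach y) ` F)"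
  have "c \<in> (\<lambda>y. v y / ever_reach y) ` F"
    unfolding c_def using \<open>finite F\<close> zF by (intro Max_in) auto
  then obtain x where x: "x \<in> F" "v x = c * ever_reach x"
    using ever_reach_pos by (auto simp: less_imp_neq[symmetric])
  have "c * ever_reach x > ever_reach x" using x by (simp add: F_def)
  then have c1: "c > 1" using ever_reach_pos[of x] by simp
  have le: "v y \<le> c * ever_reach y" if "y \<ge> 1 - R" for y
  proof (cases "y \<in> F")
    case True
    then have "v y / ever_reach y \<le> c" unfolding c_def using \<open>finite F\<close> by (intro Max_ge) auto
    then show ?thesis using ever_reach_pos[of y] by (simp add: field_simps)
  next
    case False
    have "v y \<le> ever_reach y"
    proof (cases "y \<le> 0")
      case True
      then show ?thesis using bd[OF that] by (simp add: ever_reach_eq_1)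
    next
      case F: False
      then show ?thesis using False far[of y] by (cases "y > N") (auto simp: F_def)
    qed
    also have "\<dots> \<le> c * ever_reach y" using c1 ever_reach_pos[of y] by simp
    finally show ?thesis .
  qed
  have Qle: "Q (v y) \<le> c * Q (ever_reach y)" if "y \<ge> 1 - R" for y
  proof (cases "c * ever_reach y \<le> 1")
    case True
    have "Q (v y) \<le> Q (c * ever_reach y)" using bd[OF that] le[OF that] True by (intro branch_prob_mono) auto
    also have "\<dots> \<le> c * Q (ever_reach y)" using c1 True ever_reach_nonneg by (intro branch_prob_scale) auto
    finally show ?thesis .
  next
    case False
    \<comment> \<open>Scaling applies only up to the value 1. When c * ever_reach y exceeds 1, the
      smaller factor d reaches exactly 1, which already dominates v y.\<close>
    define d where "d = 1 / ever_reach y"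
    have d: "d \<ge> 1" "d \<le> c" "d * ever_reach y = 1"
      using ever_reach_pos[of y] ever_reach_le_1[of y] False by (auto simp: d_def field_simps)
    have "Q (v y) \<le> Q (d * ever_reach y)" using bd[OF that] d by (intro branch_prob_mono) auto
    also have "\<dots> \<le> d * Q (ever_reach y)" using d ever_reach_nonneg by (intro branch_prob_scale) auto
    also have "\<dots> \<le> c * Q (ever_reach y)"
      using d ever_reach_nonneg ever_reach_le_1 by (intro mult_right_mono branch_prob_bounds) auto
    finally show ?thesis .
  qed
  have x1: "x \<ge> 1" "v x > 0" using x ever_reach_pos[of x] by (auto simp: F_def intro: less_trans)
  have "v x < avg (\<lambda>y. Q (v y)) x" using x1 by (rule sub)
  also have "\<dots> \<le> avg (\<lambda>y. c * Q (ever_reach y)) x"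
    using x1 by (intro avg_mono Qle) (use jump_le in \<open>force simp: abs_le_iff\<close>)
  also have "\<dots> \<le> c * ever_reach x"
    unfolding avg_cmult using c1 x1 by (intro mult_left_mono ever_reach_ge_avg) auto
  finally show False using x by simp
qed

text \<open>Below the root of \<eta> = \<beta> t the constant t is a strict subsolution, but nothing
  is known about \<open>ever_reach\<close> far out. It is therefore tilted into a linear function,
  which averaging over a centered jump preserves, and cut off at 0; the slope then tends to
  0.\<close>

lemma survival_le_ever_reach:
  assumes Qge: "\<And>t. 0 \<le> t \<Longrightarrow> t \<le> 1 \<Longrightarrow> Q t \<ge> (1 + \<eta>) * t - \<beta> * t\<^sup>2"
    and pos: "\<eta> > 0" "\<beta> > 0" and t: "0 < t" "t \<le> 1" "\<beta> * t < \<eta>" and z: "z \<ge> 1"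
  shows "ever_reach z \<ge> t"
proof -
  have lin: "t * (1 - real_of_int (z + R) / N) \<le> ever_reach z" if N: "N \<ge> 1" for N :: nat
  proof -
    \<comment> \<open>The summand R keeps l at most t on all sites y >= 1 - R that a jump from y >=
      1 can reach.\<close>
    define l where "l = (\<lambda>y. t * (1 - real_of_int (y + R) / N))"
    define v where "v = (\<lambda>y. max 0 (l y))"
    have "v z \<le> ever_reach z"
    proof (rule strict_subsolution_le_ever_reach[where N = "int N"])
      fix y assume y: "y \<ge> 1 - R"
      have "l y \<le> t * 1" unfolding l_def using t y N by (intro mult_left_mono) auto
      then show "0 \<le> v y \<and> v y \<le> 1" using t by (auto simp: v_def)
    next
      fix y assume y: "y > int N"
      have "real_of_int y > real N" using y by linarith
      then have "1 - real_of_int (y + R) / N \<le> 0" using N R_nonneg by (simp add: field_simps)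
      then have "l y \<le> 0" using t unfolding l_def by (intro mult_nonneg_nonpos) auto
      then show "v y \<le> ever_reach y" using ever_reach_nonneg by (simp add: v_def)
    next
      fix y assume y: "y \<ge> 1" "v y > 0"
      define \<kappa> where "\<kappa> = 1 + \<eta> - \<beta> * t"
      have k: "\<kappa> > 1" using t by (simp add: \<kappa>_def)
      have vt: "0 \<le> v x" "v x \<le> t" if "x \<ge> 1 - R" for x
      proof -
        have "l x \<le> t * 1" unfolding l_def using t that N by (intro mult_left_mono) auto
        then show "0 \<le> v x" "v x \<le> t" using t by (auto simp: v_def)
      qed
      have "avg l y = l y"
      proof -
        have "l = (\<lambda>y. (t * (1 - real_of_int R / N)) - (t / N) * real_of_int y)"
          by (auto simp: l_def algebra_simps add_divide_distrib diff_divide_distrib)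
        then show ?thesis by (simp only: avg_diff avg_cmult avg_const avg_int)
      qed
      moreover have "avg l y \<le> avg v y" by (intro avg_mono) (simp add: v_def)
      moreover have "v y = l y" using y by (simp add: v_def max_def split: if_splits)
      ultimately have "v y \<le> avg v y" by simp
      then have "v y < \<kappa> * avg v y"
        using y(2) mult_strict_right_mono[OF k, of "avg v y"] by linarith
      also have "\<dots> = avg (\<lambda>x. \<kappa> * v x) y" by (simp add: avg_cmult)
      also have "\<dots> \<le> avg (\<lambda>x. Q (v x)) y"
      proof (rule avg_mono)
        fix j assume j: "j \<in> set_pmf a"
        have yj: "y - j \<ge> 1 - R" using jump_le[OF j] y by linarith
        note vb = vt[OF yj]
        have "\<kappa> * v (y - j) = (1 + \<eta>) * v (y - j) - \<beta> * t * v (y - j)" by (simp add: \<kappa>_def algebra_simps)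
        also have "\<dots> \<le> (1 + \<eta>) * v (y - j) - \<beta> * v (y - j) * v (y - j)"
          using vb pos by (intro diff_left_mono mult_right_mono mult_left_mono) auto
        also have "\<dots> \<le> Q (v (y - j))" using Qge[of "v (y - j)"] vb t by (simp add: power2_eq_square)
        finally show "\<kappa> * v (y - j) \<le> Q (v (y - j))" .
      qed
      finally show "v y < avg (\<lambda>x. Q (v x)) y" .
    qed (rule z)
    then show ?thesis by (simp add: v_def l_def)
  qed
  have "(\<lambda>N. t * (1 - real_of_int (z + R) / real N)) \<longlonglongrightarrow> t * (1 - 0)"
    by (intro tendsto_intros lim_const_over_n)
  then have "t * (1 - 0) \<le> ever_reach z"
    by (rule LIMSEQ_le_const2) (use lin in blast)
  then show ?thesis by simp
qed

text \<open>\<^term>\<open>Q\<close> is only controlled on \<open>[0, \<delta>]\<close>. Where the barrier is at least \<open>\<delta>\<close> there is nothing to prove;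
  elsewhere \<open>ratio\<close> keeps it below \<open>2\<delta>\<close> on the range of one jump, where the quadratic bound for
  \<^term>\<open>Q\<close> is still increasing.\<close>

lemma ever_reach_le_psi:
  fixes \<theta> \<sigma> \<rho> \<delta> :: real and n :: nat and j b :: int
  assumes par: "\<theta> \<noteq> 0" "\<rho> > 0" "\<sigma> > 0" "n \<ge> 1" "\<bar>\<theta>\<bar> / n \<le> 1 / 2" "4 * \<sigma>\<^sup>2 * \<delta> \<le> 1"
    and b: "b \<ge> 1" "b - R + j > 0"
    and Qle: "\<And>t. 0 \<le> t \<Longrightarrow> t \<le> \<delta> \<Longrightarrow> Q t \<le> (1 + \<theta> / n) * t - \<sigma>\<^sup>2 / 2 * t\<^sup>2"
  defines "w \<equiv> \<lambda>z::int. (real_of_int z + j) / sqrt n"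
  assumes ratio: "\<And>z. z \<ge> b \<Longrightarrow> psi \<theta> \<sigma> \<rho> (w (z - R)) \<le> 2 * psi \<theta> \<sigma> \<rho> (w z)"
    and ratio2: "\<And>z. z \<ge> b \<Longrightarrow> (1 + \<bar>\<theta>\<bar> / n) * V * psi2 \<theta> \<sigma> \<rho> (w (z - R)) \<le> \<rho>\<^sup>2 * psi2 \<theta> \<sigma> \<rho> (w z)"
    and small: "\<And>z. z \<ge> b - R \<Longrightarrow> ever_reach z \<le> \<delta>"
    and start: "\<And>z. b - R \<le> z \<Longrightarrow> z < b \<Longrightarrow> \<delta> \<le> psi \<theta> \<sigma> \<rho> (w z) / n"
    and z: "z \<ge> b - R"
  shows "ever_reach z \<le> psi \<theta> \<sigma> \<rho> (w z) / n"
proof -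
  let ?f = "psi \<theta> \<sigma> \<rho>" and ?g = "psi2 \<theta> \<sigma> \<rho>"
  define v where "v = (\<lambda>z. ?f (w z) / n)"
  define q where "q = (\<lambda>t. (1 + \<theta> / n) * t - \<sigma>\<^sup>2 / 2 * t\<^sup>2)"
  define h where "h = 1 / sqrt n"
  have h: "h > 0" "h\<^sup>2 = 1 / n" using par by (auto simp: h_def power_divide)
  have n0: "real n > 0" using par by simp
  have wpos: "w z > 0" if "z \<ge> b - R" for z
    using that b par unfolding w_def by (intro divide_pos_pos) auto
  have vpos: "v z > 0" if "z \<ge> b - R" for z
    using wpos[OF that] par unfolding v_def by (intro divide_pos_pos psi_pos) auto
  \<comment> \<open>q t - q s is t - s times (1 + \<theta> / n) - \<sigma>^2 / 2 * (s + t). On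
    [0, 2 \<delta>] the subtracted term is at most 2 \<sigma>^2 \<delta> <= 1 / 2, while 1 +
    \<theta> / n >= 1 / 2.\<close>
  have qmono: "q s \<le> q t" if "0 \<le> s" "s \<le> t" "t \<le> 2 * \<delta>" for s t
  proof -
    have "\<sigma>\<^sup>2 / 2 * (s + t) \<le> \<sigma>\<^sup>2 / 2 * (4 * \<delta>)" using that by (intro mult_left_mono) auto
    also have "\<dots> \<le> 1 / 2" using par(6) by (simp add: mult_ac)
    also have "\<dots> \<le> 1 + \<theta> / n" using par(5) abs_ge_minus_self[of "\<theta> / n"] unfolding abs_divide abs_of_nat by linarith
    finally have "0 \<le> (t - s) * ((1 + \<theta> / n) - \<sigma>\<^sup>2 / 2 * (s + t))" using that by (intro mult_nonneg_nonneg) auto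
    also have "\<dots> = q t - q s" by (simp add: q_def algebra_simps power2_eq_square add_divide_distrib diff_divide_distrib)
    finally show ?thesis by simp
  qed
  \<comment> \<open>Jensen's inequality handles the square, the Taylor bound estimates avg v z - v z
    by V and \<open>psi2\<close> at w (z - R), and \<open>ratio2\<close> exchanges these for
    \<rho>^2 and \<open>psi2\<close> at w z. The equation for \<open>psi\<close> then cancels
    everything except v z.\<close>
  have step: "avg (\<lambda>y. q (v y)) z \<le> v z" if zz: "z \<ge> b" for z
  proof -
    have wz: "w z - R * h = w (z - R)" by (simp add: w_def h_def diff_divide_distrib add_divide_distrib)
    have wj: "w (z - j') = w z - j' * h" for j' by (simp add: w_def h_def diff_divide_distrib add_divide_distrib)
    have wr: "w z - R * h > 0" unfolding wz using zz by (intro wpos) auto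
    have av: "avg v z = (\<Sum>j\<in>set_pmf a. pmf a j * ?f (w z - j * h)) / n"
      unfolding avg_def v_def wj by (simp add: sum_divide_distrib)
    define \<Delta> where "\<Delta> = avg v z - v z"
    have D: "\<Delta> = ((\<Sum>j\<in>set_pmf a. pmf a j * ?f (w z - j * h)) - ?f (w z)) / n"
      unfolding \<Delta>_def av by (simp add: v_def diff_divide_distrib)
    have D0: "0 \<le> \<Delta>"
    proof -
      have "0 \<le> V / 2 * h\<^sup>2 * ?g (w z + R * h)"
        using V_pos wpos[of z] zz R_nonneg h par by (intro mult_nonneg_nonneg less_imp_le[OF psi2_pos]) (auto intro: add_pos_nonneg)
      then show ?thesis unfolding D using avg_psi_bounds(2)[OF par(1-3) h(1) wr] n0 by (intro divide_nonneg_pos) auto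
    qed
    have D1: "\<Delta> \<le> V / 2 / n\<^sup>2 * ?g (w (z - R))"
    proof -
      have "\<Delta> \<le> (V / 2 * h\<^sup>2 * ?g (w z - R * h)) / n"
        unfolding D using avg_psi_bounds(1)[OF par(1-3) h(1) wr] n0 by (intro divide_right_mono) auto
      then show ?thesis unfolding wz h(2) by (simp add: power2_eq_square)
    qed
    have sq: "avg (\<lambda>y. (v y)\<^sup>2) z \<ge> (v z)\<^sup>2"
      using D0 vpos[of z] zz R_nonneg by (intro avg_sq_ge) (auto simp: \<Delta>_def)
    have "avg (\<lambda>y. q (v y)) z = (1 + \<theta> / n) * avg v z - \<sigma>\<^sup>2 / 2 * avg (\<lambda>y. (v y)\<^sup>2) z"
      unfolding q_def avg_diff avg_cmult ..
    also have "\<dots> \<le> (1 + \<theta> / n) * avg v z - \<sigma>\<^sup>2 / 2 * (v z)\<^sup>2"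
      using sq by (intro diff_left_mono mult_left_mono) auto
    also have "\<dots> = v z + \<theta> / n * v z + (1 + \<theta> / n) * \<Delta> - \<sigma>\<^sup>2 / 2 * (v z)\<^sup>2"
      by (simp add: \<Delta>_def algebra_simps)
    also have "(1 + \<theta> / n) * \<Delta> \<le> (1 + \<bar>\<theta>\<bar> / n) * (V / 2 / n\<^sup>2 * ?g (w (z - R)))"
      using D0 D1 n0 by (intro mult_mono) (auto intro!: add_nonneg_nonneg divide_right_mono)
    also have "\<dots> = ((1 + \<bar>\<theta>\<bar> / n) * V * ?g (w (z - R))) / (2 * n\<^sup>2)"
      by simp
    also have "\<dots> \<le> (\<rho>\<^sup>2 * ?g (w z)) / (2 * n\<^sup>2)"
      using ratio2[OF zz] by (intro divide_right_mono) auto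
    also have "\<dots> = (\<rho>\<^sup>2 / 2 * ?g (w z)) / n\<^sup>2" by simp
    also have "\<rho>\<^sup>2 / 2 * ?g (w z) = - \<theta> * ?f (w z) + \<sigma>\<^sup>2 / 2 * (?f (w z))\<^sup>2"
      using wpos[of z] zz R_nonneg par by (intro psi_ode) auto
    also have "v z + \<theta> / n * v z + (- \<theta> * ?f (w z) + \<sigma>\<^sup>2 / 2 * (?f (w z))\<^sup>2) / n\<^sup>2 - \<sigma>\<^sup>2 / 2 * (v z)\<^sup>2 = v z"
      using n0 by (simp add: v_def power_divide add_divide_distrib diff_divide_distrib power2_eq_square)
    finally show ?thesis by simp
  qed
  have "reach m z \<le> v z" if "z \<ge> b - R" for m z
    using that
  proof (induction m arbitrary: z)
    case 0
    show ?case
    proof (cases "z \<ge> b")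
      case True
      then show ?thesis using b vpos[OF 0] by simp
    next
      case False
      then show ?thesis using start[of z] small[OF 0] 0 reach_le_ever_reach[of 0 z] by (simp add: v_def)
    qed
  next
    case (Suc m)
    show ?case
    proof (cases "z < b \<or> v z \<ge> \<delta>")
      case True
      have "reach (Suc m) z \<le> \<delta>" using small[OF Suc.prems] reach_le_ever_reach[of "Suc m" z] by linarith
      then show ?thesis using True start[of z] Suc.prems by (auto simp: v_def)
    next
      case False
      then have zz: "z \<ge> b" "v z < \<delta>" by auto
      have "reach (Suc m) z = avg (\<lambda>y. Q (reach m y)) z" using zz b by (simp only: reach_Suc) simp
      also have "\<dots> \<le> avg (\<lambda>y. q (v y)) z"
      proof (rule avg_mono)
        fix j' assume j': "j' \<in> set_pmf a"
        have zj: "z - R \<le> z - j'" using jump_le[OF j'] by linarith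
        then have zj': "z - j' \<ge> b - R" using zz by linarith
        have "Q (reach m (z - j')) \<le> q (reach m (z - j'))"
          unfolding q_def using small[OF zj'] reach_le_ever_reach[of m "z - j'"] reach_prob_bounds[of a p m "z - j'"]
          by (intro Qle) auto
        also have "\<dots> \<le> q (v (z - j'))"
        proof (rule qmono)
          show "reach m (z - j') \<le> v (z - j')" by (rule Suc.IH[OF zj'])
          have "w (z - R) \<le> w (z - j')" using zj unfolding w_def by (intro divide_right_mono) auto
          then have "?f (w (z - j')) \<le> ?f (w (z - R))"
            using wpos[of "z - R"] zz par by (intro psi_antimono) auto
          then have "v (z - j') \<le> 2 * v z"
            using divide_right_mono[OF order_trans[OF _ ratio[OF zz(1)]], of _ "real n"] by (simp add: v_def)
          then show "v (z - j') \<le> 2 * \<delta>" using zz by simp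
        qed (rule reach_prob_bounds)
        finally show "Q (reach m (z - j')) \<le> q (v (z - j'))" .
      qed
      also have "\<dots> \<le> v z" by (rule step[OF zz(1)])
      finally show ?thesis .
    qed
  qed
  then show ?thesis using z unfolding v_def by (intro ever_reach_le) auto
qed

text \<open>The barrier is a strict subsolution, strictness coming from \<open>ratio2\<close>, and
  \<open>start\<close> keeps it in [0, 1], where the bounds on Q hold. The condition
  \<open>far\<close> puts its limit at infinity, 2 \<theta> / (\<sigma>^2 n), below the survival
  level \<theta> / (n \<beta>).\<close>

lemma psi_le_ever_reach:
  fixes \<theta> \<sigma> \<rho> \<beta> :: real and n :: nat and j :: int
  assumes par: "\<theta> \<noteq> 0" "\<rho> > 0" "\<sigma> > 0" "n \<ge> 1" "\<bar>\<theta>\<bar> / n \<le> 1 / 2" "\<beta> > 0"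
    and j: "1 - R + j > 0"
    and Qge: "\<And>t. 0 \<le> t \<Longrightarrow> t \<le> 1 \<Longrightarrow> Q t \<ge> (1 + \<theta> / n) * t - \<beta> * t\<^sup>2"
    and Qle: "\<And>t. 0 \<le> t \<Longrightarrow> t \<le> 1 \<Longrightarrow> Q t \<le> (1 + \<theta> / n) * t"
  defines "w \<equiv> \<lambda>z::int. (real_of_int z + j) / sqrt n"
  assumes ratio: "\<And>z. z \<ge> 1 \<Longrightarrow> 2 * \<beta> * (psi \<theta> \<sigma> \<rho> (w (z - R)))\<^sup>2 \<le> \<sigma>\<^sup>2 * (psi \<theta> \<sigma> \<rho> (w z))\<^sup>2"
    and ratio2: "\<And>z. z \<ge> 1 \<Longrightarrow> (1 - \<bar>\<theta>\<bar> / n) * V * psi2 \<theta> \<sigma> \<rho> (w (z + R)) > \<rho>\<^sup>2 * psi2 \<theta> \<sigma> \<rho> (w z)"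
    and start: "psi \<theta> \<sigma> \<rho> (w (1 - R)) / n \<le> 1"
    and far: "\<theta> > 0 \<Longrightarrow> 2 * \<beta> < \<sigma>\<^sup>2"
    and z: "z \<ge> 1"
  shows "psi \<theta> \<sigma> \<rho> (w z) / n \<le> ever_reach z"
proof -
  let ?f = "psi \<theta> \<sigma> \<rho>" and ?g = "psi2 \<theta> \<sigma> \<rho>"
  define v where "v = (\<lambda>z. ?f (w z) / n)"
  define h where "h = 1 / sqrt n"
  have h: "h > 0" "h\<^sup>2 = 1 / n" using par by (auto simp: h_def power_divide)
  have n0: "real n > 0" using par by simp
  have wmono: "w y \<le> w z" if "y \<le> z" for y z
    using that unfolding w_def by (intro divide_right_mono) auto
  have wpos: "w z > 0" if "z \<ge> 1 - R" for z
    using that j par unfolding w_def by (intro divide_pos_pos) auto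
  have vanti: "v z \<le> v y" if "1 - R \<le> y" "y \<le> z" for y z
    unfolding v_def using that wpos[of y] par wmono[of y z] by (intro divide_right_mono psi_antimono) auto
  have vpos: "v z > 0" if "z \<ge> 1 - R" for z
    using wpos[OF that] par unfolding v_def by (intro divide_pos_pos psi_pos) auto
  have v1: "v z \<le> 1" if "z \<ge> 1 - R" for z
    using vanti[of "1 - R" z] that start by (simp add: v_def)
  have sub: "v z < avg (\<lambda>y. Q (v y)) z" if zz: "z \<ge> 1" for z
  proof -
    have wz: "w z - R * h = w (z - R)" "w z + R * h = w (z + R)"
      by (simp_all add: w_def h_def diff_divide_distrib add_divide_distrib)
    have wj: "w (z - j') = w z - j' * h" for j' by (simp add: w_def h_def diff_divide_distrib add_divide_distrib)
    have wr: "w z - R * h > 0" unfolding wz using zz by (intro wpos) auto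
    have av: "avg v z = (\<Sum>j\<in>set_pmf a. pmf a j * ?f (w z - j * h)) / n"
      unfolding avg_def v_def wj by (simp add: sum_divide_distrib)
    define \<Delta> where "\<Delta> = avg v z - v z"
    have D: "\<Delta> = ((\<Sum>j\<in>set_pmf a. pmf a j * ?f (w z - j * h)) - ?f (w z)) / n"
      unfolding \<Delta>_def av by (simp add: v_def diff_divide_distrib)
    have D1: "\<Delta> \<ge> V / 2 / n\<^sup>2 * ?g (w (z + R))"
    proof -
      have "\<Delta> \<ge> (V / 2 * h\<^sup>2 * ?g (w z + R * h)) / n"
        unfolding D using avg_psi_bounds(2)[OF par(1-3) h(1) wr] n0 by (intro divide_right_mono) auto
      then show ?thesis unfolding wz h(2) by (simp add: power2_eq_square)
    qed
    have th: "1 - \<bar>\<theta>\<bar> / n \<le> 1 + \<theta> / n" "0 \<le> 1 - \<bar>\<theta>\<bar> / n"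
      using par(5) abs_ge_minus_self[of "\<theta> / n"] unfolding abs_divide abs_of_nat by linarith+
    have psi20: "0 \<le> V / 2 / n\<^sup>2 * ?g (w (z + R))"
      using V_pos wpos[of "z + R"] zz R_nonneg par by (intro mult_nonneg_nonneg less_imp_le[OF psi2_pos]) auto
    \<comment> \<open>Jensen's inequality points the wrong way here, so the mean of the squares is
      estimated by the largest value, at z - R, and \<open>ratio\<close> pays for the loss.\<close>
    have sq: "\<beta> * avg (\<lambda>y. (v y)\<^sup>2) z \<le> \<sigma>\<^sup>2 / 2 * (v z)\<^sup>2"
    proof -
      have "avg (\<lambda>y. (v y)\<^sup>2) z \<le> avg (\<lambda>y. (v (z - R))\<^sup>2) z"
      proof (rule avg_mono)
        fix j' assume j': "j' \<in> set_pmf a"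
        have zj: "z - R \<le> z - j'" using jump_le[OF j'] by linarith
        show "(v (z - j'))\<^sup>2 \<le> (v (z - R))\<^sup>2"
          using zj zz vpos[of "z - j'"] by (intro power_mono vanti) auto
      qed
      then have "\<beta> * avg (\<lambda>y. (v y)\<^sup>2) z \<le> \<beta> * (v (z - R))\<^sup>2" using par by (intro mult_left_mono) auto
      also have "\<dots> = (2 * \<beta> * (?f (w (z - R)))\<^sup>2) / (2 * n\<^sup>2)" by (simp add: v_def power_divide)
      also have "\<dots> \<le> (\<sigma>\<^sup>2 * (?f (w z))\<^sup>2) / (2 * n\<^sup>2)" using ratio[OF zz] by (intro divide_right_mono) auto
      also have "\<dots> = \<sigma>\<^sup>2 / 2 * (v z)\<^sup>2" by (simp add: v_def power_divide)
      finally show ?thesis .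
    qed
    have "v z = v z + \<theta> / n * v z + (- \<theta> * ?f (w z) + \<sigma>\<^sup>2 / 2 * (?f (w z))\<^sup>2) / n\<^sup>2 - \<sigma>\<^sup>2 / 2 * (v z)\<^sup>2"
      using n0 by (simp add: v_def power_divide add_divide_distrib diff_divide_distrib power2_eq_square)
    also have "- \<theta> * ?f (w z) + \<sigma>\<^sup>2 / 2 * (?f (w z))\<^sup>2 = \<rho>\<^sup>2 / 2 * ?g (w z)"
      using wpos[of z] zz R_nonneg par by (intro psi_ode[symmetric]) auto
    also have "(\<rho>\<^sup>2 / 2 * ?g (w z)) / n\<^sup>2 = (\<rho>\<^sup>2 * ?g (w z)) / (2 * n\<^sup>2)" by simp
    also have "\<dots> < ((1 - \<bar>\<theta>\<bar> / n) * V * ?g (w (z + R))) / (2 * n\<^sup>2)"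
      using ratio2[OF zz] n0 by (intro divide_strict_right_mono) auto
    also have "\<dots> = (1 - \<bar>\<theta>\<bar> / n) * (V / 2 / n\<^sup>2 * ?g (w (z + R)))" by simp
    also have "\<dots> \<le> (1 + \<theta> / n) * \<Delta>" using th D1 psi20 by (intro mult_mono) auto
    finally have "v z < v z + \<theta> / n * v z + (1 + \<theta> / n) * \<Delta> - \<sigma>\<^sup>2 / 2 * (v z)\<^sup>2" by simp
    also have "\<dots> = (1 + \<theta> / n) * avg v z - \<sigma>\<^sup>2 / 2 * (v z)\<^sup>2"
      by (simp add: \<Delta>_def algebra_simps)
    also have "\<dots> \<le> (1 + \<theta> / n) * avg v z - \<beta> * avg (\<lambda>y. (v y)\<^sup>2) z" using sq by simp
    also have "\<dots> = avg (\<lambda>y. (1 + \<theta> / n) * v y - \<beta> * (v y)\<^sup>2) z" unfolding avg_diff avg_cmult ..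
    also have "\<dots> \<le> avg (\<lambda>y. Q (v y)) z"
    proof (rule avg_mono)
      fix j' assume j': "j' \<in> set_pmf a"
      have "z - j' \<ge> 1 - R" using jump_le[OF j'] zz by linarith
      then show "(1 + \<theta> / n) * v (z - j') - \<beta> * (v (z - j'))\<^sup>2 \<le> Q (v (z - j'))"
        using vpos[of "z - j'"] v1[of "z - j'"] by (intro Qge) auto
    qed
    finally show ?thesis .
  qed
  have wlim: "filterlim (\<lambda>z. w (int z)) at_top sequentially"
    unfolding w_def using n0 by real_asymp
  have vlim: "(\<lambda>z. v (int z)) \<longlonglongrightarrow> 2 * max \<theta> 0 / \<sigma>\<^sup>2 / n"
    unfolding v_def using n0 by (intro tendsto_divide tendsto_const filterlim_compose[OF tendsto_psi_at_top wlim]) (use par in auto)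
  have evN: "\<exists>N. \<forall>z>N. v z < c" if lt: "2 * max \<theta> 0 / \<sigma>\<^sup>2 / n < c" for c
  proof -
    obtain N where N: "\<And>z. z \<ge> N \<Longrightarrow> v (int z) < c"
      using order_tendstoD(2)[OF vlim lt] by (auto simp: eventually_at_top_linorder)
    show ?thesis
    proof (intro exI allI impI)
      fix z assume "z > int N"
      then have "v (int (nat z)) < c" by (intro N) auto
      then show "v z < c" using \<open>z > int N\<close> by simp
    qed
  qed
  have "v z \<le> ever_reach z"
  proof (cases "\<theta> > 0")
    case True
    \<comment> \<open>Midpoint between the limit of v at infinity and the survival level \<theta> /
      (n \<beta>), capped at 1. Both strict inequalities survive because the limit of v is itself
      below 1.\<close>
    define t where "t = min 1 ((2 * \<theta> / \<sigma>\<^sup>2 / n + \<theta> / n / \<beta>) / 2)"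
    have "2 * \<theta> / \<sigma>\<^sup>2 = \<theta> / (\<sigma>\<^sup>2 / 2)" by simp
    also have "\<dots> < \<theta> / \<beta>" using True par far by (intro divide_strict_left_mono) auto
    finally have "2 * \<theta> / \<sigma>\<^sup>2 / n < \<theta> / \<beta> / n" using n0 by (intro divide_strict_right_mono) auto
    then have lt: "2 * \<theta> / \<sigma>\<^sup>2 / n < \<theta> / n / \<beta>" by (simp add: mult.commute)
    have b0: "2 * \<theta> / \<sigma>\<^sup>2 / n > 0" using True par n0 by simp
    have v01: "2 * \<theta> / \<sigma>\<^sup>2 / n < 1"
    proof -
      have "2 * \<theta> / \<sigma>\<^sup>2 < ?f (w (1 - R))" using psi_gt_limit[of \<theta> \<rho> "w (1 - R)" \<sigma>] wpos[of "1 - R"] par True by simp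
      then have "2 * \<theta> / \<sigma>\<^sup>2 / n < ?f (w (1 - R)) / n" using n0 by (intro divide_strict_right_mono) auto
      then show ?thesis using start by simp
    qed
    have t: "0 < t" "t \<le> 1" "2 * \<theta> / \<sigma>\<^sup>2 / n < t" "t < \<theta> / n / \<beta>"
    proof -
      have "0 < min 1 ((A + B) / 2) \<and> min 1 ((A + B) / 2) \<le> 1 \<and> A < min 1 ((A + B) / 2) \<and> min 1 ((A + B) / 2) < B"
        if "0 < A" "A < 1" "A < B" for A B :: real
        using that by (auto simp: min_def)
      from this[OF b0 v01 lt] show "0 < t" "t \<le> 1" "2 * \<theta> / \<sigma>\<^sup>2 / n < t" "t < \<theta> / n / \<beta>"
        unfolding t_def by blast+
    qed
    then have tb: "\<beta> * t < \<theta> / n" using iffD1[OF pos_less_divide_eq[OF par(6)] t(4)] by (subst mult.commute)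
    have u: "ever_reach y \<ge> t" if "y \<ge> 1" for y
      using True n0 par t tb that by (intro survival_le_ever_reach[of "\<theta> / n" \<beta>] Qge) auto
    obtain N where N: "\<And>z. z > N \<Longrightarrow> v z < t" using evN[of t] t True by auto
    show ?thesis
    proof (rule strict_subsolution_le_ever_reach[where N = "max 1 N"])
      show "v y \<le> ever_reach y" if "y > max 1 N" for y
        using N[of y] u[of y] that by auto
    qed (use vpos v1 sub z in \<open>auto intro: less_imp_le\<close>)
  next
    case False
    then have neg: "\<theta> < 0" using par by simp
    \<comment> \<open>The truncation of \<^term>\<open>v\<close> at height \<open>\<zeta>\<close> has bounded support to the right and is still
      a subsolution, because \<^term>\<open>Q\<close> is subadditive and \<open>Q \<zeta> < \<zeta>\<close>.\<close>
    have "v z - \<zeta> \<le> ever_reach z" if zeta: "0 < \<zeta>" "\<zeta> \<le> 1" for \<zeta>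
    proof -
      have Q\<zeta>: "Q \<zeta> < \<zeta>"
      proof -
        have "Q \<zeta> \<le> (1 + \<theta> / n) * \<zeta>" using zeta by (intro Qle) auto
        also have "\<dots> < 1 * \<zeta>" using neg n0 zeta by (intro mult_strict_right_mono) (auto simp: divide_neg_pos)
        finally show ?thesis by simp
      qed
      obtain N where N: "\<And>z. z > N \<Longrightarrow> v z < \<zeta>" using evN[of \<zeta>] zeta neg by auto
      have "max 0 (v z - \<zeta>) \<le> ever_reach z"
      proof (rule strict_subsolution_le_ever_reach[where N = N])
        show "0 \<le> max 0 (v y - \<zeta>) \<and> max 0 (v y - \<zeta>) \<le> 1" if "y \<ge> 1 - R" for y
          using v1[OF that] zeta by auto
        show "max 0 (v y - \<zeta>) \<le> ever_reach y" if "y > N" for y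
          using N[OF that] ever_reach_nonneg[of y] by auto
        fix y assume y: "y \<ge> 1" "max 0 (v y - \<zeta>) > 0"
        have "v y - \<zeta> < avg (\<lambda>x. Q (v x)) y - Q \<zeta>" using sub[OF y(1)] Q\<zeta> by simp
        also have "\<dots> = avg (\<lambda>x. Q (v x) - Q \<zeta>) y" by (simp add: avg_diff)
        also have "\<dots> \<le> avg (\<lambda>x. Q (max 0 (v x - \<zeta>))) y"
        proof (rule avg_mono)
          fix j' assume j': "j' \<in> set_pmf a"
          define x where "x = y - j'"
          have x: "x \<ge> 1 - R" using jump_le[OF j'] y by (simp add: x_def) 
          show "Q (v (y - j')) - Q \<zeta> \<le> Q (max 0 (v (y - j') - \<zeta>))"
            unfolding x_def[symmetric]
          proof (cases "v x \<le> \<zeta>")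
            case True
            then have "Q (v x) \<le> Q \<zeta>" using vpos[OF x] zeta by (intro branch_prob_mono) auto
            then show "Q (v x) - Q \<zeta> \<le> Q (max 0 (v x - \<zeta>))" using True by simp
          next
            case False
            define s where "s = v x - \<zeta>"
            have s: "s > 0" "v x = s + \<zeta>" using False by (auto simp: s_def)
            have s1: "s + \<zeta> \<le> 1" using v1[OF x] s by simp
            have "Q (v x) \<le> Q s + Q \<zeta>"
              unfolding s(2) using s(1) zeta s1 by (intro branch_prob_subadditive)
            then show "Q (v x) - Q \<zeta> \<le> Q (max 0 (v x - \<zeta>))" using s by simp
          qed
        qed
        finally show "max 0 (v y - \<zeta>) < avg (\<lambda>x. Q (max 0 (v x - \<zeta>))) y" using y by simp
      qed (rule z)
      then show ?thesis by simp
    qed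
    then have "v z - min e 1 \<le> ever_reach z" if "e > 0" for e
      using that by simp
    then have "v z \<le> ever_reach z + e" if "e > 0" for e
      using that min.cobounded1[of e 1] by (metis add.commute diff_le_eq diff_left_mono order_trans)
    then show ?thesis by (rule field_le_epsilon)
  qed
  then show ?thesis by (simp add: v_def)
qed

end

section \<open>The near-critical scaling limit\<close>

text \<open>\<open>q n\<close> stands for the offspring law with parameter \<theta> / n, and
  everything is required only from \<open>n\<^sub>0\<close> on, where \<theta> / n stays away from
  -1. \<open>off_var\<close> speaks of the second factorial moment, twice the quadratic coefficient
  of Q.\<close>

locale near_critical = centered_jump +
  fixes q :: "nat \<Rightarrow> nat pmf" and \<theta> \<sigma> \<Gamma> :: real and n\<^sub>0 :: nat
  assumes theta: "\<theta> \<noteq> 0" and sigma: "\<sigma> > 0" and n0: "n\<^sub>0 \<ge> 1"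
    and theta_small: "\<And>n. n \<ge> n\<^sub>0 \<Longrightarrow> \<bar>\<theta>\<bar> / real n \<le> 1 / 2"
    and off_sq: "\<And>n. n \<ge> n\<^sub>0 \<Longrightarrow> integrable (measure_pmf (q n)) (\<lambda>i. (real i)\<^sup>2)"
    and off_cube: "\<And>n. n \<ge> n\<^sub>0 \<Longrightarrow> integrable (measure_pmf (q n)) (\<lambda>i. real i ^ 3)"
    and off_mean: "\<And>n. n \<ge> n\<^sub>0 \<Longrightarrow> measure_pmf.expectation (q n) real = 1 + \<theta> / real n"
    and off_cube_le: "\<And>n. n \<ge> n\<^sub>0 \<Longrightarrow> measure_pmf.expectation (q n) (\<lambda>i. real i ^ 3) \<le> \<Gamma>"
    and off_var: "(\<lambda>n. measure_pmf.expectation (q n) (\<lambda>i. (real i)\<^sup>2) - (1 + \<theta> / real n)) \<longlonglongrightarrow> \<sigma>\<^sup>2"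
begin

lemma branching_jump_q:
  assumes "n \<ge> n\<^sub>0"
  shows "branching_jump a R V (q n)"
proof
  show "integrable (measure_pmf (q n)) (\<lambda>i. (real i)\<^sup>2)" using assms by (rule off_sq)
  have "- (\<theta> / real n) \<le> 1 / 2"
    using theta_small[OF assms] abs_ge_minus_self[of "\<theta> / real n"] by (simp add: abs_divide)
  then show "measure_pmf.expectation (q n) real > 0" unfolding off_mean[OF assms] by linarith
qed

abbreviation u :: "nat \<Rightarrow> int \<Rightarrow> real" where
  "u n \<equiv> branching_jump.ever_reach a (q n)"

lemma R_pos: "R \<ge> 1"
  using ex_positive_jump jump_le by force

lemma Gamma_nonneg: "\<Gamma> \<ge> 0"
proof -
  have "0 \<le> measure_pmf.expectation (q n\<^sub>0) (\<lambda>i. real i ^ 3)" by (intro Bochner_Integration.integral_nonneg) auto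
  also have "\<dots> \<le> \<Gamma>" by (rule off_cube_le) simp
  finally show ?thesis .
qed

lemma eventually_n0: "eventually (\<lambda>n. n \<ge> n\<^sub>0) sequentially"
  by (rule eventually_ge_at_top)

section \<open>Bounds on Q that are uniform in n\<close>

lemma branch_prob_ge_near_critical:
  assumes "\<epsilon> > 0"
  shows "\<forall>\<^sub>F n in sequentially. \<forall>t. 0 \<le> t \<longrightarrow> t \<le> 1 \<longrightarrow>
    branch_prob (q n) t \<ge> (1 + \<theta> / real n) * t - \<sigma>\<^sup>2 * (1 + \<epsilon>) / 2 * t\<^sup>2"
proof -
  have "\<sigma>\<^sup>2 < \<sigma>\<^sup>2 * (1 + \<epsilon>)" using assms sigma by simp
  from order_tendstoD(2)[OF off_var this] eventually_n0 show ?thesis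
  proof eventually_elim
    case (elim n)
    show ?case
    proof (intro allI impI)
      fix t :: real assume t: "0 \<le> t" "t \<le> 1"
      have "(measure_pmf.expectation (q n) (\<lambda>i. (real i)\<^sup>2) - (1 + \<theta> / real n)) / 2 * t\<^sup>2 \<le> \<sigma>\<^sup>2 * (1 + \<epsilon>) / 2 * t\<^sup>2"
        using elim(1) by (intro mult_right_mono divide_right_mono) auto
      then show "branch_prob (q n) t \<ge> (1 + \<theta> / real n) * t - \<sigma>\<^sup>2 * (1 + \<epsilon>) / 2 * t\<^sup>2"
        using branch_prob_ge[OF off_sq[OF elim(2)] t] unfolding off_mean[OF elim(2)] by linarith
    qed
  qed
qed

lemma branch_prob_le_near_critical:
  assumes "\<epsilon> > 0"
  shows "\<exists>\<delta>>0. \<delta> \<le> 1 \<and> (\<forall>\<^sub>F n in sequentially. \<forall>t. 0 \<le> t \<longrightarrow> t \<le> \<delta> \<longrightarrow>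
    branch_prob (q n) t \<le> (1 + \<theta> / real n) * t - \<sigma>\<^sup>2 * (1 - \<epsilon>) / 2 * t\<^sup>2)"
proof -
  \<comment> \<open>Half of the slack \<epsilon> covers the convergence of the second moment, the
    other half the cubic error, which needs \<Gamma> * \<delta> <= \<sigma>^2 * \<epsilon> / 4. The
    denominator \<Gamma> + 1 allows \<Gamma> = 0.\<close>
  define \<delta> where "\<delta> = min 1 (\<sigma>\<^sup>2 * \<epsilon> / 4 / (\<Gamma> + 1))"
  have d: "\<delta> > 0" "\<delta> \<le> 1" using assms sigma Gamma_nonneg by (auto simp: \<delta>_def)
  have Gd: "\<Gamma> * \<delta> \<le> \<sigma>\<^sup>2 * \<epsilon> / 4"
  proof -
    have "\<Gamma> * \<delta> \<le> (\<Gamma> + 1) * (\<sigma>\<^sup>2 * \<epsilon> / 4 / (\<Gamma> + 1))"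
      using d Gamma_nonneg by (intro mult_mono) (auto simp: \<delta>_def)
    also have "(\<Gamma> + 1) * (\<sigma>\<^sup>2 * \<epsilon> / 4 / (\<Gamma> + 1)) = \<sigma>\<^sup>2 * \<epsilon> / 4"
    proof -
      have "a * (x / a) = x" if "a > 0" for a x :: real using that by simp
      then show ?thesis using Gamma_nonneg by (metis add_nonneg_pos zero_less_one)
    qed
    finally show ?thesis .
  qed
  have "\<sigma>\<^sup>2 * (1 - \<epsilon> / 2) < \<sigma>\<^sup>2" using assms sigma by simp
  from order_tendstoD(1)[OF off_var this] eventually_n0
  have "\<forall>\<^sub>F n in sequentially. \<forall>t. 0 \<le> t \<longrightarrow> t \<le> \<delta> \<longrightarrow>
    branch_prob (q n) t \<le> (1 + \<theta> / real n) * t - \<sigma>\<^sup>2 * (1 - \<epsilon>) / 2 * t\<^sup>2"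
  proof eventually_elim
    case (elim n)
    show ?case
    proof (intro allI impI)
      fix t :: real assume t: "0 \<le> t" "t \<le> \<delta>"
      have t1: "t \<le> 1" using t d by simp
      have 1: "\<sigma>\<^sup>2 * (1 - \<epsilon> / 2) / 2 * t\<^sup>2 \<le> (measure_pmf.expectation (q n) (\<lambda>i. (real i)\<^sup>2) - (1 + \<theta> / real n)) / 2 * t\<^sup>2"
        using elim(1) by (intro mult_right_mono divide_right_mono) auto
      have "measure_pmf.expectation (q n) (\<lambda>i. real i ^ 3) * t ^ 3 \<le> \<Gamma> * t ^ 3"
        using off_cube_le[OF elim(2)] t by (intro mult_right_mono) auto
      also have "\<dots> = (\<Gamma> * t) * t\<^sup>2" by (simp add: power2_eq_square power3_eq_cube)
      also have "\<dots> \<le> (\<sigma>\<^sup>2 * \<epsilon> / 4) * t\<^sup>2"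
        using t Gd Gamma_nonneg mult_left_mono[of t \<delta> \<Gamma>] by (intro mult_right_mono) auto
      finally have 2: "measure_pmf.expectation (q n) (\<lambda>i. real i ^ 3) * t ^ 3 \<le> (\<sigma>\<^sup>2 * \<epsilon> / 4) * t\<^sup>2" .
      have "\<sigma>\<^sup>2 * (1 - \<epsilon> / 2) / 2 * t\<^sup>2 = \<sigma>\<^sup>2 * (1 - \<epsilon>) / 2 * t\<^sup>2 + (\<sigma>\<^sup>2 * \<epsilon> / 4) * t\<^sup>2"
        by (simp add: algebra_simps diff_divide_distrib)
      then show "branch_prob (q n) t \<le> (1 + \<theta> / real n) * t - \<sigma>\<^sup>2 * (1 - \<epsilon>) / 2 * t\<^sup>2"
        using branch_prob_le[OF off_sq[OF elim(2)] off_cube[OF elim(2)] t(1) t1] 1 2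
        unfolding off_mean[OF elim(2)] by linarith
    qed
  qed
  then show ?thesis using d by blast
qed

text \<open>Beyond \<delta> the scaling property gives Q t <= (t / \<delta>) * Q \<delta>, so the
  quadratic gain at \<delta> becomes a gain linear in t, which dominates a multiple of t^2 on
  [0, 1]. The bound 8 c <= 1 makes \<delta> = 1 and \<open>\<sigma>'^2 = 2 * c\<close> admissible in
  \<open>ever_reach_le_psi\<close>.\<close>

lemma branch_prob_le_global:
  "\<exists>c>0. 8 * c \<le> 1 \<and> (\<forall>\<^sub>F n in sequentially. \<forall>t. 0 \<le> t \<longrightarrow> t \<le> 1 \<longrightarrow>
    branch_prob (q n) t \<le> (1 + \<theta> / real n) * t - c * t\<^sup>2)"
proof -
  from branch_prob_le_near_critical[of "1/2"] obtain \<delta> where d: "\<delta> > 0" "\<delta> \<le> 1"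
    and ev: "\<forall>\<^sub>F n in sequentially. \<forall>t. 0 \<le> t \<longrightarrow> t \<le> \<delta> \<longrightarrow>
      branch_prob (q n) t \<le> (1 + \<theta> / real n) * t - \<sigma>\<^sup>2 * (1 - 1/2) / 2 * t\<^sup>2" by auto
  define b where "b = \<sigma>\<^sup>2 / 4"
  have b: "b > 0" using sigma by (simp add: b_def)
  define c where "c = min (1 / 8) (b * \<delta>)"
  have c: "c > 0" "8 * c \<le> 1" "c \<le> b * \<delta>" using b d by (auto simp: c_def)
  have cb: "c \<le> b" using c(3) b d mult_left_le[of \<delta> b] by linarith
  from ev have "\<forall>\<^sub>F n in sequentially. \<forall>t. 0 \<le> t \<longrightarrow> t \<le> 1 \<longrightarrow>
    branch_prob (q n) t \<le> (1 + \<theta> / real n) * t - c * t\<^sup>2"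
  proof eventually_elim
    case (elim n)
    show ?case
    proof (intro allI impI)
      fix t :: real assume t: "0 \<le> t" "t \<le> 1"
      have el: "branch_prob (q n) t \<le> (1 + \<theta> / real n) * t - b * t\<^sup>2" if "0 \<le> t" "t \<le> \<delta>" for t
        using elim[rule_format, OF that] by (simp add: b_def)
      show "branch_prob (q n) t \<le> (1 + \<theta> / real n) * t - c * t\<^sup>2"
      proof (cases "t \<le> \<delta>")
        case True
        have "c * t\<^sup>2 \<le> b * t\<^sup>2" using cb by (intro mult_right_mono) auto
        then show ?thesis using el[OF t(1) True] by linarith
      next
        case False
        have "branch_prob (q n) (t / \<delta> * \<delta>) \<le> t / \<delta> * branch_prob (q n) \<delta>"
          using False d t by (intro branch_prob_scale) auto
        also have "\<dots> \<le> t / \<delta> * ((1 + \<theta> / real n) * \<delta> - b * \<delta>\<^sup>2)"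
          using el[of \<delta>] d t by (intro mult_left_mono) auto
        also have "\<dots> = (1 + \<theta> / real n) * t - b * \<delta> * t"
          using d by (simp add: right_diff_distrib power2_eq_square)
        also have "\<dots> \<le> (1 + \<theta> / real n) * t - c * t\<^sup>2"
        proof -
          have "c * t\<^sup>2 \<le> (b * \<delta>) * t"
            using c t mult_left_le[of t t] by (intro mult_mono) (auto simp: power2_eq_square)
          then show ?thesis by simp
        qed
        finally show ?thesis using d by simp
      qed
    qed
  qed
  then show ?thesis using c by blast
qed

section \<open>Barriers for large n\<close>

lemma eventually_le_sqrt:
  assumes "r\<^sub>0 > 0"
  shows "\<forall>\<^sub>F n in sequentially. real_of_int R / sqrt (real n) \<le> r\<^sub>0"
proof -
  have "(\<lambda>n. real_of_int R / sqrt (real n)) \<longlonglongrightarrow> 0" by real_asymp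
  from order_tendstoD(2)[OF this assms] show ?thesis by (rule eventually_mono) simp
qed

lemma eventually_theta_less:
  assumes "c > 0"
  shows "\<forall>\<^sub>F n in sequentially. \<bar>\<theta>\<bar> / real n < c"
  by (rule order_tendstoD(2)[OF lim_const_over_n assms])

text \<open>With \<delta> = 1 the smallness of u demanded by \<open>ever_reach_le_psi\<close> is
  trivial. The price is that the parameters bear no relation to the true ones.\<close>

lemma crude_upper_bound:
  "\<exists>\<sigma>' \<rho>' z1. \<sigma>' > 0 \<and> \<rho>' > 0 \<and> (\<forall>\<^sub>F n in sequentially. \<forall>z\<ge>z1.
     u n z \<le> psi \<theta> \<sigma>' \<rho>' (real_of_int z / sqrt (real n)) / real n)"
proof -
  from branch_prob_le_global obtain c where c: "c > 0" "8 * c \<le> 1"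
    and ev: "\<forall>\<^sub>F n in sequentially. \<forall>t. 0 \<le> t \<longrightarrow> t \<le> 1 \<longrightarrow>
      branch_prob (q n) t \<le> (1 + \<theta> / real n) * t - c * t\<^sup>2" by blast
  from psi_ratio[of 1] obtain K where K: "K > 1"
    and rat: "\<And>\<theta> \<sigma> \<rho>. \<theta> \<noteq> 0 \<Longrightarrow> \<sigma> > 0 \<Longrightarrow> \<rho> > 0 \<Longrightarrow> \<exists>r\<^sub>0>0. \<forall>r x. 0 < r \<longrightarrow> r \<le> r\<^sub>0 \<longrightarrow> x \<ge> K * r \<longrightarrow>
     psi \<theta> \<sigma> \<rho> (x - r) \<le> (1 + 1) * psi \<theta> \<sigma> \<rho> x \<and> psi2 \<theta> \<sigma> \<rho> (x - r) \<le> (1 + 1) * psi2 \<theta> \<sigma> \<rho> x"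
    by (metis zero_less_one)
  \<comment> \<open>At least K * R, so that \<open>psi_ratio\<close> applies from z1 on; the extra R
    keeps the starting strip left of z1 on positive sites.\<close>
  define z1 where "z1 = max 1 \<lceil>K * R\<rceil> + R"
  have z1: "z1 - R \<ge> 1" "z1 \<ge> 1" "real_of_int z1 \<ge> K * R" using R_pos by (auto simp: z1_def) linarith+
  define \<sigma>' where "\<sigma>' = sqrt (2 * c)"
  \<comment> \<open>The summand 4 V pays for a factor 2 from 1 + |\<theta>| / n and a factor 2 from
    the change of \<open>psi2\<close> over one jump. The other summand lifts the limiting height at
    z1 above 1, hence above u on the starting strip.\<close>
  define \<rho>' where "\<rho>' = sqrt (4 * V + \<sigma>'\<^sup>2 * (real_of_int z1)\<^sup>2)"
  have s: "\<sigma>' > 0" "\<sigma>'\<^sup>2 = 2 * c" using c by (auto simp: \<sigma>'_def)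
  have r: "\<rho>' > 0" "\<rho>'\<^sup>2 = 4 * V + \<sigma>'\<^sup>2 * (real_of_int z1)\<^sup>2"
    using V_pos s(1) by (auto simp: \<rho>'_def intro!: add_pos_nonneg add_nonneg_nonneg)
  let ?f = "psi \<theta> \<sigma>' \<rho>'" and ?g = "psi2 \<theta> \<sigma>' \<rho>'"
  obtain r\<^sub>0 where r0: "r\<^sub>0 > 0" and rat0: "\<And>r x. 0 < r \<Longrightarrow> r \<le> r\<^sub>0 \<Longrightarrow> x \<ge> K * r \<Longrightarrow>
     ?f (x - r) \<le> 2 * ?f x \<and> ?g (x - r) \<le> 2 * ?g x"
    using rat[OF theta s(1) r(1)] by auto
  have big: "1 < 6 * \<rho>'\<^sup>2 / (\<sigma>'\<^sup>2 * (real_of_int z1)\<^sup>2)"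
    unfolding r using s z1 V_pos c by (simp add: field_simps add_pos_pos)
  have "\<forall>\<^sub>F n in sequentially. 1 < ?f (real_of_int z1 / sqrt (real n)) / real n"
    using z1 by (intro order_tendstoD(1)[OF tendsto_psi_scaled big] theta r s) auto
  with ev eventually_n0 eventually_le_sqrt[OF r0]
  have "\<forall>\<^sub>F n in sequentially. \<forall>z\<ge>z1 - R. u n z \<le> ?f (real_of_int z / sqrt (real n)) / real n"
  proof eventually_elim
    case (elim n)
    have n: "n \<ge> 1" using elim(2) n0 by linarith
    then have sn: "sqrt (real n) > 0" by simp
    interpret B: branching_jump a R V "q n" by (rule branching_jump_q[OF elim(2)])
    show ?case
    proof (intro allI impI)
      fix z assume z: "z \<ge> z1 - R"
      have shift: "real_of_int (y - R) / sqrt (real n) = real_of_int y / sqrt (real n) - R / sqrt (real n)" for y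
        by (simp add: diff_divide_distrib)
      have rat1: "?f (real_of_int (y - R) / sqrt (real n)) \<le> 2 * ?f (real_of_int y / sqrt (real n)) \<and>
         ?g (real_of_int (y - R) / sqrt (real n)) \<le> 2 * ?g (real_of_int y / sqrt (real n))" if "y \<ge> z1" for y
        unfolding shift
      proof (rule rat0)
        have "K * R \<le> real_of_int y" using that z1 by linarith
        then show "K * (R / sqrt (real n)) \<le> real_of_int y / sqrt (real n)"
          using divide_right_mono[of "K * R" "real_of_int y" "sqrt (real n)"] sn by simp
      qed (use R_pos sn elim in auto)
      have "u n z \<le> ?f ((real_of_int z + real_of_int 0) / sqrt (real n)) / real n"
      proof (rule B.ever_reach_le_psi[where \<delta> = 1 and b = z1 and \<sigma> = \<sigma>' and \<rho> = \<rho>' and j = 0])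
        show "branch_prob (q n) t \<le> (1 + \<theta> / real n) * t - \<sigma>'\<^sup>2 / 2 * t\<^sup>2" if "0 \<le> t" "t \<le> 1" for t
          using elim(1) that s by simp
        show "?f ((real_of_int (y - R) + real_of_int 0) / sqrt (real n)) \<le> 2 * ?f ((real_of_int y + real_of_int 0) / sqrt (real n))"
          if "y \<ge> z1" for y using rat1[OF that] by simp
        show "(1 + \<bar>\<theta>\<bar> / real n) * V * ?g ((real_of_int (y - R) + real_of_int 0) / sqrt (real n))
            \<le> \<rho>'\<^sup>2 * ?g ((real_of_int y + real_of_int 0) / sqrt (real n))" if y: "y \<ge> z1" for y
        proof -
          have pp: "?g (real_of_int x / sqrt (real n)) > 0" if "x \<ge> 1" for x
            using that sn s r theta by (intro psi2_pos) auto
          have "(1 + \<bar>\<theta>\<bar> / real n) * V * ?g (real_of_int (y - R) / sqrt (real n))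
             \<le> 2 * V * (2 * ?g (real_of_int y / sqrt (real n)))"
          proof (intro mult_mono mult_right_mono)
            show "1 + \<bar>\<theta>\<bar> / real n \<le> 2" using theta_small[OF elim(2)] by linarith
          qed (use rat1[OF y] V_pos pp[of "y - R"] y z1 in auto)
          also have "\<dots> = (4 * V) * ?g (real_of_int y / sqrt (real n))" by simp
          also have "\<dots> \<le> \<rho>'\<^sup>2 * ?g (real_of_int y / sqrt (real n))"
            unfolding r using pp[of y] y z1 s(1) by (intro mult_right_mono) auto
          finally show ?thesis by simp
        qed
        show "1 \<le> ?f ((real_of_int y + real_of_int 0) / sqrt (real n)) / real n" if "z1 - R \<le> y" "y < z1" for y
        proof -
          have "?f (real_of_int z1 / sqrt (real n)) \<le> ?f (real_of_int y / sqrt (real n))"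
            using that z1 sn r theta by (intro psi_antimono divide_right_mono divide_pos_pos) auto
          then have "?f (real_of_int z1 / sqrt (real n)) / real n \<le> ?f (real_of_int y / sqrt (real n)) / real n"
            by (intro divide_right_mono) auto
          then show ?thesis using elim(4) by simp
        qed
      qed (use theta s r n theta_small[OF elim(2)] c z1 z B.ever_reach_le_1 in auto)
      then show "u n z \<le> ?f (real_of_int z / sqrt (real n)) / real n" by simp
    qed
  qed
  then show ?thesis using s r by blast
qed

text \<open>At lattice distance k the crude barrier tends to a constant times k^-2 as n grows; a
  fixed large k brings it below \<delta>, and monotonicity of the barrier extends this to all z >=
  k.\<close>

lemma ever_reach_small:
  assumes "\<delta> > 0"
  shows "\<exists>K. \<forall>\<^sub>F n in sequentially. \<forall>z\<ge>K. u n z \<le> \<delta>"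
proof -
  from crude_upper_bound obtain \<sigma>' \<rho>' z1 where sr: "\<sigma>' > 0" "\<rho>' > 0"
    and ev: "\<forall>\<^sub>F n in sequentially. \<forall>z\<ge>z1. u n z \<le> psi \<theta> \<sigma>' \<rho>' (real_of_int z / sqrt (real n)) / real n"
    by blast
  let ?f = "psi \<theta> \<sigma>' \<rho>'"
  have "(\<lambda>k. 6 * \<rho>'\<^sup>2 / (\<sigma>'\<^sup>2 * (real k)\<^sup>2)) \<longlonglongrightarrow> 0"
    using sr by real_asymp
  then have "\<forall>\<^sub>F k in sequentially. 6 * \<rho>'\<^sup>2 / (\<sigma>'\<^sup>2 * (real k)\<^sup>2) < \<delta> \<and> k \<ge> nat (max 1 z1)"
    using assms by (intro eventually_conj order_tendstoD(2) eventually_ge_at_top)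
  then obtain k :: nat where k: "6 * \<rho>'\<^sup>2 / (\<sigma>'\<^sup>2 * (real k)\<^sup>2) < \<delta>" "k \<ge> nat (max 1 z1)"
    by (auto simp: eventually_at_top_linorder)
  have k1: "int k \<ge> z1" "k \<ge> 1" using k(2) by auto
  have "\<forall>\<^sub>F n in sequentially. ?f (real k / sqrt (real n)) / real n < \<delta>"
    using k k1 by (intro order_tendstoD(2)[OF tendsto_psi_scaled] theta sr) auto
  with ev eventually_n0 have "\<forall>\<^sub>F n in sequentially. \<forall>z\<ge>int k. u n z \<le> \<delta>"
  proof eventually_elim
    case (elim n)
    then have n: "n \<ge> 1" using n0 by linarith
    show ?case
    proof (intro allI impI)
      fix z assume z: "z \<ge> int k"
      have "u n z \<le> ?f (real_of_int z / sqrt (real n)) / real n" using elim z k1 by auto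
      also have "\<dots> \<le> ?f (real k / sqrt (real n)) / real n"
        using z k1 n sr theta by (intro divide_right_mono psi_antimono divide_pos_pos) auto
      also have "\<dots> \<le> \<delta>" using elim by simp
      finally show "u n z \<le> \<delta>" .
    qed
  qed
  then show ?thesis by blast
qed

text \<open>The shift \<open>j\<close> places the start of the comparison where the rescaled barrier is small enough for the
  Taylor expansion to be accurate; the crude bound guarantees that the solution is already smaller there.\<close>

lemma sharp_upper_bound:
  assumes e: "0 < e" "e < 1"
  shows "\<exists>j z1. \<forall>\<^sub>F n in sequentially. \<forall>z\<ge>z1.
     u n z \<le> psi \<theta> (\<sigma> * sqrt (1 - e)) (sqrt (V * (1 + e))) ((real_of_int z + real_of_int j) / sqrt (real n)) / real n"
proof -
  define \<sigma>' where "\<sigma>' = \<sigma> * sqrt (1 - e)"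
  define \<rho>' where "\<rho>' = sqrt (V * (1 + e))"
  have s: "\<sigma>' > 0" "\<sigma>'\<^sup>2 = \<sigma>\<^sup>2 * (1 - e)" using sigma e by (auto simp: \<sigma>'_def power_mult_distrib)
  have r: "\<rho>' > 0" "\<rho>'\<^sup>2 = V * (1 + e)" using V_pos e by (auto simp: \<rho>'_def)
  from branch_prob_le_near_critical[OF e(1)] obtain \<delta>\<^sub>0 where d0: "\<delta>\<^sub>0 > 0" "\<delta>\<^sub>0 \<le> 1"
    and ev: "\<forall>\<^sub>F n in sequentially. \<forall>t. 0 \<le> t \<longrightarrow> t \<le> \<delta>\<^sub>0 \<longrightarrow>
    branch_prob (q n) t \<le> (1 + \<theta> / real n) * t - \<sigma>\<^sup>2 * (1 - e) / 2 * t\<^sup>2" by blast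
  have "e / 2 > 0" using e by simp
  from psi_ratio[OF this] obtain K where K: "K > 1"
    and rat: "\<And>\<theta> \<sigma> \<rho>. \<theta> \<noteq> 0 \<Longrightarrow> \<sigma> > 0 \<Longrightarrow> \<rho> > 0 \<Longrightarrow> \<exists>r\<^sub>0>0. \<forall>r x. 0 < r \<longrightarrow> r \<le> r\<^sub>0 \<longrightarrow> x \<ge> K * r \<longrightarrow>
     psi \<theta> \<sigma> \<rho> (x - r) \<le> (1 + e / 2) * psi \<theta> \<sigma> \<rho> x \<and> psi2 \<theta> \<sigma> \<rho> (x - r) \<le> (1 + e / 2) * psi2 \<theta> \<sigma> \<rho> x"
    by metis
  let ?f = "psi \<theta> \<sigma>' \<rho>'" and ?g = "psi2 \<theta> \<sigma>' \<rho>'"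
  obtain r\<^sub>0 where r0: "r\<^sub>0 > 0" and rat0: "\<And>r x. 0 < r \<Longrightarrow> r \<le> r\<^sub>0 \<Longrightarrow> x \<ge> K * r \<Longrightarrow>
     ?f (x - r) \<le> (1 + e / 2) * ?f x \<and> ?g (x - r) \<le> (1 + e / 2) * ?g x"
    using rat[OF theta s(1) r(1)] by auto
  define k where "k = max 1 \<lceil>K * R\<rceil> + R"
  have k: "k - R \<ge> 1" "k \<ge> 1" "real_of_int k \<ge> K * R" using R_pos by (auto simp: k_def) linarith+
  define l where "l = 6 * \<rho>'\<^sup>2 / (\<sigma>'\<^sup>2 * (real_of_int k)\<^sup>2)"
  have l: "l > 0" unfolding l_def using r(1) s(1) k(2) by (intro divide_pos_pos mult_pos_pos zero_less_power) auto
  \<comment> \<open>Three demands: the expansion of Q holds up to \<delta>, the quadratic bound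
    increases up to 2 \<delta>, and \<delta> lies below l, the limiting height at distance k, so the
    barrier starts above \<delta>.\<close>
  define \<delta> where "\<delta> = min \<delta>\<^sub>0 (min (1 / (4 * \<sigma>'\<^sup>2)) (l / 2))"
  have d: "\<delta> > 0" "\<delta> \<le> \<delta>\<^sub>0" "\<delta> \<le> 1 / (4 * \<sigma>'\<^sup>2)" "\<delta> < l" using d0 l s(1) by (auto simp: \<delta>_def)
  have d4: "4 * \<sigma>'\<^sup>2 * \<delta> \<le> 1"
    using d(3) s(1) pos_le_divide_eq[of "4 * \<sigma>'\<^sup>2" \<delta> 1] by (simp add: mult.commute)
  from ever_reach_small[OF d(1)] obtain K2 where K2: "\<forall>\<^sub>F n in sequentially. \<forall>z\<ge>K2. u n z \<le> \<delta>" by blast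
  define z1 where "z1 = max 1 K2 + R"
  \<comment> \<open>Site z1, from whose starting strip on u is at most \<delta>, is moved to
    distance k from the singularity, so the barrier is still above \<delta> on the strip.\<close>
  define j where "j = k - z1"
  have z1: "z1 \<ge> 1" "z1 - R \<ge> K2" "z1 - R + j \<ge> 1" using R_pos k by (auto simp: z1_def j_def)
  have "\<forall>\<^sub>F n in sequentially. \<delta> < ?f (real_of_int k / sqrt (real n)) / real n"
    using d(4) k by (intro order_tendstoD(1)[OF tendsto_psi_scaled] theta r s) (auto simp: l_def)
  \<comment> \<open>Eventually (1 + |\<theta>| / n) * (1 + e / 2) is at most 1 + e, the factor by
    which \<open>\<rho>'^2\<close> exceeds V.\<close>
  moreover have "(1 + e) / (1 + e / 2) - 1 > 0" using e by (simp add: field_simps)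
  note eventually_theta_less[OF this]
  ultimately have "\<forall>\<^sub>F n in sequentially. \<forall>z\<ge>z1 - R. u n z \<le> ?f ((real_of_int z + real_of_int j) / sqrt (real n)) / real n"
    using ev K2 eventually_n0 eventually_le_sqrt[OF r0]
  proof eventually_elim
    case (elim n)
    have n: "n \<ge> 1" using elim(5) n0 by linarith
    then have sn: "sqrt (real n) > 0" by simp
    interpret B: branching_jump a R V "q n" by (rule branching_jump_q[OF elim(5)])
    let ?w = "\<lambda>z::int. (real_of_int z + real_of_int j) / sqrt (real n)"
    show ?case
    proof (intro allI impI)
      fix z assume z: "z \<ge> z1 - R"
      have shift: "?w (y - R) = ?w y - R / sqrt (real n)" for y
        by (simp add: diff_divide_distrib add_divide_distrib)
      have rat1: "?f (?w (y - R)) \<le> (1 + e / 2) * ?f (?w y) \<and>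
         ?g (?w (y - R)) \<le> (1 + e / 2) * ?g (?w y)" if "y \<ge> z1" for y
        unfolding shift
      proof (rule rat0)
        have "K * R \<le> real_of_int y + real_of_int j" using that k unfolding j_def by linarith
        then show "K * (R / sqrt (real n)) \<le> ?w y"
          using divide_right_mono[of "K * R" "real_of_int y + real_of_int j" "sqrt (real n)"] sn by simp
      qed (use R_pos sn elim in auto)
      have wpos: "?w y > 0" if "y \<ge> z1 - R" for y
        using that z1 sn by (intro divide_pos_pos) auto
      show "u n z \<le> ?f ((real_of_int z + real_of_int j) / sqrt (real n)) / real n"
      proof (rule B.ever_reach_le_psi[where \<delta> = \<delta> and b = z1 and \<sigma> = \<sigma>' and \<rho> = \<rho>' and j = j])
        show "branch_prob (q n) t \<le> (1 + \<theta> / real n) * t - \<sigma>'\<^sup>2 / 2 * t\<^sup>2" if "0 \<le> t" "t \<le> \<delta>" for t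
          using elim(3) that s d by simp
        show "?f (?w (y - R)) \<le> 2 * ?f (?w y)" if "y \<ge> z1" for y
        proof -
          have "(1 + e / 2) * ?f (?w y) \<le> 2 * ?f (?w y)"
            using e wpos[of y] that R_pos theta s r by (intro mult_right_mono less_imp_le[OF psi_pos]) auto
          then show ?thesis using rat1[OF that] by linarith
        qed
        show "(1 + \<bar>\<theta>\<bar> / real n) * V * ?g (?w (y - R)) \<le> \<rho>'\<^sup>2 * ?g (?w y)" if y: "y \<ge> z1" for y
        proof -
          have pp: "?g (?w x) > 0" if "x \<ge> z1 - R" for x
            using wpos[OF that] s r theta by (intro psi2_pos) auto
          have "(1 + \<bar>\<theta>\<bar> / real n) * V * ?g (?w (y - R))
             \<le> ((1 + e) / (1 + e / 2)) * V * ((1 + e / 2) * ?g (?w y))"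
            using rat1[OF y] elim(2) V_pos pp[of "y - R"] y e
            by (intro mult_mono mult_right_mono) auto
          also have "\<dots> = V * (1 + e) * ?g (?w y)" using e by (simp add: field_simps)
          finally show ?thesis unfolding r .
        qed
        show "\<delta> \<le> ?f (?w y) / real n" if "z1 - R \<le> y" "y < z1" for y
        proof -
          have "?f (real_of_int k / sqrt (real n)) \<le> ?f (?w y)"
            using wpos[of y] that sn r theta unfolding j_def by (intro psi_antimono divide_right_mono) auto
          then have "?f (real_of_int k / sqrt (real n)) / real n \<le> ?f (?w y) / real n"
            by (intro divide_right_mono) auto
          then show ?thesis using elim(1) by simp
        qed
        show "u n y \<le> \<delta>" if "y \<ge> z1 - R" for y using elim(4) that z1 by auto
      qed (use theta s r n theta_small[OF elim(5)] d4 z1 z in auto)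
    qed
  qed
  then show ?thesis unfolding \<sigma>'_def \<rho>'_def by blast
qed

text \<open>No preliminary estimate of u enters: moving the singularity far enough to the left makes
  the barrier at most 1 on all sites from 1 - R on, and the lower expansion of Q holds on all of
  [0, 1].\<close>

lemma sharp_lower_bound:
  assumes e: "0 < e" "e < 1"
  shows "\<exists>j. \<forall>\<^sub>F n in sequentially. \<forall>z\<ge>1.
     psi \<theta> (\<sigma> * sqrt (1 + e)) (sqrt (V * (1 - e))) ((real_of_int z + real_of_int j) / sqrt (real n)) / real n \<le> u n z"
proof -
  define \<sigma>' where "\<sigma>' = \<sigma> * sqrt (1 + e)"
  define \<rho>' where "\<rho>' = sqrt (V * (1 - e))"
  have s: "\<sigma>' > 0" "\<sigma>'\<^sup>2 = \<sigma>\<^sup>2 * (1 + e)" using sigma e by (auto simp: \<sigma>'_def power_mult_distrib)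
  have r: "\<rho>' > 0" "\<rho>'\<^sup>2 = V * (1 - e)" using V_pos e by (auto simp: \<rho>'_def)
  define \<beta> where "\<beta> = \<sigma>\<^sup>2 * (1 + e / 2) / 2"
  have beta: "\<beta> > 0" "2 * \<beta> < \<sigma>'\<^sup>2" using sigma e by (auto simp: \<beta>_def s)
  have e8: "e / 8 > 0" "e / 2 > 0" using e by auto
  \<comment> \<open>The slack 1 + e in \<open>\<sigma>'^2\<close> is shared between the factor 1 + e
    / 2 in \<beta> and the square of the change of \<open>psi\<close> over one jump.\<close>
  have ee: "(1 + e / 2) * (1 + e / 8)\<^sup>2 \<le> 1 + e"
  proof -
    have "e * e \<le> e" using e mult_left_mono[of e 1 e] by simp
    moreover have "e * e * e \<le> e * e" using e mult_left_mono[of e 1 "e * e"] by simp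
    moreover have "(1 + e / 2) * (1 + e / 8)\<^sup>2 = 1 + 3 / 4 * e + 9 / 64 * (e * e) + 1 / 128 * (e * e * e)"
      by (simp add: power2_eq_square field_simps)
    ultimately show ?thesis using e by linarith
  qed
  from psi_ratio[OF e8(1)] obtain K where K: "K > 1"
    and rat: "\<And>\<theta> \<sigma> \<rho>. \<theta> \<noteq> 0 \<Longrightarrow> \<sigma> > 0 \<Longrightarrow> \<rho> > 0 \<Longrightarrow> \<exists>r\<^sub>0>0. \<forall>r x. 0 < r \<longrightarrow> r \<le> r\<^sub>0 \<longrightarrow> x \<ge> K * r \<longrightarrow>
     psi \<theta> \<sigma> \<rho> (x - r) \<le> (1 + e / 8) * psi \<theta> \<sigma> \<rho> x \<and> psi2 \<theta> \<sigma> \<rho> (x - r) \<le> (1 + e / 8) * psi2 \<theta> \<sigma> \<rho> x"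
    by metis
  let ?f = "psi \<theta> \<sigma>' \<rho>'" and ?g = "psi2 \<theta> \<sigma>' \<rho>'"
  obtain r\<^sub>0 where r0: "r\<^sub>0 > 0" and rat0: "\<And>r x. 0 < r \<Longrightarrow> r \<le> r\<^sub>0 \<Longrightarrow> x \<ge> K * r \<Longrightarrow>
     ?f (x - r) \<le> (1 + e / 8) * ?f x \<and> ?g (x - r) \<le> (1 + e / 8) * ?g x"
    using rat[OF theta s(1) r(1)] by auto
  have "(\<lambda>k. 6 * \<rho>'\<^sup>2 / (\<sigma>'\<^sup>2 * (real k)\<^sup>2)) \<longlonglongrightarrow> 0"
    using s(1) r(1) by real_asymp
  then have "\<forall>\<^sub>F k in sequentially. 6 * \<rho>'\<^sup>2 / (\<sigma>'\<^sup>2 * (real k)\<^sup>2) < 1 \<and> k \<ge> nat (max 1 \<lceil>K * R\<rceil>)"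
    by (intro eventually_conj order_tendstoD(2) eventually_ge_at_top) auto
  then obtain k :: nat where k: "6 * \<rho>'\<^sup>2 / (\<sigma>'\<^sup>2 * (real k)\<^sup>2) < 1" "k \<ge> nat (max 1 \<lceil>K * R\<rceil>)"
    by (auto simp: eventually_at_top_linorder)
  have k1: "k \<ge> 1" "real k \<ge> K * R" using k(2) by linarith+
  \<comment> \<open>Then 1 - R + j = k: the leftmost site that matters sits at distance k, where the
    limiting height is below 1.\<close>
  define j where "j = int k + R - 1"
  have "\<forall>\<^sub>F n in sequentially. ?f (real k / sqrt (real n)) / real n < 1"
    using k k1 by (intro order_tendstoD(2)[OF tendsto_psi_scaled] theta r s) auto
  moreover have "1 - (1 - e) * (1 + e / 8) > 0" using e by (simp add: algebra_simps add_pos_pos)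
  note eventually_theta_less[OF this]
  moreover note branch_prob_ge_near_critical[OF e8(2)]
  moreover from branch_prob_le_global have "\<forall>\<^sub>F n in sequentially. \<forall>t. 0 \<le> t \<longrightarrow> t \<le> 1 \<longrightarrow> branch_prob (q n) t \<le> (1 + \<theta> / real n) * t"
  proof -
    from branch_prob_le_global obtain c where c: "c > 0" and "\<forall>\<^sub>F n in sequentially. \<forall>t. 0 \<le> t \<longrightarrow> t \<le> 1 \<longrightarrow>
      branch_prob (q n) t \<le> (1 + \<theta> / real n) * t - c * t\<^sup>2" by blast
    from this(2) show ?thesis
    proof eventually_elim
      case (elim n)
      show ?case
      proof (intro allI impI)
        fix t :: real assume "0 \<le> t" "t \<le> 1"
        then have "branch_prob (q n) t \<le> (1 + \<theta> / real n) * t - c * t\<^sup>2" using elim by auto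
        moreover have "c * t\<^sup>2 \<ge> 0" using c by simp
        ultimately show "branch_prob (q n) t \<le> (1 + \<theta> / real n) * t" by linarith
      qed
    qed
  qed
  ultimately have "\<forall>\<^sub>F n in sequentially. \<forall>z\<ge>1. ?f ((real_of_int z + real_of_int j) / sqrt (real n)) / real n \<le> u n z"
    using eventually_n0 eventually_le_sqrt[OF r0]
  proof eventually_elim
    case (elim n)
    have n: "n \<ge> 1" using elim(5) n0 by linarith
    then have sn: "sqrt (real n) > 0" by simp
    interpret B: branching_jump a R V "q n" by (rule branching_jump_q[OF elim(5)])
    let ?w = "\<lambda>z::int. (real_of_int z + real_of_int j) / sqrt (real n)"
    show ?case
    proof (intro allI impI)
      fix z :: int assume z: "z \<ge> 1"
      have shift: "?w (y - R) = ?w y - R / sqrt (real n)" for y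
        by (simp add: diff_divide_distrib add_divide_distrib)
      have rat1: "?f (?w (y - R)) \<le> (1 + e / 8) * ?f (?w y) \<and>
         ?g (?w (y - R)) \<le> (1 + e / 8) * ?g (?w y)" if "y \<ge> 1" for y
        unfolding shift
      proof (rule rat0)
        have "K * R \<le> real_of_int y + real_of_int j" using that k1 R_pos unfolding j_def by simp
        then show "K * (R / sqrt (real n)) \<le> ?w y"
          using divide_right_mono[of "K * R" "real_of_int y + real_of_int j" "sqrt (real n)"] sn by simp
      qed (use R_pos sn elim in auto)
      have wpos: "?w y > 0" if "y \<ge> 1 - R" for y
        using that k1 sn unfolding j_def by (intro divide_pos_pos) auto
      show "?f ((real_of_int z + real_of_int j) / sqrt (real n)) / real n \<le> u n z"
      proof (rule B.psi_le_ever_reach[where \<beta> = \<beta> and \<sigma> = \<sigma>' and \<rho> = \<rho>' and j = j])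
        show "branch_prob (q n) t \<ge> (1 + \<theta> / real n) * t - \<beta> * t\<^sup>2" if "0 \<le> t" "t \<le> 1" for t
          using elim(3) that unfolding \<beta>_def by simp
        show "branch_prob (q n) t \<le> (1 + \<theta> / real n) * t" if "0 \<le> t" "t \<le> 1" for t
          using elim(4) that by simp
        show "2 * \<beta> * (?f (?w (y - R)))\<^sup>2 \<le> \<sigma>'\<^sup>2 * (?f (?w y))\<^sup>2" if y: "y \<ge> 1" for y
        proof -
          have "(?f (?w (y - R)))\<^sup>2 \<le> ((1 + e / 8) * ?f (?w y))\<^sup>2"
            using rat1[OF y] wpos[of "y - R"] y theta s r by (intro power_mono less_imp_le[OF psi_pos]) auto
          then have "2 * \<beta> * (?f (?w (y - R)))\<^sup>2 \<le> 2 * \<beta> * ((1 + e / 8) * ?f (?w y))\<^sup>2"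
            using beta by (intro mult_left_mono) auto
          also have "\<dots> = \<sigma>\<^sup>2 * ((1 + e / 2) * (1 + e / 8)\<^sup>2) * (?f (?w y))\<^sup>2"
            by (simp add: \<beta>_def power_mult_distrib)
          also have "\<dots> \<le> \<sigma>\<^sup>2 * (1 + e) * (?f (?w y))\<^sup>2"
            using ee by (intro mult_right_mono mult_left_mono) auto
          finally show ?thesis unfolding s .
        qed
        show "\<rho>'\<^sup>2 * ?g (?w y) < (1 - \<bar>\<theta>\<bar> / real n) * V * ?g (?w (y + R))" if y: "y \<ge> 1" for y
        proof -
          have pp: "?g (?w (y + R)) > 0"
            using wpos[of "y + R"] y R_pos s r theta by (intro psi2_pos) auto
          have "?g (?w y) \<le> (1 + e / 8) * ?g (?w (y + R))"
            using rat1[of "y + R"] y R_pos by simp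
          then have "\<rho>'\<^sup>2 * ?g (?w y) \<le> \<rho>'\<^sup>2 * ((1 + e / 8) * ?g (?w (y + R)))"
            by (intro mult_left_mono) auto
          also have "\<dots> = ((1 - e) * (1 + e / 8)) * (V * ?g (?w (y + R)))"
            unfolding r by simp
          also have "\<dots> < (1 - \<bar>\<theta>\<bar> / real n) * (V * ?g (?w (y + R)))"
            using elim(2) V_pos pp by (intro mult_strict_right_mono) auto
          finally show ?thesis by simp
        qed
        show "?f (?w (1 - R)) / real n \<le> 1"
          using elim(1) by (simp add: j_def)
      qed (use theta s r n theta_small[OF elim(5)] beta k1 z in \<open>auto simp: j_def\<close>)
    qed
  qed
  then show ?thesis unfolding \<sigma>'_def \<rho>'_def by blast
qed

lemma survival_lower_bound:
  assumes "\<theta> > 0" "t < 2 * \<theta> / \<sigma>\<^sup>2"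
  shows "\<forall>\<^sub>F n in sequentially. \<forall>z. t \<le> real n * u n z"
proof (cases "t > 0")
  case True
  \<comment> \<open>Chosen so that \<sigma>^2 * (1 + e) / 2 * t = \<theta>; using only e / 2 in the
    expansion of Q leaves t strictly below the survival level.\<close>
  define e where "e = (2 * \<theta> / \<sigma>\<^sup>2) / t - 1"
  have e: "e > 0" unfolding e_def using iffD2[OF less_divide_eq_1_pos[OF True] assms(2)] by linarith
  have "\<forall>\<^sub>F n in sequentially. t / real n < 1"
    by (rule order_tendstoD(2)[OF lim_const_over_n]) simp
  moreover have e2: "e / 2 > 0" using e by simp
  note branch_prob_ge_near_critical[OF this]
  ultimately show ?thesis using eventually_n0
  proof eventually_elim
    case (elim n)
    have n: "real n > 0" using elim(3) n0 by linarith
    interpret B: branching_jump a R V "q n" by (rule branching_jump_q[OF elim(3)])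
    show ?case
    proof
      fix z
      have "t / real n \<le> u n z"
      proof (cases "z \<ge> 1")
        case True
        show ?thesis
        proof (rule B.survival_le_ever_reach[where \<eta> = "\<theta> / real n" and \<beta> = "\<sigma>\<^sup>2 * (1 + e / 2) / 2"])
          have "\<sigma>\<^sup>2 * (1 + e / 2) / 2 * t < \<sigma>\<^sup>2 * (1 + e) / 2 * t"
            using \<open>t > 0\<close> sigma e by simp
          also have "\<dots> = \<theta>" using \<open>t > 0\<close> sigma by (simp add: e_def)
          finally show "\<sigma>\<^sup>2 * (1 + e / 2) / 2 * (t / real n) < \<theta> / real n"
            unfolding times_divide_eq_right[of _ t] by (rule divide_strict_right_mono[OF _ n])
        qed (use elim True \<open>t > 0\<close> assms n sigma e in auto)
      next
        case False
        then show ?thesis using elim(1) B.ever_reach_eq_1[of z] by simp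
      qed
      then show "t \<le> real n * u n z" using n by (simp add: field_simps)
    qed
  qed
next
  case False
  show ?thesis using eventually_n0
  proof eventually_elim
    case (elim n)
    interpret B: branching_jump a R V "q n" by (rule branching_jump_q[OF elim])
    show ?case
    proof
      fix z
      have "0 \<le> real n * u n z" using B.ever_reach_nonneg by simp
      then show "t \<le> real n * u n z" using False by linarith
    qed
  qed
qed

text \<open>First n tends to infinity with the perturbation e fixed, where the shift j and the
  rounding disappear after division by sqrt n; then e tends to 0 by continuity of \<open>psi\<close>
  in its parameters.\<close>

lemma tendsto_ever_reach:
  assumes x: "x > 0"
  shows "(\<lambda>n. real n * u n \<lceil>sqrt (real n) * x\<rceil>) \<longlonglongrightarrow> psi \<theta> \<sigma> (sqrt V) x"
proof -
  define zn where "zn = (\<lambda>n::nat. \<lceil>sqrt (real n) * x\<rceil>)"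
  have zlim: "(\<lambda>n. (real_of_int (zn n) + real_of_int j) / sqrt (real n)) \<longlonglongrightarrow> x" for j
    unfolding zn_def using x by real_asymp
  have "filterlim (\<lambda>n::nat. real_of_int (zn n)) at_top sequentially"
    unfolding zn_def using x by real_asymp
  then have zbig: "\<forall>\<^sub>F n in sequentially. zn n \<ge> z1" for z1
    unfolding filterlim_at_top by (rule eventually_mono[OF spec[of _ "real_of_int z1"]]) simp
  have ev1: "\<forall>\<^sub>F e in at_right (0::real). 0 < e \<and> e < 1"
    by (auto simp: eventually_at_right_field intro!: exI[of _ 1])
  have rV: "sqrt V > 0" using V_pos by simp
  have s1: "((\<lambda>e. \<sigma> * sqrt (1 - e)) \<longlongrightarrow> \<sigma>) (at_right 0)" "((\<lambda>e. sqrt (V * (1 + e))) \<longlongrightarrow> sqrt V) (at_right 0)"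
    "((\<lambda>e. \<sigma> * sqrt (1 + e)) \<longlongrightarrow> \<sigma>) (at_right 0)" "((\<lambda>e. sqrt (V * (1 - e))) \<longlongrightarrow> sqrt V) (at_right 0)"
    by (auto intro!: tendsto_eq_intros)
  have "(\<lambda>n. real n * u n (zn n)) \<longlonglongrightarrow> psi \<theta> \<sigma> (sqrt V) x"
  proof (rule order_tendstoI)
    fix c assume c: "psi \<theta> \<sigma> (sqrt V) x < c"
    have "((\<lambda>e. psi \<theta> (\<sigma> * sqrt (1 - e)) (sqrt (V * (1 + e))) x) \<longlongrightarrow> psi \<theta> \<sigma> (sqrt V) x) (at_right 0)"
      by (intro tendsto_psi theta rV sigma x s1 tendsto_const)
    from eventually_conj[OF order_tendstoD(2)[OF this c] ev1]
    obtain e where e: "0 < e" "e < 1" "psi \<theta> (\<sigma> * sqrt (1 - e)) (sqrt (V * (1 + e))) x < c"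
      by (metis (mono_tags, lifting) eventually_happens trivial_limit_at_right_real)
    let ?f = "psi \<theta> (\<sigma> * sqrt (1 - e)) (sqrt (V * (1 + e)))"
    have pos: "\<sigma> * sqrt (1 - e) > 0" "sqrt (V * (1 + e)) > 0" using e sigma V_pos by auto
    from sharp_upper_bound[OF e(1,2)] obtain j z1 where ev: "\<forall>\<^sub>F n in sequentially. \<forall>z\<ge>z1.
     u n z \<le> ?f ((real_of_int z + real_of_int j) / sqrt (real n)) / real n" by blast
    have "(\<lambda>n. ?f ((real_of_int (zn n) + real_of_int j) / sqrt (real n)))
       \<longlonglongrightarrow> ?f x"
      by (intro tendsto_psi theta pos x zlim tendsto_const)
    from order_tendstoD(2)[OF this e(3)] ev zbig[of z1] eventually_gt_at_top[of 0]
    show "\<forall>\<^sub>F n in sequentially. real n * u n (zn n) < c"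
    proof eventually_elim
      case (elim n)
      then have "u n (zn n) \<le> ?f ((real_of_int (zn n) + real_of_int j) / sqrt (real n)) / real n" by blast
      then have "real n * u n (zn n) \<le> ?f ((real_of_int (zn n) + real_of_int j) / sqrt (real n))"
        using elim(4) by (simp add: pos_le_divide_eq mult.commute)
      then show ?case using elim(1) by linarith
    qed
  next
    fix c assume c: "psi \<theta> \<sigma> (sqrt V) x > c"
    have "((\<lambda>e. psi \<theta> (\<sigma> * sqrt (1 + e)) (sqrt (V * (1 - e))) x) \<longlongrightarrow> psi \<theta> \<sigma> (sqrt V) x) (at_right 0)"
      by (intro tendsto_psi theta rV sigma x s1 tendsto_const)
    from eventually_conj[OF order_tendstoD(1)[OF this c] ev1]
    obtain e where e: "0 < e" "e < 1" "psi \<theta> (\<sigma> * sqrt (1 + e)) (sqrt (V * (1 - e))) x > c"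
      by (metis (mono_tags, lifting) eventually_happens trivial_limit_at_right_real)
    let ?f = "psi \<theta> (\<sigma> * sqrt (1 + e)) (sqrt (V * (1 - e)))"
    have pos: "\<sigma> * sqrt (1 + e) > 0" "sqrt (V * (1 - e)) > 0" using e sigma V_pos by auto
    from sharp_lower_bound[OF e(1,2)] obtain j where ev: "\<forall>\<^sub>F n in sequentially. \<forall>z\<ge>1.
     ?f ((real_of_int z + real_of_int j) / sqrt (real n)) / real n \<le> u n z" by blast
    have "(\<lambda>n. ?f ((real_of_int (zn n) + real_of_int j) / sqrt (real n)))
       \<longlonglongrightarrow> ?f x"
      by (intro tendsto_psi theta pos x zlim tendsto_const)
    from order_tendstoD(1)[OF this e(3)] ev zbig[of 1] eventually_gt_at_top[of 0]
    show "\<forall>\<^sub>F n in sequentially. c < real n * u n (zn n)"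
    proof eventually_elim
      case (elim n)
      then have "?f ((real_of_int (zn n) + real_of_int j) / sqrt (real n)) / real n \<le> u n (zn n)" by blast
      then have "?f ((real_of_int (zn n) + real_of_int j) / sqrt (real n)) \<le> real n * u n (zn n)"
        using elim(4) by (simp add: pos_divide_le_eq mult.commute)
      then show ?case using elim(1) by linarith
    qed
  qed
  then show ?thesis by (simp add: zn_def)
qed

end

section \<open>Uniform convergence\<close>

text \<open>Polya's argument on a half-line: the lower bound rules out a loss of mass at infinity.\<close>

lemma uniform_limit_antimono_half_line:
  fixes F :: "nat \<Rightarrow> real \<Rightarrow> real" and G :: "real \<Rightarrow> real"
  assumes F: "\<And>n x y. n \<ge> N \<Longrightarrow> x\<^sub>0 \<le> x \<Longrightarrow> x \<le> y \<Longrightarrow> F n y \<le> F n x"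
    and G: "\<And>x y. x\<^sub>0 \<le> x \<Longrightarrow> x \<le> y \<Longrightarrow> G y \<le> G x"
    and cont: "continuous_on {x\<^sub>0..} G"
    and lim: "\<And>x. x\<^sub>0 \<le> x \<Longrightarrow> (\<lambda>n. F n x) \<longlonglongrightarrow> G x"
    and inf: "(G \<longlongrightarrow> L) at_top"
    and low: "\<And>e. e > 0 \<Longrightarrow> \<forall>\<^sub>F n in sequentially. \<forall>x\<ge>x\<^sub>0. L - e \<le> F n x"
  shows "uniform_limit {x\<^sub>0..} F G sequentially"
proof (rule uniform_limitI)
  fix e :: real assume "e > 0"
  define \<epsilon> where "\<epsilon> = e / 4"
  have eps: "\<epsilon> > 0" using \<open>e > 0\<close> by (simp add: \<epsilon>_def)
  have GL: "L \<le> G x" if "x\<^sub>0 \<le> x" for x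
    by (rule tendsto_upperbound[OF inf])
       (use G that in \<open>auto simp: eventually_at_top_linorder intro!: exI[of _ x]\<close>)
  have "\<forall>\<^sub>F x in at_top. G x < L + \<epsilon> \<and> x > x\<^sub>0"
    using eps by (intro eventually_conj order_tendstoD(2)[OF inf] eventually_gt_at_top) auto
  then obtain T where T: "G T < L + \<epsilon>" "T > x\<^sub>0" by (auto simp: eventually_at_top_linorder)
  have "uniformly_continuous_on {x\<^sub>0..T} G"
    by (intro compact_uniformly_continuous continuous_on_subset[OF cont]) auto
  then obtain d where d: "d > 0" "\<And>x y. x \<in> {x\<^sub>0..T} \<Longrightarrow> y \<in> {x\<^sub>0..T} \<Longrightarrow> dist y x < d \<Longrightarrow> dist (G y) (G x) < \<epsilon>"
    using eps unfolding uniformly_continuous_on_def by metis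
  obtain m :: nat where m: "(T - x\<^sub>0) / d < real m" using reals_Archimedean2 by blast
  define h where "h = (T - x\<^sub>0) / real m"
  have m0: "real m > 0" using m T d by (intro le_less_trans[OF _ m]) auto
  have h: "0 < h" "h < d" "real m * h = T - x\<^sub>0" using m m0 T d by (auto simp: h_def field_simps)
  define t where "t = (\<lambda>i::nat. x\<^sub>0 + real i * h)"
  have t: "x\<^sub>0 \<le> t i" for i using h by (simp add: t_def)
  have tm: "t m = T" using h by (simp add: t_def)
  have tT: "t i \<le> T" if "i \<le> m" for i
    unfolding tm[symmetric] t_def using that h by (intro add_left_mono mult_right_mono) auto
  have "\<forall>\<^sub>F n in sequentially. \<forall>i\<in>{..m}. \<bar>F n (t i) - G (t i)\<bar> < \<epsilon>"
  proof (rule eventually_ball_finite)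
    show "\<forall>i\<in>{..m}. \<forall>\<^sub>F n in sequentially. \<bar>F n (t i) - G (t i)\<bar> < \<epsilon>"
      using tendstoD[OF lim[OF t] eps] by (auto simp: dist_real_def)
  qed simp
  with low[OF eps] eventually_ge_at_top[of N]
  show "\<forall>\<^sub>F n in sequentially. \<forall>x\<in>{x\<^sub>0..}. dist (F n x) (G x) < e"
  proof eventually_elim
    case (elim n)
    have near: "\<bar>F n (t i) - G (t i)\<bar> < \<epsilon>" if "i \<le> m" for i using elim(3) that by auto
    show ?case
    proof
      fix x assume "x \<in> {x\<^sub>0..}"
      then have x: "x\<^sub>0 \<le> x" by simp
      have "\<bar>F n x - G x\<bar> < 3 * \<epsilon>"
      proof (cases "x \<ge> T")
        \<comment> \<open>Beyond the last grid point T, F n and G both lie in a narrow band around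
          L: monotonicity bounds them from above by their values at T, \<open>low\<close> and
          \<open>GL\<close> bound them from below.\<close>
        case True
        have "F n x \<le> F n T" "G x \<le> G T" using F[OF elim(2)] G True T by auto
        moreover have "L - \<epsilon> \<le> F n x" using elim(1) x by auto
        moreover have "\<bar>F n T - G T\<bar> < \<epsilon>" using near[of m] tm by simp
        ultimately show ?thesis using GL[OF x] T(1) by linarith
      next
        case False
        define i where "i = nat \<lfloor>(x - x\<^sub>0) / h\<rfloor>"
        have "0 \<le> (x - x\<^sub>0) / h" using x h by simp
        then have i: "real i \<le> (x - x\<^sub>0) / h" "(x - x\<^sub>0) / h < real i + 1" unfolding i_def by linarith+
        have ti: "t i \<le> x" "x \<le> t (Suc i)"
          using i h by (auto simp: t_def field_simps)
        have "t i < t m" using ti False tm by simp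
        then have im: "i < m" unfolding t_def using h(1) by simp
        have "dist (t (Suc i)) (t i) < d" using h by (simp add: t_def dist_real_def algebra_simps)
        then have "dist (G (t (Suc i))) (G (t i)) < \<epsilon>"
          using t tT im by (intro d(2)) auto
        then have "\<bar>G (t (Suc i)) - G (t i)\<bar> < \<epsilon>" by (simp add: dist_real_def)
        moreover have "F n x \<le> F n (t i)" "F n (t (Suc i)) \<le> F n x" "G x \<le> G (t i)" "G (t (Suc i)) \<le> G x"
          using F[OF elim(2)] G ti t x by auto
        moreover have "\<bar>F n (t i) - G (t i)\<bar> < \<epsilon>" "\<bar>F n (t (Suc i)) - G (t (Suc i))\<bar> < \<epsilon>"
          using near im by auto
        ultimately show ?thesis by linarith
      qed
      then show "dist (F n x) (G x) < e" using eps by (simp add: dist_real_def \<epsilon>_def)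
    qed
  qed
qed

text \<open>Squeezed by exp (- x - 2 x^2) <= 1 - x <= exp (- x); after taking powers the quadratic
  error is 2 (n x) x, which tends to 0.\<close>

lemma tendsto_one_minus_power_exp:
  fixes x :: "nat \<Rightarrow> real"
  assumes lim: "(\<lambda>n. real n * x n) \<longlonglongrightarrow> L" and x: "\<And>n. n \<ge> N \<Longrightarrow> 0 \<le> x n \<and> x n \<le> 1"
  shows "(\<lambda>n. (1 - x n) ^ n) \<longlonglongrightarrow> exp (- L)"
proof (rule tendsto_sandwich)
  have "(\<lambda>n. (real n * x n) * (1 / real n)) \<longlonglongrightarrow> L * 0"
    by (intro tendsto_mult lim lim_const_over_n)
  moreover have "\<forall>\<^sub>F n in sequentially. (real n * x n) * (1 / real n) = x n"
    by (rule eventually_mono[OF eventually_gt_at_top[of 0]]) simp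
  ultimately have x0: "x \<longlonglongrightarrow> 0" using Lim_transform_eventually by fastforce
  have "(\<lambda>n. exp (- (real n * x n) - 2 * (real n * x n) * x n)) \<longlonglongrightarrow> exp (- L - 2 * L * 0)"
    by (intro tendsto_intros lim x0)
  then show "(\<lambda>n. exp (- (real n * x n) - 2 * (real n * x n) * x n)) \<longlonglongrightarrow> exp (- L)" by simp
  show "(\<lambda>n. exp (- (real n * x n))) \<longlonglongrightarrow> exp (- L)" by (intro tendsto_intros lim)
  have "\<forall>\<^sub>F n in sequentially. x n < 1 / 2" using order_tendstoD(2)[OF x0, of "1/2"] by simp
  with eventually_ge_at_top[of N]
  show "\<forall>\<^sub>F n in sequentially. exp (- (real n * x n) - 2 * (real n * x n) * x n) \<le> (1 - x n) ^ n"
  proof eventually_elim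
    case (elim n)
    have "- x n - 2 * (x n)\<^sup>2 \<le> ln (1 - x n)"
      using x[OF elim(1)] elim(2) by (intro ln_one_minus_pos_lower_bound) auto
    then have "exp (- x n - 2 * (x n)\<^sup>2) \<le> 1 - x n" using elim(2) by (simp add: ln_ge_iff)
    then have "exp (- x n - 2 * (x n)\<^sup>2) ^ n \<le> (1 - x n) ^ n" by (intro power_mono) auto
    also have "exp (- x n - 2 * (x n)\<^sup>2) ^ n = exp (- (real n * x n) - 2 * (real n * x n) * x n)"
      by (simp add: algebra_simps power2_eq_square flip: exp_of_nat_mult)
    finally show ?case .
  qed
  show "\<forall>\<^sub>F n in sequentially. (1 - x n) ^ n \<le> exp (- (real n * x n))"
  proof (rule eventually_mono[OF eventually_ge_at_top[of N]])
    fix n assume n: "n \<ge> N"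
    have "1 - x n \<le> exp (- x n)" using exp_ge_add_one_self[of "- x n"] by simp
    then have "(1 - x n) ^ n \<le> exp (- x n) ^ n" using x[OF n] by (intro power_mono) auto
    then show "(1 - x n) ^ n \<le> exp (- (real n * x n))" by (simp flip: exp_of_nat_mult)
  qed
qed

lemma measure_max_position_antimono:
  assumes "c \<le> d"
  shows "measure (brw_law a p n) {X. max_position X \<ge> d} \<le> measure (brw_law a p n) {X. max_position X \<ge> c}"
proof -
  interpret prob_space "brw_law a p n" by (rule prob_space_brw_law)
  have "{X \<in> space path_space. max_position X \<ge> c} \<in> sets path_space"
    using borel_measurable_max_position by measurable
  then have "{X. max_position X \<ge> c} \<in> sets (brw_law a p n)" by (simp add: brw_law_def)
  then show ?thesis using assms by (intro finite_measure_mono) auto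
qed

context near_critical
begin

lemma measure_max_position_eq:
  assumes "n \<ge> n\<^sub>0"
  shows "measure (brw_law a (q n) n) {X. max_position X \<ge> ereal c} = 1 - (1 - u n \<lceil>c\<rceil>) ^ n"
proof -
  interpret B: branching_jump a R V "q n" by (rule branching_jump_q[OF assms])
  have "n \<ge> 1" using assms n0 by linarith
  then have "(\<lambda>m. 1 - (1 - reach_prob a (q n) m \<lceil>c\<rceil>) ^ n)
      \<longlonglongrightarrow> measure (brw_law a (q n) n) {X. max_position X \<ge> ereal c}"
    by (rule tendsto_max_position_prob)
  moreover have "(\<lambda>m. 1 - (1 - reach_prob a (q n) m \<lceil>c\<rceil>) ^ n) \<longlonglongrightarrow> 1 - (1 - u n \<lceil>c\<rceil>) ^ n"
    by (intro tendsto_intros B.reach_tendsto)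
  ultimately show ?thesis by (rule LIMSEQ_unique)
qed

lemma u_bounds: "n \<ge> n\<^sub>0 \<Longrightarrow> 0 \<le> u n z \<and> u n z \<le> 1"
  using branching_jump.ever_reach_nonneg[OF branching_jump_q] branching_jump.ever_reach_le_1[OF branching_jump_q]
  by auto

text \<open>The required lower bound at infinity is 1 - exp (- 2 \<theta>^+ / \<sigma>^2), the
  limiting survival probability: it comes from the survival bound when \<theta> > 0 and is trivial
  otherwise, being 0.\<close>

lemma uniform_limit_max_position:
  assumes x0: "x\<^sub>0 > 0"
  shows "uniform_limit {x\<^sub>0..}
     (\<lambda>n x. measure (brw_law a (q n) n) {X. max_position X \<ge> ereal (sqrt (real n) * x)})
     (\<lambda>x. 1 - exp (- psi \<theta> \<sigma> (sqrt V) x)) sequentially"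
proof (rule uniform_limit_antimono_half_line[where N = n\<^sub>0 and L = "1 - exp (- (2 * max \<theta> 0 / \<sigma>\<^sup>2))"])
  let ?F = "\<lambda>n x. measure (brw_law a (q n) n) {X. max_position X \<ge> ereal (sqrt (real n) * x)}"
    and ?f = "psi \<theta> \<sigma> (sqrt V)"
  have rV: "sqrt V > 0" using V_pos by simp
  show "?F n y
     \<le> ?F n x" if "x \<le> y" for n x y
    using that by (intro measure_max_position_antimono) (auto intro!: mult_left_mono)
  show "1 - exp (- ?f y) \<le> 1 - exp (- ?f x)" if "x\<^sub>0 \<le> x" "x \<le> y" for x y
    using psi_antimono[OF theta rV _ that(2), of \<sigma>] that x0 by simp
  have "continuous_on {x\<^sub>0..} (?f)"
    by (rule DERIV_continuous_on[OF DERIV_subset[OF has_real_derivative_psi[OF theta rV]]]) (use x0 in auto)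
  then show "continuous_on {x\<^sub>0..} (\<lambda>x. 1 - exp (- ?f x))" by (intro continuous_intros)
  show "((\<lambda>x. 1 - exp (- ?f x)) \<longlongrightarrow> 1 - exp (- (2 * max \<theta> 0 / \<sigma>\<^sup>2))) at_top"
    by (intro tendsto_intros tendsto_psi_at_top theta rV)
  show "(\<lambda>n. ?F n x)
     \<longlonglongrightarrow> 1 - exp (- ?f x)" if "x\<^sub>0 \<le> x" for x
  proof -
    have "(\<lambda>n. 1 - (1 - u n \<lceil>sqrt (real n) * x\<rceil>) ^ n) \<longlonglongrightarrow> 1 - exp (- ?f x)"
      using that x0 u_bounds by (intro tendsto_intros tendsto_one_minus_power_exp[where N = n\<^sub>0] tendsto_ever_reach) auto
    moreover have "\<forall>\<^sub>F n in sequentially. 1 - (1 - u n \<lceil>sqrt (real n) * x\<rceil>) ^ n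
        = ?F n x"
      by (rule eventually_mono[OF eventually_n0]) (simp add: measure_max_position_eq)
    ultimately show ?thesis by (rule Lim_transform_eventually)
  qed
  show "\<forall>\<^sub>F n in sequentially. \<forall>x\<ge>x\<^sub>0. 1 - exp (- (2 * max \<theta> 0 / \<sigma>\<^sup>2)) - e
     \<le> ?F n x" if e: "e > 0" for e
  proof (cases "\<theta> > 0")
    case True
    define L where "L = 2 * \<theta> / \<sigma>\<^sup>2"
    have "((\<lambda>t. exp (- t)) \<longlongrightarrow> exp (- L)) (at_left L)" by (intro tendsto_intros)
    then have "\<forall>\<^sub>F t in at_left L. exp (- t) < exp (- L) + e" using e by (intro order_tendstoD(2)) auto
    moreover have "\<forall>\<^sub>F t in at_left L. t < L" by (auto simp: eventually_at_left_field intro!: exI[of _ "L - 1"])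
    ultimately have "\<forall>\<^sub>F t in at_left L. exp (- t) < exp (- L) + e \<and> t < L" by eventually_elim simp
    then obtain t where t: "exp (- t) < exp (- L) + e" "t < L"
      by (metis (mono_tags, lifting) eventually_happens trivial_limit_at_left_real)
    from survival_lower_bound[OF True t(2)[unfolded L_def]] eventually_n0 show ?thesis
    proof eventually_elim
      case (elim n)
      show ?case
      proof (intro allI impI)
        fix x assume "x\<^sub>0 \<le> x"
        let ?u = "u n \<lceil>sqrt (real n) * x\<rceil>"
        have "1 - ?u \<le> exp (- ?u)" using exp_ge_add_one_self[of "- ?u"] by simp
        then have "(1 - ?u) ^ n \<le> exp (- ?u) ^ n" using u_bounds[OF elim(2)] by (intro power_mono) auto
        also have "\<dots> = exp (- (real n * ?u))" by (simp flip: exp_of_nat_mult)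
        also have "\<dots> \<le> exp (- t)" using elim(1) by simp
        finally show "1 - exp (- (2 * max \<theta> 0 / \<sigma>\<^sup>2)) - e
           \<le> ?F n x"
          using t(1) True unfolding measure_max_position_eq[OF elim(2)] L_def by simp
      qed
    qed
  next
    case False
    then show ?thesis using e by (intro always_eventually) (auto intro: order_trans[OF _ measure_nonneg])
  qed
qed

end

theorem theorem1p9:
  fixes a :: "int pmf" and R \<sigma>R :: real
    and p :: "real \<Rightarrow> nat pmf" and s :: "real \<Rightarrow> real" and \<gamma> :: "real \<Rightarrow> ennreal"
    and \<sigma> \<theta> :: real
  assumes jump_support: "\<And>j. j \<in> set_pmf a \<Longrightarrow> \<bar>real_of_int j\<bar> \<le> R"
    and jump_mean: "measure_pmf.expectation a real_of_int = 0"
    and jump_variance: "measure_pmf.variance a real_of_int = \<sigma>R\<^sup>2" and "\<sigma>R > 0"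
    and offspring_zero: "\<And>\<eta>. \<eta> > -1 \<Longrightarrow> pmf (p \<eta>) 0 > 0"
    and offspring_mean: "\<And>\<eta>. \<eta> > -1 \<Longrightarrow> measure_pmf.expectation (p \<eta>) real = 1 + \<eta>"
    and offspring_square_integrable:
      "\<And>\<eta>. \<eta> > -1 \<Longrightarrow> integrable (measure_pmf (p \<eta>)) (\<lambda>i. (real i)\<^sup>2)"
    and offspring_variance: "\<And>\<eta>. \<eta> > -1 \<Longrightarrow> measure_pmf.variance (p \<eta>) real = (s \<eta>)\<^sup>2"
    and offspring_third_moment:
      "\<And>\<eta>. \<eta> > -1 \<Longrightarrow> (\<integral>\<^sup>+ i. ennreal (real i ^ 3) \<partial>measure_pmf (p \<eta>)) = \<gamma> \<eta>"
    and "s 0 = \<sigma>" and "(s \<longlongrightarrow> \<sigma>) (at 0)" and "\<sigma> > 0"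
    and third_moment_bound: "\<exists>\<delta>>0. (SUP \<eta>\<in>{\<eta>. -1 < \<eta> \<and> \<bar>\<eta>\<bar> < \<delta>}. \<gamma> \<eta>) < \<infinity>"
    and "\<theta> \<noteq> 0"
  shows "(\<forall>x\<^sub>0>0. uniform_limit {x\<^sub>0..}
            (\<lambda>n x. measure (brw_law a (p (\<theta> / real n)) n)
                      {X. max_position X \<ge> ereal (sqrt (real n) * x)})
            (\<lambda>x. 1 - exp (- psi \<theta> \<sigma> \<sigma>R x)) sequentially) \<and>
         solves_bvp \<theta> \<sigma> \<sigma>R (psi \<theta> \<sigma> \<sigma>R) \<and>
         (\<forall>f. solves_bvp \<theta> \<sigma> \<sigma>R f \<longrightarrow> (\<forall>x>0. f x = psi \<theta> \<sigma> \<sigma>R x)) \<and>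
         psi \<theta> \<sigma> \<sigma>R \<sim>[at_top]
           (\<lambda>x. 2 * max \<theta> 0 / \<sigma>\<^sup>2 + 12 * \<bar>\<theta>\<bar> / \<sigma>\<^sup>2 * exp (- (sqrt (2 * \<bar>\<theta>\<bar> / \<sigma>R\<^sup>2) * x)))"
proof -
  from third_moment_bound obtain \<delta> where \<delta>: "\<delta> > 0"
    and sup: "(SUP \<eta>\<in>{\<eta>. -1 < \<eta> \<and> \<bar>\<eta>\<bar> < \<delta>}. \<gamma> \<eta>) < \<infinity>" by blast
  \<comment> \<open>The supremum is finite, so this real number bounds the third moments for all
    parameters near 0 at once.\<close>
  define C where "C = enn2real (SUP \<eta>\<in>{\<eta>. -1 < \<eta> \<and> \<bar>\<eta>\<bar> < \<delta>}. \<gamma> \<eta>)"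
  have C: "C \<ge> 0" by (simp add: C_def)
  have \<gamma>_le: "\<gamma> \<eta> \<le> ennreal C" if "\<eta> > -1" "\<bar>\<eta>\<bar> < \<delta>" for \<eta>
    unfolding C_def using sup that by (auto intro!: SUP_upper)
  have "(\<lambda>n. \<bar>\<theta>\<bar> / real n) \<longlonglongrightarrow> 0" by (rule lim_const_over_n)
  then have "\<forall>\<^sub>F n in sequentially. \<bar>\<theta>\<bar> / real n < min (1 / 2) \<delta>"
    using \<delta> by (intro order_tendstoD(2)) auto
  then obtain n\<^sub>1 where n1: "\<And>n. n \<ge> n\<^sub>1 \<Longrightarrow> \<bar>\<theta>\<bar> / real n < min (1 / 2) \<delta>"
    by (auto simp: eventually_at_top_linorder)
  define n\<^sub>0 where "n\<^sub>0 = max 1 n\<^sub>1"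
  have small: "\<theta> / real n > -1" "\<bar>\<theta> / real n\<bar> < \<delta>" "\<bar>\<theta>\<bar> / real n \<le> 1 / 2" if "n \<ge> n\<^sub>0" for n
  proof -
    have "\<bar>\<theta>\<bar> / real n < min (1 / 2) \<delta>" using that by (intro n1) (simp add: n\<^sub>0_def)
    then have *: "\<bar>\<theta> / real n\<bar> < 1 / 2" "\<bar>\<theta> / real n\<bar> < \<delta>" by (simp_all add: abs_divide)
    then show "\<theta> / real n > -1" "\<bar>\<theta> / real n\<bar> < \<delta>" by linarith+
    show "\<bar>\<theta>\<bar> / real n \<le> 1 / 2" using *(1) by (simp add: abs_divide)
  qed
  have cube: "integrable (measure_pmf (p \<eta>)) (\<lambda>i. real i ^ 3)"
      "measure_pmf.expectation (p \<eta>) (\<lambda>i. real i ^ 3) \<le> C" if h: "\<eta> > -1" "\<bar>\<eta>\<bar> < \<delta>" for \<eta>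
  proof -
    have fin: "(\<integral>\<^sup>+ i. ennreal (real i ^ 3) \<partial>measure_pmf (p \<eta>)) \<le> ennreal C"
      unfolding offspring_third_moment[OF h(1)] by (rule \<gamma>_le[OF h])
    then have "(\<integral>\<^sup>+ i. ennreal (real i ^ 3) \<partial>measure_pmf (p \<eta>)) < \<infinity>"
      by (rule le_less_trans) simp
    then show int: "integrable (measure_pmf (p \<eta>)) (\<lambda>i. real i ^ 3)"
      by (intro integrableI_nonneg) auto
    have "ennreal (measure_pmf.expectation (p \<eta>) (\<lambda>i. real i ^ 3)) \<le> ennreal C"
      using fin nn_integral_eq_integral[OF int] by simp
    then show "measure_pmf.expectation (p \<eta>) (\<lambda>i. real i ^ 3) \<le> C" using C by simp
  qed
  have second: "measure_pmf.expectation (p \<eta>) (\<lambda>i. (real i)\<^sup>2) = (s \<eta>)\<^sup>2 + (1 + \<eta>)\<^sup>2" if "\<eta> > -1" for \<eta>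
    using offspring_variance[OF that] offspring_square_integrable[OF that] offspring_mean[OF that]
    by (subst (asm) measure_pmf.variance_eq) (auto intro: integrable_real_pmf)
  \<comment> \<open>The limit of s at 0 is punctured; composing it with \<theta> / n requires
    \<theta> / n to avoid 0.\<close>
  have "\<theta> / real n \<in> - {0}" if "n \<ge> 1" for n using that \<open>\<theta> \<noteq> 0\<close> by simp
  then have "filterlim (\<lambda>n. \<theta> / real n) (at 0) sequentially"
    unfolding filterlim_at using lim_const_over_n[of \<theta>] by (auto simp: eventually_at_top_linorder intro!: exI[of _ 1])
  then have slim: "(\<lambda>n. s (\<theta> / real n)) \<longlonglongrightarrow> \<sigma>" by (rule filterlim_compose[OF \<open>(s \<longlongrightarrow> \<sigma>) (at 0)\<close>])
  have fin: "finite (set_pmf a)"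
  proof (rule finite_subset)
    show "set_pmf a \<subseteq> {-\<lceil>R\<rceil>..\<lceil>R\<rceil>}"
    proof
      fix j assume "j \<in> set_pmf a"
      then have "\<bar>real_of_int j\<bar> \<le> R" by (rule jump_support)
      then show "j \<in> {-\<lceil>R\<rceil>..\<lceil>R\<rceil>}" by (auto simp: abs_le_iff) linarith+
    qed
  qed simp
  have expect: "measure_pmf.expectation a f = (\<Sum>j\<in>set_pmf a. pmf a j * f j)" for f :: "int \<Rightarrow> real"
    by (subst integral_measure_pmf_real[OF fin]) (auto simp: mult.commute)
  \<comment> \<open>The statement allows a real R, but the barrier arguments shift by an integer
    number of sites, hence \<lceil>R\<rceil>.\<close>
  interpret near_critical a "\<lceil>R\<rceil>" "\<sigma>R\<^sup>2" "\<lambda>n. p (\<theta> / real n)" \<theta> \<sigma> C n\<^sub>0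
  proof
    show "\<bar>j\<bar> \<le> \<lceil>R\<rceil>" if "j \<in> set_pmf a" for j using jump_support[OF that] by linarith
    show "(\<Sum>j\<in>set_pmf a. pmf a j * real_of_int j) = 0" using jump_mean unfolding expect .
    show "(\<Sum>j\<in>set_pmf a. pmf a j * (real_of_int j)\<^sup>2) = \<sigma>R\<^sup>2"
      using jump_variance[unfolded jump_mean] unfolding expect by simp
    show "\<sigma>R\<^sup>2 > 0" using \<open>\<sigma>R > 0\<close> by simp
    show "n\<^sub>0 \<ge> 1" by (simp add: n\<^sub>0_def)
    show "\<bar>\<theta>\<bar> / real n \<le> 1 / 2" if "n \<ge> n\<^sub>0" for n using small(3)[OF that] .
    show "integrable (measure_pmf (p (\<theta> / real n))) (\<lambda>i. (real i)\<^sup>2)" if "n \<ge> n\<^sub>0" for n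
      by (rule offspring_square_integrable[OF small(1)[OF that]])
    show "integrable (measure_pmf (p (\<theta> / real n))) (\<lambda>i. real i ^ 3)" if "n \<ge> n\<^sub>0" for n
      by (rule cube(1)[OF small(1,2)[OF that]])
    show "measure_pmf.expectation (p (\<theta> / real n)) real = 1 + \<theta> / real n" if "n \<ge> n\<^sub>0" for n
      by (rule offspring_mean[OF small(1)[OF that]])
    show "measure_pmf.expectation (p (\<theta> / real n)) (\<lambda>i. real i ^ 3) \<le> C" if "n \<ge> n\<^sub>0" for n
      by (rule cube(2)[OF small(1,2)[OF that]])
    have "(\<lambda>n. ((s (\<theta> / real n))\<^sup>2 + (1 + \<theta> / real n)\<^sup>2) - (1 + \<theta> / real n)) \<longlonglongrightarrow> (\<sigma>\<^sup>2 + (1 + 0)\<^sup>2) - (1 + 0)"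
      by (intro tendsto_intros slim lim_const_over_n)
    then have "(\<lambda>n. ((s (\<theta> / real n))\<^sup>2 + (1 + \<theta> / real n)\<^sup>2) - (1 + \<theta> / real n)) \<longlonglongrightarrow> \<sigma>\<^sup>2" by simp
    moreover have "\<forall>\<^sub>F n in sequentially. ((s (\<theta> / real n))\<^sup>2 + (1 + \<theta> / real n)\<^sup>2) - (1 + \<theta> / real n)
        = measure_pmf.expectation (p (\<theta> / real n)) (\<lambda>i. (real i)\<^sup>2) - (1 + \<theta> / real n)"
      by (rule eventually_mono[OF eventually_ge_at_top[of n\<^sub>0]]) (simp add: second small(1))
    ultimately show "(\<lambda>n. measure_pmf.expectation (p (\<theta> / real n)) (\<lambda>i. (real i)\<^sup>2) - (1 + \<theta> / real n)) \<longlonglongrightarrow> \<sigma>\<^sup>2"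
      by (rule Lim_transform_eventually)
  qed (use \<open>\<theta> \<noteq> 0\<close> \<open>\<sigma> > 0\<close> in auto)
  show ?thesis
    using uniform_limit_max_position \<open>\<sigma>R > 0\<close> \<open>\<sigma> > 0\<close> \<open>\<theta> \<noteq> 0\<close>
      solves_bvp_psi[of \<theta> \<sigma>R \<sigma>] psi_asymp_equiv[of \<theta> \<sigma>R \<sigma>]
    by (auto intro: bvp_unique)
qed

end
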